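(* Let $q=2$, $\alpha>0$, and let $\ell_0\ge2$ be an integer. Let $V=(V(t))_{t\in\mathbb Z}$ be a positive strictly stationary process with $\mathbb E\{V(0)^\alpha\}=1$ and $\mathbb E\{V(0)^{2\alpha}\}<\infty$. Independently of $V$, let $(\eta_{i,s})_{i\in\{1,2\},\,s\in\mathbb Z}$ be mutually independent standard $\alpha$-Pareto variables ($\mathbb P\{\eta_{i,s}>x\}=x^{-\alpha}$, $x\ge1$), and put $$X_i(t)=\sum_{j=0}^{\ell_0-1}V(t-j)\eta_{i,t-j},\qquad \varphi_s(t)=\mathbb I_{\{s,\dots,s+\ell_0-1\}}(t),\qquad w_\delta=\mathbb E\{V(0)^\alpha V(\delta)^\alpha\},\quad \delta\in\mathbb Z.$$ Then: (a) $X=(X_1,X_2)$ is strictly stationary and $X\in\mathrm{RV}_\Pi((\alpha,\alpha),\nu_{\mathrm{FV}};b)$ with $b_i(u)=u^\alpha$, where, for every Borel $F\ge0$ on $C(\mathbb Z,\mathbb R^2)$, $$\nu_{\mathrm{FV}}(F)=\sum_{\delta\in\mathbb Z}w_\delta\sum_{s\in\mathbb Z}\int_{(0,\infty)^2}F(r_1\varphi_s,r_2\varphi_{s+\delta})\prod_{i=1}^2\alpha r_i^{-\alpha-1}dr_i ;$$ for each fixed product window, only finitely many source pairs $(s,s+\delta)$ contribute to its $\nu_{\mathrm{FV}}$-mass. (b) For each $i\in\{1,2\}$ the scalar path-tail measure of the row $X_i$ (its one-row, $q=1$, regular-variation limit under $b(u)=u^\alpha$) is $$\nu_i^{\mathrm{sc}}(F)=\sum_{s\in\mathbb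 Z}\int_0^\infty F(r\varphi_s)\,\alpha r^{-\alpha-1}dr,\qquad F\ge0\text{ Borel on }C(\mathbb Z,\mathbb R),$$ so it does not depend on the temporal law of $V$. It is not a marginal of $\nu_{\mathrm{FV}}$: for each $i$, every nonempty finite $K\subset\mathbb Z$ and $\varepsilon>0$, $\nu_{\mathrm{FV}}\{f:\sup_{t\in K}|f_i(t)|>\varepsilon\}=\infty$. (c) For every $\ell\in\mathbb Z$, the anchor mass $p_{(0,\ell)}=\nu_{\mathrm{FV}}\{f:|f_1(0)|>1,\ |f_2(\ell)|>1\}$ equals $$p_{(0,\ell)}=\sum_{d=-(\ell_0-1)}^{\ell_0-1}(\ell_0-|d|)\,w_{\ell+d}.$$
   Context: For $q\in\{1,2\}$, $C(\mathbb Z,\mathbb R^q)$ (all functions $\mathbb Z\to\mathbb R^q$) carries the topology of pointwise convergence and its Borel $\sigma$-field. $(K_n)_{n\ge1}$ is an increasing exhaustion of $\mathbb Z$ by nonempty finite sets such that every finite subset lies in some $K_n$; $\rho_{n,i}(f)=\sup_{t\in K_n}|f_i(t)|$. Product windows are the sets $\{f:\rho_{n_i,i}(f)>\varepsilon_i,\ 1\le i\le q\}$ with $\boldsymbol n\in\mathbb N^q$, $\varepsilon\in(0,\infty)^q$. For $u\in(0,\infty)^q$, $u^{-1}\odot X=(X_i/u_i)_{1\le i\le q}$. $X\in\mathrm{RV}_\Pi(\boldsymbol\alpha,\nu;b)$, with $b_i$ regularly varying at infinity with index $\boldsymbol\alpha_i$, means: $\nu$ is a nonzero measure, carried by $\{f:f_i\not\equiv0\text{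 for all }i\}$ and finite on every product window, and $$\lim_{u\to\infty}\Big(\prod_{i=1}^qb_i(u_i)\Big)\mathbb E\{F(u^{-1}\odot X)\}=\int F\,d\nu$$ for every bounded continuous $F$ vanishing outside some product window, where $u\to\infty$ means $\min_iu_i\to\infty$ with arbitrary relative growth of the thresholds (limit along every such sequence). The scalar path-tail measure in (b) is the limit $\nu$ in this definition with $q=1$ applied to the single row $X_i$. Strict stationarity means invariance in law under all shifts of $\mathbb Z$. A source pair $(s_1,s_2)\in\mathbb Z^2$ contributes to a set $A$ if $(r_1\varphi_{s_1},r_2\varphi_{s_2})\in A$ for some $r_1,r_2>0$. *)

theory Defs
  imports "HOL-Probability.Probability"
begin

(* Paths in C(Z, R^q) are functions int => real^'q with q = CARD('q).  The topology on functions
   given by the library is the product topology, i.e. pointwise convergence, and "borel" is its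
   Borel sigma-field.  Scalar paths are the case real^1. *)

definition exhaustion :: "(nat \<Rightarrow> int set) \<Rightarrow> bool" where
  "exhaustion K \<longleftrightarrow> (\<forall>n. finite (K n) \<and> K n \<noteq> {}) \<and> incseq K \<and>
     (\<forall>S. finite S \<longrightarrow> (\<exists>n. S \<subseteq> K n))"

definition sup_on :: "int set \<Rightarrow> 'q::finite \<Rightarrow> (int \<Rightarrow> real^'q) \<Rightarrow> real" where
  "sup_on S i f = (SUP t\<in>S. \<bar>f t $ i\<bar>)"

definition product_window ::
    "(nat \<Rightarrow> int set) \<Rightarrow> ('q::finite \<Rightarrow> nat) \<Rightarrow> ('q \<Rightarrow> real) \<Rightarrow> (int \<Rightarrow> real^'q) set" where
  "product_window K n \<epsilon> = {f. \<forall>i. sup_on (K (n i)) i f > \<epsilon> i}"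

definition is_product_window :: "(nat \<Rightarrow> int set) \<Rightarrow> (int \<Rightarrow> real^'q::finite) set \<Rightarrow> bool" where
  "is_product_window K W \<longleftrightarrow> (\<exists>n \<epsilon>. (\<forall>i. \<epsilon> i > 0) \<and> W = product_window K n \<epsilon>)"

definition rescale :: "real^'q \<Rightarrow> (int \<Rightarrow> real^'q) \<Rightarrow> (int \<Rightarrow> real^'q::finite)" where
  "rescale u f = (\<lambda>t. \<chi> i. f t $ i / u $ i)"

definition regularly_varying :: "(real \<Rightarrow> real) \<Rightarrow> real \<Rightarrow> bool" where
  "regularly_varying b \<rho> \<longleftrightarrow> b \<in> borel_measurable borel \<and> (\<forall>\<^sub>F x in at_top. b x > 0) \<and>
     (\<forall>c>0. ((\<lambda>x. b (c * x) / b x) \<longlongrightarrow> c powr \<rho>) at_top)"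

definition strictly_stationary ::
    "'w measure \<Rightarrow> (int \<Rightarrow> 'w \<Rightarrow> 'b::topological_space) \<Rightarrow> bool" where
  "strictly_stationary M X \<longleftrightarrow> (\<lambda>\<omega> t. X t \<omega>) \<in> borel_measurable M \<and>
     (\<forall>h. distr M borel (\<lambda>\<omega> t. X (t + h) \<omega>) = distr M borel (\<lambda>\<omega> t. X t \<omega>))"

(* The library's indep_var needs both variables to have the same value type; this is its
   characterisation through indep_set without that restriction. *)

definition independent ::
    "'w measure \<Rightarrow> ('w \<Rightarrow> 'b::topological_space) \<Rightarrow> ('w \<Rightarrow> 'c::topological_space) \<Rightarrow> bool" where
  "independent M Y Z \<longleftrightarrow> Y \<in> borel_measurable M \<and> Z \<in> borel_measurable M \<and>
     prob_space.indep_set M {Y -` A \<inter> space M | A. A \<in> sets borel}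
                            {Z -` A \<inter> space M | A. A \<in> sets borel}"

definition RV_Pi ::
    "(nat \<Rightarrow> int set) \<Rightarrow> 'w measure \<Rightarrow> (int \<Rightarrow> 'w \<Rightarrow> real^'q::finite) \<Rightarrow>
     ('q \<Rightarrow> real) \<Rightarrow> (int \<Rightarrow> real^'q) measure \<Rightarrow> ('q \<Rightarrow> real \<Rightarrow> real) \<Rightarrow> bool" where
  "RV_Pi K M X \<alpha> \<nu> b \<longleftrightarrow>
     (\<lambda>\<omega> t. X t \<omega>) \<in> borel_measurable M \<and>
     (\<forall>i. regularly_varying (b i) (\<alpha> i)) \<and>
     sets \<nu> = sets borel \<and>
     emeasure \<nu> (space \<nu>) \<noteq> 0 \<and>
     emeasure \<nu> {f. \<not> (\<forall>i. \<exists>t. f t $ i \<noteq> 0)} = 0 \<and>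
     (\<forall>W. is_product_window K W \<longrightarrow> emeasure \<nu> W < \<infinity>) \<and>
     (\<forall>F :: (int \<Rightarrow> real^'q) \<Rightarrow> real.
        continuous_on UNIV F \<and> bounded (range F) \<and>
        (\<exists>W. is_product_window K W \<and> (\<forall>f. f \<notin> W \<longrightarrow> F f = 0)) \<longrightarrow>
        (\<forall>u :: nat \<Rightarrow> real^'q.
           (\<forall>n i. u n $ i > 0) \<and>
           filterlim (\<lambda>n. Min (range (\<lambda>i. u n $ i))) at_top sequentially \<longrightarrow>
           (\<lambda>n. (\<Prod>i\<in>UNIV. b i (u n $ i)) * (\<integral>\<omega>. F (rescale (u n) (\<lambda>t. X t \<omega>)) \<partial>M))
             \<longlonglongrightarrow> (\<integral>f. F f \<partial>\<nu>)))"

definition path_row :: "'q::finite \<Rightarrow> (int \<Rightarrow> real^'q) \<Rightarrow> (int \<Rightarrow> real^1)" where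
  "path_row i f = (\<lambda>t. vec (f t $ i))"

definition MA_process ::
    "nat \<Rightarrow> (int \<Rightarrow> 'w \<Rightarrow> real) \<Rightarrow> (2 \<Rightarrow> int \<Rightarrow> 'w \<Rightarrow> real) \<Rightarrow> int \<Rightarrow> 'w \<Rightarrow> real^2" where
  "MA_process l0 V \<eta> t \<omega> = (\<chi> i. \<Sum>j<l0. V (t - int j) \<omega> * \<eta> i (t - int j) \<omega>)"

definition phi :: "nat \<Rightarrow> int \<Rightarrow> int \<Rightarrow> real" where
  "phi l0 s t = indicator {s..s + int l0 - 1} t"

definition w_coeff :: "'w measure \<Rightarrow> (int \<Rightarrow> 'w \<Rightarrow> real) \<Rightarrow> real \<Rightarrow> int \<Rightarrow> real" where
  "w_coeff M V \<alpha> \<delta> = (\<integral>\<omega>. V 0 \<omega> powr \<alpha> * V \<delta> \<omega> powr \<alpha> \<partial>M)"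

definition single_source :: "nat \<Rightarrow> real \<Rightarrow> int \<Rightarrow> (int \<Rightarrow> real^1)" where
  "single_source l0 r s = (\<lambda>t. vec (r * phi l0 s t))"

definition source_pair :: "nat \<Rightarrow> real \<Rightarrow> int \<Rightarrow> real \<Rightarrow> int \<Rightarrow> (int \<Rightarrow> real^2)" where
  "source_pair l0 r\<^sub>1 s\<^sub>1 r\<^sub>2 s\<^sub>2 = (\<lambda>t. vector [r\<^sub>1 * phi l0 s\<^sub>1 t, r\<^sub>2 * phi l0 s\<^sub>2 t])"

definition contributes :: "nat \<Rightarrow> (int \<Rightarrow> real^2) set \<Rightarrow> int \<times> int \<Rightarrow> bool" where
  "contributes l0 A = (\<lambda>(s\<^sub>1, s\<^sub>2). \<exists>r\<^sub>1>0. \<exists>r\<^sub>2>0. source_pair l0 r\<^sub>1 s\<^sub>1 r\<^sub>2 s\<^sub>2 \<in> A)"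

text \<open>The measure \<open>\<alpha> r\<^sup>-\<^sup>\<alpha>\<^sup>-\<^sup>1 dr\<close> on \<open>(0, \<infinity>)\<close>.\<close>

definition power_tail :: "real \<Rightarrow> real measure" where
  "power_tail \<alpha> = density lborel (\<lambda>r. ennreal (\<alpha> * r powr (- \<alpha> - 1)) * indicator {0<..} r)"

definition FV_integral ::
    "real \<Rightarrow> nat \<Rightarrow> (int \<Rightarrow> real) \<Rightarrow> ((int \<Rightarrow> real^2) \<Rightarrow> ennreal) \<Rightarrow> ennreal" where
  "FV_integral \<alpha> l0 w F = (\<Sum>\<^sub>\<infinity>\<delta>\<in>UNIV. ennreal (w \<delta>) * (\<Sum>\<^sub>\<infinity>s\<in>UNIV.
     (\<integral>\<^sup>+(r\<^sub>1, r\<^sub>2). F (source_pair l0 r\<^sub>1 s r\<^sub>2 (s + \<delta>)) \<partial>(power_tail \<alpha> \<Otimes>\<^sub>M power_tail \<alpha>))))"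

definition nu_FV :: "real \<Rightarrow> nat \<Rightarrow> (int \<Rightarrow> real) \<Rightarrow> (int \<Rightarrow> real^2) measure" where
  "nu_FV \<alpha> l0 w = measure_of UNIV (sets borel) (\<lambda>A. FV_integral \<alpha> l0 w (indicator A))"

definition sc_integral :: "real \<Rightarrow> nat \<Rightarrow> ((int \<Rightarrow> real^1) \<Rightarrow> ennreal) \<Rightarrow> ennreal" where
  "sc_integral \<alpha> l0 F =
     (\<Sum>\<^sub>\<infinity>s\<in>UNIV. (\<integral>\<^sup>+r. F (single_source l0 r s) \<partial>power_tail \<alpha>))"

definition nu_sc :: "real \<Rightarrow> nat \<Rightarrow> (int \<Rightarrow> real^1) measure" where
  "nu_sc \<alpha> l0 = measure_of UNIV (sets borel) (\<lambda>A. sc_integral \<alpha> l0 (indicator A))"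

end

(*
  Write z(s) = v(s) eta(s) / u for the rescaled source sizes of one row with v fixed.  A functional G
  that vanishes outside a window needs some |z(s)| > d with s in a finite set S, so G splits over
  s in S with weights 1(|z(s)| > d) / card {s' in S. |z(s')| > d}.  In the s-th term the Pareto
  variable eta(s) is integrated first; the substitution r = v(s) eta(s) / u turns u^alpha times its
  law into v(s)^alpha times the power-tail measure restricted to r > v(s) / u, while all other
  sources tend to 0 pointwise and the weight tends to 1.  Dominated convergence gives the limit
  sum over s of v(s)^alpha times the integral of G(r phi_s), even when G itself varies with u as
  long as it converges continuously.  This last point lets the one-row limit be iterated: first in
  row 2 with row 1 frozen, then in row 1.  The bound sum of v(s1)^alpha v(s2)^alpha is integrable
  because V(0) has moments of order 2 alpha, so a final dominated convergence in v yields the weights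
  w(s2 - s1) for two rows, and E V(s)^alpha = 1 for a single row.
*)
theory Submission
  imports Defs
begin

section \<open>Power tails and Pareto variables\<close>

text \<open>All limits are first computed for \<open>ennreal\<close>-valued functionals with
  nonnegative integrals. The limit measures have infinite total mass, and in this setting Tonelli
  and the sums over sources carry no integrability conditions. Real test functions return only at
  the end, through F, -F and |F|, whose negative values \<open>ennreal\<close> truncates to 0. The
  constant \<epsilon> / l0 is a pigeonhole threshold: a sum of l0 terms above \<epsilon> has a term
  above \<epsilon> / l0. The relative growth of the two thresholds never enters, because each row
  absorbs its own factor u^\<alpha> exactly and the remaining bound does not involve u. Two
  obstacles lie outside the limit theorem. \<open>nu_FV\<close> and \<open>nu_sc\<close> come from
  \<open>measure_of\<close>, so they must be identified with genuine image measures before their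
  integrals can be evaluated. And "the" path-tail measure of a row presupposes uniqueness: test
  functions determine the limit on each window, the windows exhaust the paths without a zero row,
  and the other paths form a null set.\<close>

lemma infsum_int_eq_nn_integral:
  fixes f :: "int \<Rightarrow> ennreal"
  shows "(\<Sum>\<^sub>\<infinity>x\<in>UNIV. f x) = (\<integral>\<^sup>+x. f x \<partial>count_space UNIV)"
proof (rule antisym)
  have eq: "(\<Sum>\<^sub>\<infinity>x\<in>UNIV. f x) = (SUP A\<in>{A. finite A \<and> A \<subseteq> UNIV}. sum f A)"
    by (rule nonneg_infsum_complete) simp
  show "(\<Sum>\<^sub>\<infinity>x\<in>UNIV. f x) \<le> (\<integral>\<^sup>+x. f x \<partial>count_space UNIV)"
    unfolding eq
  proof (rule SUP_least)
    fix A :: "int set" assume A: "A \<in> {A. finite A \<and> A \<subseteq> UNIV}"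
    have "sum f A = (\<integral>\<^sup>+x. f x * indicator A x \<partial>count_space UNIV)"
      using A by (subst nn_integral_count_space'[of A]) (auto intro!: sum.cong)
    also have "\<dots> \<le> (\<integral>\<^sup>+x. f x \<partial>count_space UNIV)"
      by (intro nn_integral_mono) (auto simp: indicator_def)
    finally show "sum f A \<le> (\<integral>\<^sup>+x. f x \<partial>count_space UNIV)" .
  qed
  \<comment> \<open>An enumeration of the integers turns the integral into a series whose partial
    sums are sums over finite sets, hence below the supremum in \<open>eq\<close>.\<close>
  have b: "bij_betw (from_nat_into (UNIV :: int set)) UNIV UNIV"
    by (rule bij_betw_from_nat_into) (auto simp: infinite_UNIV_int)
  have "(\<integral>\<^sup>+x. f x \<partial>count_space UNIV) = (\<Sum>n. f (from_nat_into UNIV n))"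
    by (subst nn_integral_bij_count_space[OF b, symmetric]) (simp add: nn_integral_count_space_nat)
  also have "\<dots> = (SUP n. \<Sum>i<n. f (from_nat_into UNIV i))"
    by (rule suminf_eq_SUP)
  also have "\<dots> \<le> (\<Sum>\<^sub>\<infinity>x\<in>UNIV. f x)"
    unfolding eq
  proof (rule SUP_mono, rule bexI)
    fix n
    have "inj_on (from_nat_into (UNIV :: int set)) {..<n}"
      using b by (meson bij_betw_imp_inj_on inj_on_subset subset_UNIV)
    then show "(\<Sum>i<n. f (from_nat_into UNIV i)) \<le> sum f (from_nat_into UNIV ` {..<n})"
      by (simp add: sum.reindex)
  qed auto
  finally show "(\<integral>\<^sup>+x. f x \<partial>count_space UNIV) \<le> (\<Sum>\<^sub>\<infinity>x\<in>UNIV. f x)" .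
qed

lemma sets_power_tail [simp, measurable_cong]: "sets (power_tail \<alpha>) = sets borel"
  by (simp add: power_tail_def)

lemma space_power_tail [simp]: "space (power_tail \<alpha>) = UNIV"
  by (simp add: power_tail_def)

lemma nn_integral_power_tail:
  assumes "g \<in> borel_measurable borel"
  shows "(\<integral>\<^sup>+r. g r \<partial>power_tail \<alpha>) =
    (\<integral>\<^sup>+r. ennreal (\<alpha> * r powr (- \<alpha> - 1)) * indicator {0<..} r * g r \<partial>lborel)"
  using assms by (simp add: power_tail_def nn_integral_density)

lemma emeasure_power_tail_greaterThan:
  assumes "\<alpha> > 0" "c > 0"
  shows "emeasure (power_tail \<alpha>) {c<..} = ennreal (c powr - \<alpha>)"
proof -
  have "emeasure (power_tail \<alpha>) {c<..} = (\<integral>\<^sup>+r. indicator {c<..} r \<partial>power_tail \<alpha>)"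
    by simp
  also have "\<dots> = (\<integral>\<^sup>+r. ennreal (\<alpha> * r powr (- \<alpha> - 1)) * indicator {0<..} r * indicator {c<..} r \<partial>lborel)"
    by (rule nn_integral_power_tail) simp
  \<comment> \<open>Adding the endpoint changes only a Lebesgue null set and gives the closed
    half-line on which the fundamental theorem is applied.\<close>
  also have "\<dots> = (\<integral>\<^sup>+r. ennreal (\<alpha> * r powr (- \<alpha> - 1)) * indicator {c..} r \<partial>lborel)"
    using AE_lborel_singleton[of c] assms
    by (intro nn_integral_cong_AE) (auto elim!: eventually_mono simp: indicator_def)
  also have "\<dots> = ennreal (0 - (- (c powr - \<alpha>)))"
  proof (rule nn_integral_FTC_atLeast)
    show "((\<lambda>r. - (r powr - \<alpha>)) has_real_derivative \<alpha> * r powr (- \<alpha> - 1)) (at r)" if "c \<le> r" for r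
      using that assms by (auto intro!: derivative_eq_intros simp: powr_diff field_simps)
    have "((\<lambda>r. r powr - \<alpha>) \<longlongrightarrow> 0) at_top"
      using assms by (intro tendsto_neg_powr filterlim_ident) auto
    from tendsto_minus[OF this] show "((\<lambda>r. - (r powr - \<alpha>)) \<longlongrightarrow> 0) at_top" by simp
  qed (use assms in auto)
  finally show ?thesis by simp
qed

lemma emeasure_power_tail_nonpos: "emeasure (power_tail \<alpha>) {..0} = 0"
proof -
  have "emeasure (power_tail \<alpha>) {..0} = (\<integral>\<^sup>+r. indicator {..0} r \<partial>power_tail \<alpha>)"
    by simp
  also have "\<dots> = (\<integral>\<^sup>+r. ennreal (\<alpha> * r powr (- \<alpha> - 1)) * indicator {0<..} r * indicator {..0} r \<partial>lborel)"
    by (rule nn_integral_power_tail) simp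
  also have "\<dots> = (\<integral>\<^sup>+r. 0 \<partial>(lborel :: real measure))"
    by (rule nn_integral_cong) (auto simp: indicator_def)
  finally show ?thesis by simp
qed

lemma AE_power_tail_pos: "AE r in power_tail \<alpha>. 0 < r"
  by (rule AE_I[OF _ emeasure_power_tail_nonpos]) auto

text \<open>The mass is infinite only near 0, so half-lines bounded away from 0, together with the
  null set \<open>{..0}\<close>, form a cover. This is what licenses Tonelli for two radii.\<close>

lemma sigma_finite_power_tail:
  assumes "\<alpha> > 0"
  shows "sigma_finite_measure (power_tail \<alpha>)"
proof
  have "\<exists>n. r > 1 / real (Suc n)" if "r > 0" for r :: real
    using reals_Archimedean[OF that] by (auto simp: inverse_eq_divide)
  then have "(\<Union>n. {1 / real (Suc n)<..}) \<union> {..0} = (UNIV :: real set)"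
    by (auto simp: not_le) (metis not_le)
  then show "\<exists>A. countable A \<and> A \<subseteq> sets (power_tail \<alpha>) \<and> \<Union>A = space (power_tail \<alpha>) \<and>
      (\<forall>a\<in>A. emeasure (power_tail \<alpha>) a \<noteq> \<infinity>)"
    using assms
    by (intro exI[of _ "insert {..0} (range (\<lambda>n. {1 / real (Suc n)<..}))"])
      (auto simp: emeasure_power_tail_nonpos emeasure_power_tail_greaterThan simp del: of_nat_Suc)
qed

text \<open>The small radii carry infinite mass. This is the origin of the infinite row marginals of
  \<open>nu_FV\<close>: a row without a size constraint contributes the whole power tail.\<close>

lemma emeasure_power_tail_UNIV:
  assumes "\<alpha> > 0"
  shows "emeasure (power_tail \<alpha>) UNIV = \<infinity>"
proof (rule ccontr)
  assume "emeasure (power_tail \<alpha>) UNIV \<noteq> \<infinity>"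
  then obtain m where m: "emeasure (power_tail \<alpha>) UNIV = ennreal m" "m \<ge> 0"
    by (cases "emeasure (power_tail \<alpha>) UNIV") auto
  \<comment> \<open>Chosen so that \<open>c powr - \<alpha>\<close> equals
    \<open>m + 1\<close>.\<close>
  define c where "c = (m + 1) powr (- 1 / \<alpha>)"
  have c: "c > 0" using m by (simp add: c_def)
  have "ennreal (m + 1) = emeasure (power_tail \<alpha>) {c<..}"
    using assms c m by (simp add: emeasure_power_tail_greaterThan) (simp add: c_def powr_powr)
  also have "\<dots> \<le> ennreal m"
    unfolding m(1)[symmetric] by (rule emeasure_mono) auto
  finally show False using m(2) by (simp add: ennreal_le_iff)
qed

text \<open>Homogeneity of the power tail, by the linear substitution r = a r'. With a = v(s) / u it
  converts the law of a rescaled Pareto variable into a power tail with a weight.\<close>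

lemma nn_integral_power_tail_scale:
  assumes "a > 0" and [measurable]: "g \<in> borel_measurable borel"
  shows "(\<integral>\<^sup>+r. g r \<partial>power_tail \<alpha>) = ennreal (a powr \<alpha>) * (\<integral>\<^sup>+r. g (r / a) \<partial>power_tail \<alpha>)"
proof -
  have "(\<integral>\<^sup>+r. g r \<partial>power_tail \<alpha>) =
      (\<integral>\<^sup>+r. ennreal (\<alpha> * r powr (- \<alpha> - 1)) * indicator {0<..} r * g r \<partial>lborel)"
    by (simp add: nn_integral_power_tail)
  also have "\<dots> = ennreal (1 / a) *
      (\<integral>\<^sup>+r. ennreal (\<alpha> * (r / a) powr (- \<alpha> - 1)) * indicator {0<..} (r / a) * g (r / a) \<partial>lborel)"
    using assms(1) by (subst nn_integral_real_affine[where c = "1 / a" and t = 0]) auto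
  also have "\<dots> = (\<integral>\<^sup>+r. ennreal (1 / a) * (ennreal (\<alpha> * (r / a) powr (- \<alpha> - 1)) * indicator {0<..} (r / a) * g (r / a)) \<partial>lborel)"
    by (rule nn_integral_cmult[symmetric]) simp
  also have "\<dots> = (\<integral>\<^sup>+r. ennreal (a powr \<alpha>) * (ennreal (\<alpha> * r powr (- \<alpha> - 1)) * indicator {0<..} r * g (r / a)) \<partial>lborel)"
  proof (rule nn_integral_cong)
    fix r :: real
    have "1 / a * (\<alpha> * (r / a) powr (- \<alpha> - 1)) = a powr \<alpha> * (\<alpha> * r powr (- \<alpha> - 1))" if "r > 0"
      using that assms(1) by (simp add: powr_divide powr_diff powr_minus field_simps)
    then show "ennreal (1 / a) * (ennreal (\<alpha> * (r / a) powr (- \<alpha> - 1)) * indicator {0<..} (r / a) * g (r / a)) =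
        ennreal (a powr \<alpha>) * (ennreal (\<alpha> * r powr (- \<alpha> - 1)) * indicator {0<..} r * g (r / a))"
      using assms(1)
      by (cases "r > 0") (auto simp: mult.assoc[symmetric] ennreal_mult'[symmetric] zero_less_divide_iff)
  qed
  also have "\<dots> = ennreal (a powr \<alpha>) * (\<integral>\<^sup>+r. g (r / a) \<partial>power_tail \<alpha>)"
    by (subst nn_integral_cmult) (auto simp: nn_integral_power_tail)
  finally show ?thesis .
qed

text \<open>The half-line beyond 1 has power-tail mass exactly 1, so restriction alone already
  normalises. In this form the scaling of Pareto variables becomes homogeneity of
  \<open>power_tail\<close>.\<close>

definition pareto :: "real \<Rightarrow> real measure" where
  "pareto \<alpha> = density (power_tail \<alpha>) (indicator {1<..})"

lemma sets_pareto [simp, measurable_cong]: "sets (pareto \<alpha>) = sets borel"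
  by (simp add: pareto_def)

lemma space_pareto [simp]: "space (pareto \<alpha>) = UNIV"
  by (simp add: pareto_def)

lemma emeasure_pareto:
  "A \<in> sets borel \<Longrightarrow> emeasure (pareto \<alpha>) A = emeasure (power_tail \<alpha>) ({1<..} \<inter> A)"
  by (simp add: pareto_def emeasure_restricted Int_def)

lemma prob_space_pareto: "\<alpha> > 0 \<Longrightarrow> prob_space (pareto \<alpha>)"
  by (rule prob_spaceI) (simp add: emeasure_pareto emeasure_power_tail_greaterThan)

lemma pareto_unique:
  assumes "\<alpha> > 0" "prob_space N" "sets N = sets borel"
    and tail: "\<And>x. x \<ge> 1 \<Longrightarrow> measure N {x<..} = x powr - \<alpha>"
  shows "N = pareto \<alpha>"
proof (rule cdf_unique)
  interpret N: prob_space N by fact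
  interpret p: prob_space "pareto \<alpha>" using assms(1) by (rule prob_space_pareto)
  have sp: "space N = UNIV" using sets_eq_imp_space_eq[OF assms(3)] by simp
  show "real_distribution N" "real_distribution (pareto \<alpha>)"
    using assms(3) by unfold_locales auto
  have N: "measure N {..x} = 1 - measure N {x<..}" for x
    using N.prob_compl[of "{x<..}"] assms(3) sp
    by (simp add: Compl_eq_Diff_UNIV[symmetric] del: Compl_eq_Diff_UNIV)
  have p: "measure (pareto \<alpha>) {..x} = 1 - measure (pareto \<alpha>) {x<..}" for x
    using p.prob_compl[of "{x<..}"]
    by (simp add: Compl_eq_Diff_UNIV[symmetric])
  have pt: "measure (pareto \<alpha>) {x<..} = (max 1 x) powr - \<alpha>" for x
  proof -
    have "{1<..} \<inter> {x<..} = {max 1 x<..}" by auto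
    then show ?thesis
      using assms(1) by (simp add: measure_def emeasure_pareto emeasure_power_tail_greaterThan)
  qed
  have Nt: "measure N {x<..} = (max 1 x) powr - \<alpha>" for x
  proof (cases "x \<ge> 1")
    case False
    \<comment> \<open>The tail formula is only assumed from 1 on, but its value at 1 puts all the
      mass beyond 1, which fixes the tail at every smaller x.\<close>
    have "1 = measure N {1<..}" using tail[of 1] by simp
    also have "\<dots> \<le> measure N {x<..}"
      using False assms(3) by (intro N.finite_measure_mono) auto
    finally show ?thesis using False N.prob_le_1[of "{x<..}"] by (simp add: max_def)
  qed (use tail[of x] in \<open>simp add: max_def\<close>)
  show "cdf N = cdf (pareto \<alpha>)"
    by (auto simp: cdf_def N p pt Nt)
qed

section \<open>The one-row limit for a deterministic volatility\<close>

definition pareto_seq :: "real \<Rightarrow> (int \<Rightarrow> real) measure" where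
  "pareto_seq \<alpha> = PiM UNIV (\<lambda>_. pareto \<alpha>)"

definition moving_sum :: "nat \<Rightarrow> (int \<Rightarrow> real) \<Rightarrow> int \<Rightarrow> real" where
  "moving_sum l0 z t = (\<Sum>j<l0. z (t - int j))"

text \<open>The image form makes finiteness immediate; \<open>sources_iff\<close> then shows that
  these are the indices whose pulse \<open>phi\<close> meets K.\<close>

definition sources :: "nat \<Rightarrow> int set \<Rightarrow> int set" where
  "sources l0 K = (\<lambda>(t, j). t - int j) ` (K \<times> {..<l0})"

text \<open>The weights \<open>1 / card {s' \<in> S. \<bar>z s'\<bar> > d}\<close> form a partition of unity on the event that
  some source exceeds \<open>d\<close>, so no error term for several simultaneous large sources is needed.\<close>

definition source_share ::
    "nat \<Rightarrow> int set \<Rightarrow> real \<Rightarrow> ((int \<Rightarrow> real) \<Rightarrow> ennreal) \<Rightarrow> int \<Rightarrow> (int \<Rightarrow> real) \<Rightarrow> ennreal" where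
  "source_share l0 S d G s z =
     indicator {d<..} \<bar>z s\<bar> * (G (moving_sum l0 z) / (\<Sum>s'\<in>S. indicator {d<..} \<bar>z s'\<bar>))"

lemma finite_sources: "finite K \<Longrightarrow> finite (sources l0 K)"
  by (simp add: sources_def)

lemma sources_iff: "s \<in> sources l0 K \<longleftrightarrow> (\<exists>t\<in>K. s \<le> t \<and> t < s + int l0)"
proof
  assume "\<exists>t\<in>K. s \<le> t \<and> t < s + int l0"
  then obtain t where "t \<in> K" "s \<le> t" "t < s + int l0" by auto
  then show "s \<in> sources l0 K"
    unfolding sources_def by (intro image_eqI[of _ _ "(t, nat (t - s))"]) auto
next
  assume "s \<in> sources l0 K"
  then obtain t j where "t \<in> K" "j < l0" "s = t - int j" by (auto simp: sources_def)
  then show "\<exists>t\<in>K. s \<le> t \<and> t < s + int l0" by (intro bexI[of _ t]) auto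
qed

lemma phi_eq: "phi l0 s t = (if s \<le> t \<and> t < s + int l0 then 1 else 0)"
  by (auto simp: phi_def indicator_def)

lemma phi_eq_0: "t \<in> K \<Longrightarrow> s \<notin> sources l0 K \<Longrightarrow> phi l0 s t = 0"
  by (auto simp: phi_eq sources_iff)

text \<open>The pulse \<open>phi l0 s\<close> is the response of the moving sum to one unit source
  at s. A path with a single surviving source is therefore a multiple of it, which is why the limit
  lives on such paths.\<close>

lemma moving_sum_single:
  "moving_sum l0 ((\<lambda>_. 0)(s := r)) t = r * phi l0 s t"
proof -
  have "moving_sum l0 ((\<lambda>_. 0)(s := r)) t = (\<Sum>j<l0. if j = nat (t - s) \<and> s \<le> t then r else 0)"
    unfolding moving_sum_def by (intro sum.cong) auto
  also have "\<dots> = r * phi l0 s t"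
    by (cases "s \<le> t") (auto simp: phi_eq nat_less_iff)
  finally show ?thesis .
qed

text \<open>Pigeonhole over the l0 summands of X(t).\<close>

lemma large_source:
  assumes "l0 > 0" "t \<in> K" "\<bar>moving_sum l0 z t\<bar> > \<epsilon>"
  shows "\<exists>s\<in>sources l0 K. \<bar>z s\<bar> > \<epsilon> / real l0"
proof (rule ccontr)
  assume *: "\<not> ?thesis"
  have "\<bar>moving_sum l0 z t\<bar> \<le> (\<Sum>j<l0. \<bar>z (t - int j)\<bar>)"
    unfolding moving_sum_def by (rule sum_abs)
  also have "\<dots> \<le> (\<Sum>j<l0. \<epsilon> / real l0)"
    using * assms(2) by (intro sum_mono) (force simp: sources_def not_less)
  also have "\<dots> = \<epsilon>" using assms(1) by simp
  finally show False using assms(3) by simp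
qed

text \<open>The shares have a common denominator, the number of large sources. It is nonzero because
  one source is large and finite because S is, which is exactly what cancellation in
  \<open>ennreal\<close> requires.\<close>

lemma sum_source_share:
  assumes "finite S" "\<exists>s\<in>S. \<bar>z s\<bar> > d"
  shows "(\<Sum>s\<in>S. source_share l0 S d G s z) = G (moving_sum l0 z)"
proof -
  define N :: ennreal where "N = (\<Sum>s'\<in>S. indicator {d<..} \<bar>z s'\<bar>)"
  obtain s where s: "s \<in> S" "\<bar>z s\<bar> > d" using assms(2) by auto
  have "indicator {d<..} \<bar>z s\<bar> \<le> N"
    unfolding N_def using assms(1) s by (intro member_le_sum) auto
  then have "N \<noteq> 0" using s by auto
  moreover have "N < \<top>"
    unfolding N_def using assms(1) by (subst ennreal_sum_less_top) (auto simp: indicator_def)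
  moreover have "(\<Sum>s\<in>S. source_share l0 S d G s z) = N * (G (moving_sum l0 z) / N)"
    by (simp add: source_share_def N_def sum_distrib_right)
  ultimately show ?thesis
    by (simp add: ennreal_times_divide mult.commute[of N] mult_divide_eq_ennreal)
qed

text \<open>Where the share of s is not 0, the source s counts itself in the denominator, so the
  denominator is at least 1. The bound thus involves no source other than s.\<close>

lemma source_share_le:
  assumes "finite S" "s \<in> S" "\<And>x. G x \<le> C"
  shows "source_share l0 S d G s z \<le> C * indicator {d<..} \<bar>z s\<bar>"
proof (cases "\<bar>z s\<bar> > d")
  case True
  define N :: ennreal where "N = (\<Sum>s'\<in>S. indicator {d<..} \<bar>z s'\<bar>)"
  have "indicator {d<..} \<bar>z s\<bar> \<le> N"
    unfolding N_def using assms by (intro member_le_sum) auto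
  then have N: "1 \<le> N" using True by simp
  have "G (moving_sum l0 z) / N \<le> G (moving_sum l0 z) / 1"
    using N by (cases N; cases "G (moving_sum l0 z)")
      (auto simp: ennreal_top_divide divide_ennreal divide_le_eq mult_le_cancel_left1 divide_ennreal_def[of _ 1] intro!: ennreal_leI)
  also have "\<dots> \<le> C" using assms(3) by (simp add: divide_ennreal_def)
  finally show ?thesis using True by (simp add: source_share_def N_def)
qed (simp add: source_share_def)

lemma tendsto_moving_sum:
  assumes "\<And>s. (\<lambda>n. z n s) \<longlonglongrightarrow> y s"
  shows "(\<lambda>n. moving_sum l0 (z n) t) \<longlonglongrightarrow> moving_sum l0 y t"
  unfolding moving_sum_def by (intro tendsto_sum assms)

text \<open>All sources in S other than s eventually fall below d, so the denominator counts s alone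
  and equals 1 when r > d. Coordinate s is frozen at r, so the jump of the indicator at d does no
  harm.\<close>

lemma source_share_tendsto:
  assumes "finite S" "s \<in> S" "d > 0" "r > 0"
    and z: "\<And>s. (\<lambda>n. z n s) \<longlonglongrightarrow> 0"
    and cc: "\<And>x y. (\<And>t. (\<lambda>n. x n t) \<longlonglongrightarrow> y t) \<Longrightarrow> (\<lambda>n. G n (x n)) \<longlonglongrightarrow> H y"
  shows "(\<lambda>n. source_share l0 S d (G n) s ((z n)(s := r))) \<longlonglongrightarrow>
    indicator {d<..} r * H (\<lambda>t. r * phi l0 s t)"
proof -
  have "\<forall>\<^sub>F n in sequentially. \<forall>s'\<in>S. \<bar>z n s'\<bar> < d"
    using assms(1,3) tendsto_rabs_zero[OF z]
    by (intro eventually_ball_finite ballI) (auto dest: order_tendstoD(2))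
  then have ev: "\<forall>\<^sub>F n in sequentially.
      indicator {d<..} r * G n (moving_sum l0 ((z n)(s := r))) =
      source_share l0 S d (G n) s ((z n)(s := r))"
  proof eventually_elim
    case (elim n)
    have "(\<Sum>s'\<in>S. indicator {d<..} \<bar>((z n)(s := r)) s'\<bar>) =
        (\<Sum>s'\<in>S. if s' = s then indicator {d<..} r else 0 :: ennreal)"
      using elim assms(4) by (intro sum.cong) (auto simp: indicator_def)
    then show ?case
      using assms(1,2,4) by (cases "r > d") (auto simp: source_share_def divide_ennreal_def)
  qed
  have z': "(\<lambda>n. ((z n)(s := r)) s') \<longlonglongrightarrow> ((\<lambda>_. 0)(s := r)) s'" for s'
    using z[of s'] by (cases "s' = s") simp_all
  have m: "moving_sum l0 ((\<lambda>_. 0)(s := r)) = (\<lambda>t. r * phi l0 s t)"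
    by (rule ext) (rule moving_sum_single)
  have "(\<lambda>n. G n (moving_sum l0 ((z n)(s := r)))) \<longlonglongrightarrow> H (moving_sum l0 ((\<lambda>_. 0)(s := r)))"
    by (rule cc) (rule tendsto_moving_sum, rule z')
  then have "(\<lambda>n. indicator {d<..} r * G n (moving_sum l0 ((z n)(s := r)))) \<longlonglongrightarrow>
      indicator {d<..} r * H (\<lambda>t. r * phi l0 s t)"
    unfolding m by (rule ennreal_tendsto_cmult[rotated]) (simp add: indicator_def)
  then show ?thesis using ev by (rule Lim_transform_eventually)
qed

section \<open>Measurability on path space and the law of an i.i.d. Pareto sequence\<close>

lemma measurable_into_path:
  fixes f :: "'a \<Rightarrow> int \<Rightarrow> 'b::second_countable_topology"
  assumes "\<And>t. (\<lambda>x. f x t) \<in> borel_measurable N"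
  shows "f \<in> borel_measurable N"
  using assms by (rule measurable_coordinatewise_then_product)

text \<open>Time is countable and the factors are second countable, so the product sigma-field is
  the Borel field of pointwise convergence. Product-measure and Borel arguments can therefore be
  mixed.\<close>

lemma sets_pareto_seq [simp, measurable_cong]: "sets (pareto_seq \<alpha>) = sets borel"
proof -
  have "sets (pareto_seq \<alpha>) = sets (PiM UNIV (\<lambda>_::int. borel :: real measure))"
    unfolding pareto_seq_def by (rule sets_PiM_cong) auto
  then show ?thesis by (simp add: sets_PiM_equal_borel)
qed

lemma space_pareto_seq [simp]: "space (pareto_seq \<alpha>) = UNIV"
  using sets_eq_imp_space_eq[OF sets_pareto_seq] by simp

lemma prob_space_pareto_seq: "\<alpha> > 0 \<Longrightarrow> prob_space (pareto_seq \<alpha>)"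
  unfolding pareto_seq_def by (intro prob_space_PiM prob_space_pareto)

lemma emeasure_pareto_seq_UNIV: "\<alpha> > 0 \<Longrightarrow> emeasure (pareto_seq \<alpha>) UNIV = 1"
  using prob_space.emeasure_space_1[OF prob_space_pareto_seq] by simp

lemma borel_measurable_path_component:
  fixes f :: "'a \<Rightarrow> int \<Rightarrow> 'b::second_countable_topology"
  assumes "f \<in> borel_measurable N"
  shows "(\<lambda>x. f x t) \<in> borel_measurable N"
  using assms by (rule measurable_product_then_coordinatewise)

lemma borel_measurable_coordinate:
  "(\<lambda>x :: int \<Rightarrow> 'b::second_countable_topology. x t) \<in> borel_measurable borel"
  by (rule borel_measurable_path_component) simp

lemma borel_measurable_moving_sum [measurable]:
  "moving_sum l0 \<in> borel_measurable borel"
  unfolding moving_sum_def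
  by (rule measurable_into_path) (intro borel_measurable_sum borel_measurable_coordinate)

lemma borel_measurable_fun_upd:
  fixes f :: "'a \<Rightarrow> int \<Rightarrow> real"
  assumes f: "f \<in> borel_measurable N" and g: "g \<in> borel_measurable N"
  shows "(\<lambda>x. (f x)(s := g x)) \<in> borel_measurable N"
proof (rule measurable_into_path)
  fix t
  have "(\<lambda>x. ((f x)(s := g x)) t) = (if t = s then g else (\<lambda>x. f x t))" by auto
  then show "(\<lambda>x. ((f x)(s := g x)) t) \<in> borel_measurable N"
    using g borel_measurable_path_component[OF f] by presburger
qed

lemma borel_measurable_resample:
  fixes h :: "'a \<Rightarrow> int \<Rightarrow> real"
  assumes "sets N = sets borel" "h \<in> borel_measurable L"
  shows "(\<lambda>p. (h (snd p))(s := fst p :: real)) \<in> borel_measurable (N \<Otimes>\<^sub>M L)"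
proof (rule borel_measurable_fun_upd)
  show "(\<lambda>p. h (snd p)) \<in> borel_measurable (N \<Otimes>\<^sub>M L)"
    by (rule measurable_compose[OF measurable_snd assms(2)])
  show "fst \<in> borel_measurable (N \<Otimes>\<^sub>M L)"
    using measurable_fst[of N L] measurable_cong_sets[OF refl assms(1)] by blast
qed

lemma borel_measurable_source_share [measurable]:
  assumes G: "G \<in> borel_measurable borel"
  shows "source_share l0 S d G s \<in> borel_measurable borel"
proof -
  have "(\<lambda>z. indicator {d<..} \<bar>z s\<bar> :: ennreal) \<in> borel_measurable borel" for s :: int
    by (rule measurable_compose[OF borel_measurable_coordinate]) measurable
  then show ?thesis
    unfolding source_share_def[abs_def] divide_ennreal_def
    by (intro borel_measurable_times_ennreal borel_measurable_inverse_ennreal borel_measurable_sum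
        measurable_compose[OF borel_measurable_moving_sum G])
qed

text \<open>Replacing one coordinate of an i.i.d. sequence by an independent copy leaves the law
  unchanged. This isolates one Pareto variable while keeping a full sequence as the rest.\<close>

lemma nn_integral_pareto_seq_resample:
  assumes "\<alpha> > 0" and [measurable]: "g \<in> borel_measurable borel"
  shows "(\<integral>\<^sup>+e. g e \<partial>pareto_seq \<alpha>) = (\<integral>\<^sup>+x. \<integral>\<^sup>+e. g (e(s := x)) \<partial>pareto_seq \<alpha> \<partial>pareto \<alpha>)"
proof -
  interpret prob_space "pareto_seq \<alpha>"
    using assms(1) by (rule prob_space_pareto_seq)
  have m0: "(\<lambda>p. (snd p)(s := fst p)) \<in> borel_measurable (pareto \<alpha> \<Otimes>\<^sub>M pareto_seq \<alpha>)"
    by (rule borel_measurable_resample) (simp_all add: measurable_ident_sets)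
  have m: "(\<lambda>(x, e). e(s := x)) \<in> measurable (pareto \<alpha> \<Otimes>\<^sub>M pareto_seq \<alpha>) (pareto_seq \<alpha>)"
    using m0 unfolding split_beta' measurable_cong_sets[OF refl sets_pareto_seq] .
  have pp: "prob_space (pareto \<alpha>)"
    using assms(1) by (rule prob_space_pareto)
  \<comment> \<open>The index s already belongs to \<open>UNIV\<close>, so inserting it gives
    \<open>UNIV\<close> back and the coordinate is overwritten rather than added.\<close>
  have eq: "distr (pareto \<alpha> \<Otimes>\<^sub>M pareto_seq \<alpha>) (pareto_seq \<alpha>) (\<lambda>(x, e). e(s := x)) = pareto_seq \<alpha>"
    using distr_pair_PiM_eq_PiM[of UNIV "\<lambda>_. pareto \<alpha>" s, OF pp pp]
    unfolding pareto_seq_def insert_UNIV .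
  have "(\<integral>\<^sup>+e. g e \<partial>pareto_seq \<alpha>) =
      (\<integral>\<^sup>+e. g e \<partial>distr (pareto \<alpha> \<Otimes>\<^sub>M pareto_seq \<alpha>) (pareto_seq \<alpha>) (\<lambda>(x, e). e(s := x)))"
    unfolding eq ..
  also have "\<dots> = (\<integral>\<^sup>+p. g ((snd p)(s := fst p)) \<partial>(pareto \<alpha> \<Otimes>\<^sub>M pareto_seq \<alpha>))"
    by (subst nn_integral_distr[OF m]) (simp_all add: split_beta')
  also have "\<dots> = (\<integral>\<^sup>+x. \<integral>\<^sup>+e. g (e(s := x)) \<partial>pareto_seq \<alpha> \<partial>pareto \<alpha>)"
    by (subst nn_integral_fst[symmetric]) (simp_all add: measurable_compose[OF m0 assms(2)])
  finally show ?thesis .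
qed

section \<open>Integrating out one source exactly, and the resulting limit theorem for one
  row\<close>

definition scaled_noise :: "(int \<Rightarrow> real) \<Rightarrow> real \<Rightarrow> (int \<Rightarrow> real) \<Rightarrow> int \<Rightarrow> real" where
  "scaled_noise v u e = (\<lambda>s. v s * e s / u)"

lemma borel_measurable_scaled_noise [measurable]:
  "scaled_noise v u \<in> borel_measurable borel"
  unfolding scaled_noise_def
  by (rule measurable_into_path, rule measurable_compose[OF borel_measurable_coordinate]) measurable

text \<open>The identity is exact for each u and not merely asymptotic. Afterwards u survives only
  in the cut-off v(s) / u and in the noise at the other coordinates, and both vanish as u
  grows.\<close>

lemma nn_integral_one_source:
  assumes "\<alpha> > 0" "u > 0" "v s > 0" and [measurable]: "g \<in> borel_measurable borel"
  shows "ennreal (u powr \<alpha>) * (\<integral>\<^sup>+e. g (scaled_noise v u e) \<partial>pareto_seq \<alpha>) =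
    ennreal (v s powr \<alpha>) * (\<integral>\<^sup>+p. indicator {v s / u<..} (fst p) * g ((scaled_noise v u (snd p))(s := fst p))
      \<partial>(power_tail \<alpha> \<Otimes>\<^sub>M pareto_seq \<alpha>))"
proof -
  interpret prob_space "pareto_seq \<alpha>"
    using assms(1) by (rule prob_space_pareto_seq)
  define h where "h r = (\<integral>\<^sup>+e. g ((scaled_noise v u e)(s := r)) \<partial>pareto_seq \<alpha>)" for r
  have m[measurable]: "(\<lambda>p. (scaled_noise v u (snd p))(s := fst p)) \<in> borel_measurable (borel \<Otimes>\<^sub>M pareto_seq \<alpha>)"
    by (rule borel_measurable_resample) auto
  have m'[measurable]: "(\<lambda>p. (scaled_noise v u (snd p))(s := fst p)) \<in> borel_measurable (power_tail \<alpha> \<Otimes>\<^sub>M pareto_seq \<alpha>)"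
    by (rule borel_measurable_resample) auto
  have [measurable]: "h \<in> borel_measurable borel"
    unfolding h_def by (rule borel_measurable_nn_integral) (simp add: split_beta')
  \<comment> \<open>Resampling commutes with scaling, so the integral over the other coordinates
    depends on the new value x only through \<open>v s * x / u\<close>.\<close>
  have upd: "scaled_noise v u (e(s := x)) = (scaled_noise v u e)(s := v s * x / u)" for e x
    by (auto simp: scaled_noise_def)
  have "(\<integral>\<^sup>+e. g (scaled_noise v u e) \<partial>pareto_seq \<alpha>) = (\<integral>\<^sup>+x. h (v s * x / u) \<partial>pareto \<alpha>)"
    unfolding h_def upd[symmetric] by (rule nn_integral_pareto_seq_resample[OF assms(1)]) simp
  also have "\<dots> = (\<integral>\<^sup>+x. indicator {1<..} x * h (v s * x / u) \<partial>power_tail \<alpha>)"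
    by (simp add: pareto_def nn_integral_density)
  also have "\<dots> = ennreal ((v s / u) powr \<alpha>) *
      (\<integral>\<^sup>+r. indicator {1<..} (r / (v s / u)) * h (v s * (r / (v s / u)) / u) \<partial>power_tail \<alpha>)"
    using assms by (intro nn_integral_power_tail_scale) auto
  also have "(\<lambda>r. indicator {1<..} (r / (v s / u)) * h (v s * (r / (v s / u)) / u)) =
      (\<lambda>r. indicator {v s / u<..} r * h r)"
    using assms by (auto simp: fun_eq_iff indicator_def field_simps)
  also have "(\<integral>\<^sup>+r. indicator {v s / u<..} r * h r \<partial>power_tail \<alpha>) =
      (\<integral>\<^sup>+r. \<integral>\<^sup>+e. indicator {v s / u<..} r * g ((scaled_noise v u e)(s := r)) \<partial>pareto_seq \<alpha> \<partial>power_tail \<alpha>)"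
    unfolding h_def by (intro nn_integral_cong nn_integral_cmult[symmetric]) 
      (auto intro!: measurable_compose[OF _ assms(4)] borel_measurable_fun_upd)
  also have "\<dots> = (\<integral>\<^sup>+p. indicator {v s / u<..} (fst p) * g ((scaled_noise v u (snd p))(s := fst p))
      \<partial>(power_tail \<alpha> \<Otimes>\<^sub>M pareto_seq \<alpha>))"
    by (subst nn_integral_fst[symmetric]) auto
  finally have eq: "(\<integral>\<^sup>+e. g (scaled_noise v u e) \<partial>pareto_seq \<alpha>) = ennreal ((v s / u) powr \<alpha>) * \<dots>" .
  have "u powr \<alpha> * (v s / u) powr \<alpha> = v s powr \<alpha>"
    using assms by (simp add: powr_divide)
  then show ?thesis
    unfolding eq mult.assoc[symmetric] by (simp add: ennreal_mult'[symmetric])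
qed

lemma nn_integral_moving_sum_expand:
  assumes "\<alpha> > 0" "u > 0" "l0 > 0" "finite K" "\<And>s. v s > 0"
    and [measurable]: "G \<in> borel_measurable borel"
    and supp: "\<And>x. (\<And>t. t \<in> K \<Longrightarrow> \<bar>x t\<bar> \<le> \<epsilon>) \<Longrightarrow> G x = 0"
  shows "ennreal (u powr \<alpha>) * (\<integral>\<^sup>+e. G (moving_sum l0 (scaled_noise v u e)) \<partial>pareto_seq \<alpha>) =
    (\<Sum>s\<in>sources l0 K. ennreal (v s powr \<alpha>) *
      (\<integral>\<^sup>+p. indicator {v s / u<..} (fst p) *
        source_share l0 (sources l0 K) (\<epsilon> / l0) G s ((scaled_noise v u (snd p))(s := fst p))
        \<partial>(power_tail \<alpha> \<Otimes>\<^sub>M pareto_seq \<alpha>)))"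
proof -
  let ?S = "sources l0 K" and ?d = "\<epsilon> / l0"
  have fin: "finite ?S" using assms by (simp add: finite_sources)
  have eq: "G (moving_sum l0 z) = (\<Sum>s\<in>?S. source_share l0 ?S ?d G s z)" for z
  proof (cases "\<exists>s\<in>?S. \<bar>z s\<bar> > ?d")
    case True then show ?thesis using fin by (simp add: sum_source_share)
  next
    case False
    \<comment> \<open>Without a large source the shares do not add up to G by division, but both
      sides are 0: G by its support and \<open>large_source\<close>, every share by its
      indicator.\<close>
    then have "G (moving_sum l0 z) = 0"
      using large_source[OF assms(3)] by (intro supp) (meson not_le)
    moreover have "(\<Sum>s\<in>?S. source_share l0 ?S ?d G s z) = 0"
      using False by (intro sum.neutral) (auto simp: source_share_def)
    ultimately show ?thesis by simp
  qed
  have "ennreal (u powr \<alpha>) * (\<integral>\<^sup>+e. G (moving_sum l0 (scaled_noise v u e)) \<partial>pareto_seq \<alpha>) =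
      (\<Sum>s\<in>?S. ennreal (u powr \<alpha>) * (\<integral>\<^sup>+e. source_share l0 ?S ?d G s (scaled_noise v u e) \<partial>pareto_seq \<alpha>))"
    unfolding eq by (subst nn_integral_sum) (auto simp: sum_distrib_left)
  also have "\<dots> = (\<Sum>s\<in>?S. ennreal (v s powr \<alpha>) *
      (\<integral>\<^sup>+p. indicator {v s / u<..} (fst p) *
        source_share l0 ?S ?d G s ((scaled_noise v u (snd p))(s := fst p))
        \<partial>(power_tail \<alpha> \<Otimes>\<^sub>M pareto_seq \<alpha>)))"
    by (intro sum.cong refl nn_integral_one_source assms borel_measurable_source_share)
  finally show ?thesis .
qed

text \<open>Each share is at most C on an event of power-tail mass
  \<open>(\<epsilon> / l0) powr - \<alpha>\<close>. The bound is uniform in u, so it dominates the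
  later integral over v and, for the inner row, is the constant bounding the functional of the outer
  row.\<close>

lemma nn_integral_moving_sum_bound:
  assumes "\<alpha> > 0" "u > 0" "l0 > 0" "finite K" "\<And>s. v s > 0" "\<epsilon> > 0"
    and [measurable]: "G \<in> borel_measurable borel"
    and supp: "\<And>x. (\<And>t. t \<in> K \<Longrightarrow> \<bar>x t\<bar> \<le> \<epsilon>) \<Longrightarrow> G x = 0"
    and C: "\<And>x. G x \<le> C"
  shows "ennreal (u powr \<alpha>) * (\<integral>\<^sup>+e. G (moving_sum l0 (scaled_noise v u e)) \<partial>pareto_seq \<alpha>) \<le>
    (\<Sum>s\<in>sources l0 K. ennreal (v s powr \<alpha>)) * (C * ennreal ((\<epsilon> / l0) powr - \<alpha>))"
proof -
  interpret prob_space "pareto_seq \<alpha>"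
    using assms(1) by (rule prob_space_pareto_seq)
  let ?S = "sources l0 K" and ?d = "\<epsilon> / l0"
  have fin: "finite ?S" and d: "?d > 0" using assms by (simp_all add: finite_sources)
  have le: "(\<integral>\<^sup>+p. indicator {v s / u<..} (fst p) *
        source_share l0 ?S ?d G s ((scaled_noise v u (snd p))(s := fst p))
        \<partial>(power_tail \<alpha> \<Otimes>\<^sub>M pareto_seq \<alpha>)) \<le> C * ennreal (?d powr - \<alpha>)" (is "?J s \<le> _") if s: "s \<in> ?S" for s
  proof -
    have "(\<integral>\<^sup>+p. indicator {v s / u<..} (fst p) *
        source_share l0 ?S ?d G s ((scaled_noise v u (snd p))(s := fst p))
        \<partial>(power_tail \<alpha> \<Otimes>\<^sub>M pareto_seq \<alpha>)) \<le>
        (\<integral>\<^sup>+p. C * indicator {?d<..} (fst p) \<partial>(power_tail \<alpha> \<Otimes>\<^sub>M pareto_seq \<alpha>))"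
    proof (rule nn_integral_mono)
      fix p :: "real \<times> (int \<Rightarrow> real)"
      \<comment> \<open>A positive cut-off leaves only positive radii, for which a large absolute
        value is the same as a large value.\<close>
      have "v s / u > 0" using assms by simp
      then show "indicator {v s / u<..} (fst p) *
          source_share l0 ?S ?d G s ((scaled_noise v u (snd p))(s := fst p)) \<le> C * indicator {?d<..} (fst p)"
        using source_share_le[where G=G, OF fin s C, of l0 ?d "(scaled_noise v u (snd p))(s := fst p)"]
        by (auto simp: indicator_def split: if_splits)
    qed
    also have "\<dots> = (\<integral>\<^sup>+r. \<integral>\<^sup>+e. C * indicator {?d<..} r \<partial>pareto_seq \<alpha> \<partial>power_tail \<alpha>)"
      by (subst nn_integral_fst[symmetric]) auto
    also have "\<dots> = C * ennreal (?d powr - \<alpha>)"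
      using assms d by (simp add: emeasure_pareto_seq_UNIV nn_integral_cmult emeasure_power_tail_greaterThan)
    finally show ?thesis .
  qed
  have "(\<Sum>s\<in>?S. ennreal (v s powr \<alpha>) * ?J s) \<le>
      (\<Sum>s\<in>?S. ennreal (v s powr \<alpha>) * (C * ennreal (?d powr - \<alpha>)))"
    by (intro sum_mono mult_left_mono le) simp_all
  moreover have "ennreal (u powr \<alpha>) * (\<integral>\<^sup>+e. G (moving_sum l0 (scaled_noise v u e)) \<partial>pareto_seq \<alpha>) =
      (\<Sum>s\<in>?S. ennreal (v s powr \<alpha>) * ?J s)"
    using assms by (intro nn_integral_moving_sum_expand) auto
  ultimately show ?thesis
    by (simp only: sum_distrib_right)
qed

text \<open>Letting \<open>G\<close> depend on \<open>n\<close>, with continuous convergence to \<open>H\<close>, is what allows the lemma to be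
  applied twice: the row-2 integral is such a sequence of functionals of row 1.\<close>

lemma nn_integral_moving_sum_tendsto:
  assumes "\<alpha> > 0" "l0 > 0" "finite K" "\<And>s. v s > 0" "\<epsilon> > 0"
    and u: "\<And>n. u n > 0" "filterlim u at_top sequentially"
    and [measurable]: "\<And>n. G n \<in> borel_measurable borel"
    and supp: "\<And>n x. (\<And>t. t \<in> K \<Longrightarrow> \<bar>x t\<bar> \<le> \<epsilon>) \<Longrightarrow> G n x = 0"
    and C: "\<And>n x. G n x \<le> C" "C < \<infinity>"
    and cc: "\<And>x y. (\<And>t. (\<lambda>n. x n t) \<longlonglongrightarrow> y t) \<Longrightarrow> (\<lambda>n. G n (x n)) \<longlonglongrightarrow> H y"
  shows "(\<lambda>n. ennreal (u n powr \<alpha>) *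
      (\<integral>\<^sup>+e. G n (moving_sum l0 (scaled_noise v (u n) e)) \<partial>pareto_seq \<alpha>)) \<longlonglongrightarrow>
    (\<Sum>s\<in>sources l0 K. ennreal (v s powr \<alpha>) * (\<integral>\<^sup>+r. H (\<lambda>t. r * phi l0 s t) \<partial>power_tail \<alpha>))"
proof -
  interpret prob_space "pareto_seq \<alpha>"
    using assms(1) by (rule prob_space_pareto_seq)
  let ?S = "sources l0 K" and ?d = "\<epsilon> / l0"
  have fin: "finite ?S" and d: "?d > 0" using assms by (simp_all add: finite_sources)
  \<comment> \<open>Continuous convergence applied to the constant sequence y transfers the support
    from the functionals to their limit.\<close>
  have H0: "H y = 0" if "\<And>t. t \<in> K \<Longrightarrow> \<bar>y t\<bar> \<le> \<epsilon>" for y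
    using cc[of "\<lambda>_. y" y] supp[of y] that LIMSEQ_unique[of "\<lambda>_. 0" 0 "H y"] by simp
  have [measurable]: "H \<in> borel_measurable borel"
  proof (rule borel_measurable_LIMSEQ_order)
    show "(\<lambda>n. G n x) \<longlonglongrightarrow> H x" for x by (rule cc) simp
  qed measurable
  have [measurable]: "(\<lambda>r t. r * phi l0 s t) \<in> borel_measurable borel" for s
    by (rule measurable_into_path) simp
  have upd[measurable]: "(\<lambda>p. (scaled_noise v (u n) (snd p))(s := fst p)) \<in>
      borel_measurable (power_tail \<alpha> \<Otimes>\<^sub>M pareto_seq \<alpha>)" for n s
    by (rule borel_measurable_resample) auto
  have lim: "(\<lambda>n. \<integral>\<^sup>+p. indicator {v s / u n<..} (fst p) *
        source_share l0 ?S ?d (G n) s ((scaled_noise v (u n) (snd p))(s := fst p))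
        \<partial>(power_tail \<alpha> \<Otimes>\<^sub>M pareto_seq \<alpha>)) \<longlonglongrightarrow>
      (\<integral>\<^sup>+r. H (\<lambda>t. r * phi l0 s t) \<partial>power_tail \<alpha>)" if s: "s \<in> ?S" for s
  proof -
    have "(\<lambda>n. \<integral>\<^sup>+p. indicator {v s / u n<..} (fst p) *
        source_share l0 ?S ?d (G n) s ((scaled_noise v (u n) (snd p))(s := fst p))
        \<partial>(power_tail \<alpha> \<Otimes>\<^sub>M pareto_seq \<alpha>)) \<longlonglongrightarrow>
      (\<integral>\<^sup>+p. indicator {0<..} (fst p) * (indicator {?d<..} (fst p) * H (\<lambda>t. fst p * phi l0 s t))
        \<partial>(power_tail \<alpha> \<Otimes>\<^sub>M pareto_seq \<alpha>))"
    proof (rule nn_integral_dominated_convergence[where w = "\<lambda>p. C * indicator {?d<..} (fst p)"])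
      fix n
      show "AE p in power_tail \<alpha> \<Otimes>\<^sub>M pareto_seq \<alpha>. indicator {v s / u n<..} (fst p) *
        source_share l0 ?S ?d (G n) s ((scaled_noise v (u n) (snd p))(s := fst p))
         \<le> C * indicator {?d<..} (fst p)"
      proof (rule AE_I2)
        fix p :: "real \<times> (int \<Rightarrow> real)"
        have "v s / u n > 0" using assms by simp
        then show "indicator {v s / u n<..} (fst p) *
          source_share l0 ?S ?d (G n) s ((scaled_noise v (u n) (snd p))(s := fst p)) \<le> C * indicator {?d<..} (fst p)"
          using source_share_le[where G="G n", OF fin s C(1), of l0 ?d "(scaled_noise v (u n) (snd p))(s := fst p)"]
          by (auto simp: indicator_def split: if_splits)
      qed
    next
      have "(\<integral>\<^sup>+p. C * indicator {?d<..} (fst p) \<partial>(power_tail \<alpha> \<Otimes>\<^sub>M pareto_seq \<alpha>)) =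
          (\<integral>\<^sup>+r. \<integral>\<^sup>+e. C * indicator {?d<..} r \<partial>pareto_seq \<alpha> \<partial>power_tail \<alpha>)"
        by (subst nn_integral_fst[symmetric]) auto
      also have "\<dots> = C * ennreal (?d powr - \<alpha>)"
        using assms d by (simp add: emeasure_pareto_seq_UNIV nn_integral_cmult emeasure_power_tail_greaterThan)
      finally show "(\<integral>\<^sup>+p. C * indicator {?d<..} (fst p) \<partial>(power_tail \<alpha> \<Otimes>\<^sub>M pareto_seq \<alpha>)) < \<infinity>"
        using C(2) by (simp add: ennreal_mult_less_top)
    next
      show "AE p in power_tail \<alpha> \<Otimes>\<^sub>M pareto_seq \<alpha>. (\<lambda>n. indicator {v s / u n<..} (fst p) *
        source_share l0 ?S ?d (G n) s ((scaled_noise v (u n) (snd p))(s := fst p))) \<longlonglongrightarrow>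
        indicator {0<..} (fst p) * (indicator {?d<..} (fst p) * H (\<lambda>t. fst p * phi l0 s t))"
      proof (rule AE_I2)
        fix p :: "real \<times> (int \<Rightarrow> real)"
        obtain r e where p: "p = (r, e)" by (cases p)
        have to0: "(\<lambda>n. a / u n) \<longlonglongrightarrow> 0" for a
          using u(2) by (intro real_tendsto_divide_at_top[OF tendsto_const]) 
        show "(\<lambda>n. indicator {v s / u n<..} (fst p) *
          source_share l0 ?S ?d (G n) s ((scaled_noise v (u n) (snd p))(s := fst p))) \<longlonglongrightarrow>
          indicator {0<..} (fst p) * (indicator {?d<..} (fst p) * H (\<lambda>t. fst p * phi l0 s t))"
        proof (cases "r > 0")
          case True
          have "(\<lambda>n. source_share l0 ?S ?d (G n) s ((scaled_noise v (u n) e)(s := r))) \<longlonglongrightarrow>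
             indicator {?d<..} r * H (\<lambda>t. r * phi l0 s t)"
            by (rule source_share_tendsto[OF fin s d True _ cc]) (auto simp: scaled_noise_def to0)
          moreover have "\<forall>\<^sub>F n in sequentially. v s / u n < r"
            using to0[of "v s"] True by (rule order_tendstoD(2))
          then have "\<forall>\<^sub>F n in sequentially. source_share l0 ?S ?d (G n) s ((scaled_noise v (u n) e)(s := r)) =
             indicator {v s / u n<..} r * source_share l0 ?S ?d (G n) s ((scaled_noise v (u n) e)(s := r))"
            by eventually_elim simp
          ultimately have "(\<lambda>n. indicator {v s / u n<..} r *
               source_share l0 ?S ?d (G n) s ((scaled_noise v (u n) e)(s := r))) \<longlonglongrightarrow>
             indicator {?d<..} r * H (\<lambda>t. r * phi l0 s t)"
            by (rule Lim_transform_eventually)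
          then show ?thesis using True p by simp
        next
          case False
          \<comment> \<open>For r \<le> 0 both the cut-offs and the limiting indicator are
            0.\<close>
          have "\<not> v s / u n < r" for n
            using False assms(4)[of s] u(1)[of n] by (meson divide_pos_pos less_trans)
          then show ?thesis using False p by (simp add: indicator_def)
        qed
      qed
    qed measurable
    also have "(\<integral>\<^sup>+p. indicator {0<..} (fst p) * (indicator {?d<..} (fst p) * H (\<lambda>t. fst p * phi l0 s t))
        \<partial>(power_tail \<alpha> \<Otimes>\<^sub>M pareto_seq \<alpha>)) =
        (\<integral>\<^sup>+r. \<integral>\<^sup>+e. indicator {0<..} r * (indicator {?d<..} r * H (\<lambda>t. r * phi l0 s t)) \<partial>pareto_seq \<alpha> \<partial>power_tail \<alpha>)"
      by (subst nn_integral_fst[symmetric]) auto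
    also have "\<dots> = (\<integral>\<^sup>+r. indicator {0<..} r * (indicator {?d<..} r * H (\<lambda>t. r * phi l0 s t)) \<partial>power_tail \<alpha>)"
      using assms(1) by (simp add: emeasure_pareto_seq_UNIV)
    also have "\<dots> = (\<integral>\<^sup>+r. H (\<lambda>t. r * phi l0 s t) \<partial>power_tail \<alpha>)"
    proof (rule nn_integral_cong_AE, use AE_power_tail_pos[of \<alpha>] in eventually_elim)
      case (elim r)
      have "?d \<le> \<epsilon>" using assms by (simp add: field_simps)
      then have "H (\<lambda>t. r * phi l0 s t) = 0" if "r \<le> ?d"
        using that elim assms(5) by (intro H0) (auto simp: phi_eq)
      then show ?case using elim by (auto simp: indicator_def)
    qed
    finally show ?thesis .
  qed
  have eq: "ennreal (u n powr \<alpha>) * (\<integral>\<^sup>+e. G n (moving_sum l0 (scaled_noise v (u n) e)) \<partial>pareto_seq \<alpha>) =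
      (\<Sum>s\<in>?S. ennreal (v s powr \<alpha>) * (\<integral>\<^sup>+p. indicator {v s / u n<..} (fst p) *
        source_share l0 ?S ?d (G n) s ((scaled_noise v (u n) (snd p))(s := fst p))
        \<partial>(power_tail \<alpha> \<Otimes>\<^sub>M pareto_seq \<alpha>)))" for n
    using assms by (intro nn_integral_moving_sum_expand) auto
  show ?thesis
    unfolding eq by (intro tendsto_sum ennreal_tendsto_cmult lim) auto
qed

section \<open>The limit measures\<close>

text \<open>On a finite nonempty set the supremum is a maximum; over the empty set the real supremum
  would carry no information.\<close>

lemma sup_on_greater_iff:
  assumes "finite S" "S \<noteq> {}"
  shows "sup_on S i f > \<epsilon> \<longleftrightarrow> (\<exists>t\<in>S. \<bar>f t $ i\<bar> > \<epsilon>)"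
proof -
  have "sup_on S i f = Max ((\<lambda>t. \<bar>f t $ i\<bar>) ` S)"
    unfolding sup_on_def using assms by (intro cSup_eq_Max) auto
  then show ?thesis using assms by (simp add: Max_gr_iff)
qed

lemma borel_measurable_vec:
  fixes f :: "'a \<Rightarrow> real^'n::finite"
  assumes "\<And>i. (\<lambda>x. f x $ i) \<in> borel_measurable N"
  shows "f \<in> borel_measurable N"
proof (subst borel_measurable_euclidean_space, rule ballI)
  fix b :: "real^'n" assume "b \<in> Basis"
  then obtain i where "b = axis i 1" by (auto simp: Basis_vec_def)
  then show "(\<lambda>x. f x \<bullet> b) \<in> borel_measurable N"
    using assms[of i] by (simp add: cart_eq_inner_axis[symmetric])
qed

lemma borel_measurable_vec_nth: "(\<lambda>x :: real^'n::finite. x $ i) \<in> borel_measurable borel"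
  by (rule borel_measurable_continuous_onI) (intro continuous_intros)

lemma borel_measurable_path_coordinate:
  "(\<lambda>f :: int \<Rightarrow> real^'n::finite. f t $ i) \<in> borel_measurable borel"
  by (rule measurable_compose[OF borel_measurable_coordinate borel_measurable_vec_nth])

lemma sets_exceedance [measurable]:
  "{f :: int \<Rightarrow> real^'n::finite. \<bar>f t $ i\<bar> > c} \<in> sets borel"
proof -
  have "(\<lambda>f :: int \<Rightarrow> real^'n. \<bar>f t $ i\<bar>) \<in> borel_measurable borel"
    by (rule measurable_compose[OF borel_measurable_path_coordinate]) measurable
  from measurable_sets[OF this, of "{c<..}"] show ?thesis by (simp add: vimage_def)
qed

lemma sets_sup_on_greater:
  assumes "finite S" "S \<noteq> {}"
  shows "{f :: int \<Rightarrow> real^'n::finite. sup_on S i f > \<epsilon>} \<in> sets borel"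
proof -
  have "{f :: int \<Rightarrow> real^'n. sup_on S i f > \<epsilon>} = (\<Union>t\<in>S. {f. \<bar>f t $ i\<bar> > \<epsilon>})"
    using assms by (auto simp: sup_on_greater_iff)
  then show ?thesis using assms(1) by (auto intro!: sets.finite_UN)
qed

section \<open>Source pairs, their masses, and the limit measures as image measures\<close>

definition pair_path :: "(int \<Rightarrow> real) \<Rightarrow> (int \<Rightarrow> real) \<Rightarrow> int \<Rightarrow> real^2" where
  "pair_path f g = (\<lambda>t. vector [f t, g t])"

lemma source_pair_eq:
  "source_pair l0 r\<^sub>1 s\<^sub>1 r\<^sub>2 s\<^sub>2 = pair_path (\<lambda>t. r\<^sub>1 * phi l0 s\<^sub>1 t) (\<lambda>t. r\<^sub>2 * phi l0 s\<^sub>2 t)"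
  by (simp add: source_pair_def pair_path_def)

lemma pair_path_nth [simp]: "pair_path f g t $ 1 = f t" "pair_path f g t $ 2 = g t"
  by (simp_all add: pair_path_def)

lemma borel_measurable_pair_path:
  assumes "f \<in> borel_measurable N" "g \<in> borel_measurable N"
  shows "(\<lambda>x. pair_path (f x) (g x)) \<in> borel_measurable N"
proof (rule measurable_into_path, rule borel_measurable_vec)
  fix t and i :: 2
  show "(\<lambda>x. pair_path (f x) (g x) t $ i) \<in> borel_measurable N"
    using exhaust_2[of i] assms[THEN borel_measurable_path_component, of t] by auto
qed

lemma borel_measurable_scaled_phi: "(\<lambda>r t. r * phi l0 s t) \<in> borel_measurable borel"
  by (rule measurable_into_path) simp

lemma borel_measurable_source_pair:
  "(\<lambda>p. source_pair l0 (fst p) s\<^sub>1 (snd p) s\<^sub>2) \<in> borel_measurable (power_tail \<alpha> \<Otimes>\<^sub>M power_tail \<alpha>)"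
  unfolding source_pair_eq
  by (intro borel_measurable_pair_path; rule measurable_compose[OF _ borel_measurable_scaled_phi])
    measurable

lemma borel_measurable_single_source: "(\<lambda>r. single_source l0 r s) \<in> borel_measurable (power_tail \<alpha>)"
  unfolding single_source_def
  by (rule measurable_into_path, rule borel_measurable_vec) simp

text \<open>The iterated form matches the limit taken one row at a time; \<open>pair_mass_eq\<close>
  reconciles it with the product integral.\<close>

definition pair_mass :: "real \<Rightarrow> nat \<Rightarrow> ((int \<Rightarrow> real^2) \<Rightarrow> ennreal) \<Rightarrow> int \<Rightarrow> int \<Rightarrow> ennreal" where
  "pair_mass \<alpha> l0 F s\<^sub>1 s\<^sub>2 =
     (\<integral>\<^sup>+r\<^sub>1. \<integral>\<^sup>+r\<^sub>2. F (source_pair l0 r\<^sub>1 s\<^sub>1 r\<^sub>2 s\<^sub>2) \<partial>power_tail \<alpha> \<partial>power_tail \<alpha>)"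

lemma pair_mass_eq:
  assumes "\<alpha> > 0" "F \<in> borel_measurable borel"
  shows "pair_mass \<alpha> l0 F s\<^sub>1 s\<^sub>2 =
    (\<integral>\<^sup>+(r\<^sub>1, r\<^sub>2). F (source_pair l0 r\<^sub>1 s\<^sub>1 r\<^sub>2 s\<^sub>2) \<partial>(power_tail \<alpha> \<Otimes>\<^sub>M power_tail \<alpha>))"
proof -
  interpret sigma_finite_measure "power_tail \<alpha>" using assms(1) by (rule sigma_finite_power_tail)
  show ?thesis
    unfolding pair_mass_def split_beta'
    by (subst nn_integral_fst[symmetric])
      (simp_all add: measurable_compose[OF borel_measurable_source_pair assms(2)])
qed

lemma nn_integral_count_space_shift:
  fixes f :: "int \<Rightarrow> ennreal"
  shows "(\<integral>\<^sup>+x. f (x + c) \<partial>count_space UNIV) = (\<integral>\<^sup>+x. f x \<partial>count_space UNIV)"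
proof -
  have "bij_betw (\<lambda>x. x + c) UNIV (UNIV :: int set)"
    by (rule bij_betwI[where g = "\<lambda>x. x - c"]) auto
  then show ?thesis by (rule nn_integral_bij_count_space)
qed

text \<open>Tonelli exchanges lag and time, and a translation of the integers turns (s, s +
  \<delta>) into free source times. The weight then depends on their difference, as it comes out of
  the limit theorem.\<close>

lemma FV_integral_eq:
  assumes "\<alpha> > 0" "F \<in> borel_measurable borel"
  shows "FV_integral \<alpha> l0 w F = (\<integral>\<^sup>+s\<^sub>1. \<integral>\<^sup>+s\<^sub>2. ennreal (w (s\<^sub>2 - s\<^sub>1)) * pair_mass \<alpha> l0 F s\<^sub>1 s\<^sub>2
    \<partial>count_space UNIV \<partial>count_space UNIV)"
proof -
  have "FV_integral \<alpha> l0 w F = (\<integral>\<^sup>+\<delta>. ennreal (w \<delta>) * (\<integral>\<^sup>+s. pair_mass \<alpha> l0 F s (s + \<delta>)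
      \<partial>count_space UNIV) \<partial>count_space UNIV)"
    by (simp add: FV_integral_def infsum_int_eq_nn_integral pair_mass_eq[OF assms])
  also have "\<dots> = (\<integral>\<^sup>+\<delta>. \<integral>\<^sup>+s. ennreal (w \<delta>) * pair_mass \<alpha> l0 F s (s + \<delta>)
      \<partial>count_space UNIV \<partial>count_space UNIV)"
    by (simp add: nn_integral_cmult)
  also have "\<dots> = (\<integral>\<^sup>+s. \<integral>\<^sup>+\<delta>. ennreal (w \<delta>) * pair_mass \<alpha> l0 F s (s + \<delta>)
      \<partial>count_space UNIV \<partial>count_space UNIV)"
    by (rule nn_integral_count_space_nn_integral) auto
  also have "\<dots> = (\<integral>\<^sup>+s\<^sub>1. \<integral>\<^sup>+s\<^sub>2. ennreal (w (s\<^sub>2 - s\<^sub>1)) * pair_mass \<alpha> l0 F s\<^sub>1 s\<^sub>2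
      \<partial>count_space UNIV \<partial>count_space UNIV)"
  proof (rule nn_integral_cong)
    fix s :: int
    show "(\<integral>\<^sup>+\<delta>. ennreal (w \<delta>) * pair_mass \<alpha> l0 F s (s + \<delta>) \<partial>count_space UNIV) =
        (\<integral>\<^sup>+s\<^sub>2. ennreal (w (s\<^sub>2 - s)) * pair_mass \<alpha> l0 F s s\<^sub>2 \<partial>count_space UNIV)"
      using nn_integral_count_space_shift[of "\<lambda>s\<^sub>2. ennreal (w (s\<^sub>2 - s)) * pair_mass \<alpha> l0 F s s\<^sub>2" s]
      by (simp add: add.commute)
  qed
  finally show ?thesis .
qed

lemma FV_integral_eq_sum:
  assumes "\<alpha> > 0" "F \<in> borel_measurable borel" "finite S\<^sub>1" "finite S\<^sub>2"
    and supp: "\<And>s\<^sub>1 s\<^sub>2. s\<^sub>1 \<notin> S\<^sub>1 \<or> s\<^sub>2 \<notin> S\<^sub>2 \<Longrightarrow> pair_mass \<alpha> l0 F s\<^sub>1 s\<^sub>2 = 0"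
  shows "FV_integral \<alpha> l0 w F = (\<Sum>s\<^sub>1\<in>S\<^sub>1. \<Sum>s\<^sub>2\<in>S\<^sub>2. ennreal (w (s\<^sub>2 - s\<^sub>1)) * pair_mass \<alpha> l0 F s\<^sub>1 s\<^sub>2)"
proof -
  have "(\<integral>\<^sup>+s\<^sub>2. ennreal (w (s\<^sub>2 - s\<^sub>1)) * pair_mass \<alpha> l0 F s\<^sub>1 s\<^sub>2 \<partial>count_space UNIV) =
      (\<Sum>s\<^sub>2\<in>S\<^sub>2. ennreal (w (s\<^sub>2 - s\<^sub>1)) * pair_mass \<alpha> l0 F s\<^sub>1 s\<^sub>2)" for s\<^sub>1
    using assms(4) supp by (intro nn_integral_count_space') auto
  then have "FV_integral \<alpha> l0 w F = (\<integral>\<^sup>+s\<^sub>1. (\<Sum>s\<^sub>2\<in>S\<^sub>2. ennreal (w (s\<^sub>2 - s\<^sub>1)) * pair_mass \<alpha> l0 F s\<^sub>1 s\<^sub>2)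
      \<partial>count_space UNIV)"
    by (simp add: FV_integral_eq[OF assms(1,2)])
  also have "\<dots> = (\<Sum>s\<^sub>1\<in>S\<^sub>1. \<Sum>s\<^sub>2\<in>S\<^sub>2. ennreal (w (s\<^sub>2 - s\<^sub>1)) * pair_mass \<alpha> l0 F s\<^sub>1 s\<^sub>2)"
    using assms(3) supp by (intro nn_integral_count_space') auto
  finally show ?thesis .
qed

lemma sets_nu_FV [simp]: "sets (nu_FV \<alpha> l0 w) = sets borel"
  unfolding nu_FV_def using sets.sigma_sets_eq[of "borel :: (int \<Rightarrow> real^2) measure"] by simp

lemma space_nu_FV [simp]: "space (nu_FV \<alpha> l0 w) = UNIV"
  using sets_eq_imp_space_eq[OF sets_nu_FV] by simp

lemma sets_nu_sc [simp]: "sets (nu_sc \<alpha> l0) = sets borel"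
  unfolding nu_sc_def using sets.sigma_sets_eq[of "borel :: (int \<Rightarrow> real^1) measure"] by simp

lemma space_nu_sc [simp]: "space (nu_sc \<alpha> l0) = UNIV"
  using sets_eq_imp_space_eq[OF sets_nu_sc] by simp

text \<open>\<open>measure_of\<close> returns the given set function only if that function is a
  measure. Instead of checking countable additivity, the image N of a weighted product of counting
  measure and power tails is formed. Its integrals are \<open>FV_integral\<close> by Tonelli, and
  agreement on Borel sets identifies it with \<open>nu_FV\<close>.\<close>

lemma nn_integral_nu_FV:
  assumes \<alpha>: "\<alpha> > 0" and F: "F \<in> borel_measurable borel"
  shows "(\<integral>\<^sup>+f. F f \<partial>nu_FV \<alpha> l0 w) = FV_integral \<alpha> l0 w F"
proof -
  interpret pt: sigma_finite_measure "power_tail \<alpha>" using \<alpha> by (rule sigma_finite_power_tail)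
  interpret pair_sigma_finite "power_tail \<alpha>" "power_tail \<alpha>" ..
  let ?R = "power_tail \<alpha> \<Otimes>\<^sub>M power_tail \<alpha>"
  have R: "sigma_finite_measure ?R" ..
  define L where "L = (count_space (UNIV :: (int \<times> int) set)) \<Otimes>\<^sub>M ?R"
  define src :: "(int \<times> int) \<times> real \<times> real \<Rightarrow> int \<Rightarrow> real^2" where
    "src = (\<lambda>x. source_pair l0 (fst (snd x)) (fst (fst x)) (snd (snd x)) (snd (fst x)))"
  define N where "N = distr (density L (\<lambda>x. ennreal (w (snd (fst x) - fst (fst x))))) borel src"
  have src: "src \<in> borel_measurable L"
    unfolding L_def src_def
    by (rule measurable_pair_measure_countable1) (simp_all add: borel_measurable_source_pair)
  have dens: "(\<lambda>x. ennreal (w (snd (fst x) - fst (fst x)))) \<in> borel_measurable L"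
    unfolding L_def by (rule measurable_pair_measure_countable1) simp_all
  have N: "(\<integral>\<^sup>+f. G f \<partial>N) = FV_integral \<alpha> l0 w G" if G: "G \<in> borel_measurable borel" for G
  proof -
    have Gsrc: "(\<lambda>x. G (src x)) \<in> borel_measurable L"
      by (rule measurable_compose[OF src G])
    have "(\<integral>\<^sup>+f. G f \<partial>N) = (\<integral>\<^sup>+x. ennreal (w (snd (fst x) - fst (fst x))) * G (src x) \<partial>L)"
      unfolding N_def using src dens G Gsrc
      by (subst nn_integral_distr) (simp_all add: nn_integral_density)
    also have "\<dots> = (\<integral>\<^sup>+s. \<integral>\<^sup>+r. ennreal (w (snd s - fst s)) * G (src (s, r)) \<partial>?R \<partial>count_space UNIV)"
      unfolding L_def using dens Gsrc
      by (subst sigma_finite_measure.nn_integral_fst[OF R, symmetric]) (simp_all add: L_def)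
    also have "\<dots> = (\<integral>\<^sup>+s. ennreal (w (snd s - fst s)) * pair_mass \<alpha> l0 G (fst s) (snd s) \<partial>count_space UNIV)"
    proof (rule nn_integral_cong)
      fix s :: "int \<times> int"
      have "(\<integral>\<^sup>+r. ennreal (w (snd s - fst s)) * G (src (s, r)) \<partial>?R) =
          ennreal (w (snd s - fst s)) * (\<integral>\<^sup>+r. G (src (s, r)) \<partial>?R)"
        unfolding src_def
        by (rule nn_integral_cmult) (simp add: measurable_compose[OF borel_measurable_source_pair G])
      then show "(\<integral>\<^sup>+r. ennreal (w (snd s - fst s)) * G (src (s, r)) \<partial>?R) =
          ennreal (w (snd s - fst s)) * pair_mass \<alpha> l0 G (fst s) (snd s)"
        by (simp add: pair_mass_eq[OF \<alpha> G] src_def split_beta')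
    qed
    also have "\<dots> = FV_integral \<alpha> l0 w G"
      unfolding FV_integral_eq[OF \<alpha> G]
      by (subst nn_integral_fst_count_space[symmetric]) simp
    finally show ?thesis .
  qed
  have "nu_FV \<alpha> l0 w = N"
  proof -
    have "nu_FV \<alpha> l0 w = measure_of (space N) (sets N) (emeasure N)"
      unfolding nu_FV_def
    proof (rule measure_of_eq[THEN trans])
      show "(sets borel :: (int \<Rightarrow> real^2) set set) \<subseteq> Pow UNIV" by simp
      fix A :: "(int \<Rightarrow> real^2) set" assume "A \<in> sigma_sets UNIV (sets borel)"
      then have A: "A \<in> sets borel" using sets.sigma_sets_eq[of "borel :: (int \<Rightarrow> real^2) measure"] by simp
      then have "A \<in> sets N" by (simp add: N_def)
      then show "FV_integral \<alpha> l0 w (indicator A) = emeasure N A"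
        using N[of "indicator A"] A by simp
    qed (simp add: N_def)
    then show ?thesis by (simp add: measure_of_of_measure)
  qed
  then show ?thesis using N[OF F] by simp
qed

lemma emeasure_nu_FV:
  assumes "\<alpha> > 0" "A \<in> sets borel"
  shows "emeasure (nu_FV \<alpha> l0 w) A = FV_integral \<alpha> l0 w (indicator A)"
  using nn_integral_nu_FV[OF assms(1), of "indicator A" l0 w] assms(2) by simp

text \<open>The same image-measure construction as in \<open>nn_integral_nu_FV\<close>, with one
  source time, one radius and unit weights.\<close>

lemma nn_integral_nu_sc:
  assumes \<alpha>: "\<alpha> > 0" and F: "F \<in> borel_measurable borel"
  shows "(\<integral>\<^sup>+f. F f \<partial>nu_sc \<alpha> l0) = sc_integral \<alpha> l0 F"
proof -
  interpret sigma_finite_measure "power_tail \<alpha>" using \<alpha> by (rule sigma_finite_power_tail)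
  define L where "L = (count_space (UNIV :: int set)) \<Otimes>\<^sub>M power_tail \<alpha>"
  define src :: "int \<times> real \<Rightarrow> int \<Rightarrow> real^1" where "src = (\<lambda>x. single_source l0 (snd x) (fst x))"
  define N where "N = distr L borel src"
  have src: "src \<in> borel_measurable L"
    unfolding L_def src_def
    by (rule measurable_pair_measure_countable1) (simp_all add: borel_measurable_single_source)
  have N: "(\<integral>\<^sup>+f. G f \<partial>N) = sc_integral \<alpha> l0 G" if G: "G \<in> borel_measurable borel" for G
  proof -
    have "(\<integral>\<^sup>+f. G f \<partial>N) = (\<integral>\<^sup>+x. G (src x) \<partial>L)"
      unfolding N_def using src G by (subst nn_integral_distr) simp_all
    also have "\<dots> = (\<integral>\<^sup>+s. \<integral>\<^sup>+r. G (src (s, r)) \<partial>power_tail \<alpha> \<partial>count_space UNIV)"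
      using measurable_compose[OF src G] unfolding L_def by (subst nn_integral_fst[symmetric]) simp_all
    finally show ?thesis by (simp add: sc_integral_def infsum_int_eq_nn_integral src_def)
  qed
  have "nu_sc \<alpha> l0 = N"
  proof -
    have "nu_sc \<alpha> l0 = measure_of (space N) (sets N) (emeasure N)"
      unfolding nu_sc_def
    proof (rule measure_of_eq[THEN trans])
      show "(sets borel :: (int \<Rightarrow> real^1) set set) \<subseteq> Pow UNIV" by simp
      fix A :: "(int \<Rightarrow> real^1) set" assume "A \<in> sigma_sets UNIV (sets borel)"
      then have A: "A \<in> sets borel" using sets.sigma_sets_eq[of "borel :: (int \<Rightarrow> real^1) measure"] by simp
      then have "A \<in> sets N" by (simp add: N_def)
      then show "sc_integral \<alpha> l0 (indicator A) = emeasure N A"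
        using N[of "indicator A"] A by simp
    qed (simp add: N_def)
    then show ?thesis by (simp add: measure_of_of_measure)
  qed
  then show ?thesis using N[OF F] by simp
qed

lemma emeasure_nu_sc:
  assumes "\<alpha> > 0" "A \<in> sets borel"
  shows "emeasure (nu_sc \<alpha> l0) A = sc_integral \<alpha> l0 (indicator A)"
  using nn_integral_nu_sc[OF assms(1), of "indicator A" l0] assms(2) by simp

text \<open>The single source pair (t, t) with t in S suffices: its weight \<open>w 0\<close> is
  positive, the observed row has positive mass, and the other radius ranges over the whole power
  tail, of infinite mass.\<close>

lemma emeasure_nu_FV_row_exceedance:
  assumes "\<alpha> > 0" "l0 > 0" "w 0 > 0" "finite S" "S \<noteq> {}" "\<epsilon> > 0"
  shows "emeasure (nu_FV \<alpha> l0 w) {f. sup_on S i f > \<epsilon>} = \<infinity>"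
proof -
  let ?A = "{f :: int \<Rightarrow> real^2. sup_on S i f > \<epsilon>}"
  have A: "?A \<in> sets borel" using assms by (intro sets_sup_on_greater)
  obtain t where t: "t \<in> S" using assms by auto
  have phi: "phi l0 t t = 1" using assms by (simp add: phi_eq)
  have pos: "emeasure (power_tail \<alpha>) {\<epsilon><..} > 0" and tot: "emeasure (power_tail \<alpha>) UNIV = \<infinity>"
    using assms by (simp_all add: emeasure_power_tail_greaterThan emeasure_power_tail_UNIV)
  have in_A: "source_pair l0 r\<^sub>1 t r\<^sub>2 t \<in> ?A" if "(if i = 1 then r\<^sub>1 else r\<^sub>2) > \<epsilon>" for r\<^sub>1 r\<^sub>2
    using that t assms exhaust_2[of i] by (auto simp: sup_on_greater_iff source_pair_eq phi intro!: bexI[of _ t])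
  have "(\<integral>\<^sup>+r\<^sub>1. \<integral>\<^sup>+r\<^sub>2. indicator {\<epsilon><..} (if i = 1 then r\<^sub>1 else r\<^sub>2) \<partial>power_tail \<alpha> \<partial>power_tail \<alpha>)
      \<le> pair_mass \<alpha> l0 (indicator ?A) t t"
    unfolding pair_mass_def using in_A by (intro nn_integral_mono) (auto simp: indicator_def)
  moreover have "(\<integral>\<^sup>+r\<^sub>1. \<integral>\<^sup>+r\<^sub>2. indicator {\<epsilon><..} (if i = 1 then r\<^sub>1 else r\<^sub>2) \<partial>power_tail \<alpha> \<partial>power_tail \<alpha>) = \<infinity>"
  proof (cases "i = 1")
    case True
    then have "(\<integral>\<^sup>+r\<^sub>1. \<integral>\<^sup>+r\<^sub>2. indicator {\<epsilon><..} (if i = 1 then r\<^sub>1 else r\<^sub>2) \<partial>power_tail \<alpha> \<partial>power_tail \<alpha>) =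
        (\<integral>\<^sup>+r\<^sub>1. indicator {\<epsilon><..} r\<^sub>1 * emeasure (power_tail \<alpha>) UNIV \<partial>power_tail \<alpha>)"
      by simp
    also have "\<dots> = emeasure (power_tail \<alpha>) {\<epsilon><..} * emeasure (power_tail \<alpha>) UNIV"
      by (subst nn_integral_multc) simp_all
    finally show ?thesis using pos by (simp add: tot ennreal_mult_top)
  next
    case False
    then show ?thesis using pos by (simp add: tot ennreal_mult_top)
  qed
  ultimately have "pair_mass \<alpha> l0 (indicator ?A) t t = \<infinity>"
    by (simp add: top_unique)
  then have "\<infinity> = ennreal (w (t - t)) * pair_mass \<alpha> l0 (indicator ?A) t t"
    using assms by (simp add: ennreal_mult_top)
  also have "\<dots> \<le> (\<integral>\<^sup>+s\<^sub>2. ennreal (w (s\<^sub>2 - t)) * pair_mass \<alpha> l0 (indicator ?A) t s\<^sub>2 \<partial>count_space UNIV)"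
    by (rule nn_integral_ge_point) simp
  also have "\<dots> \<le> FV_integral \<alpha> l0 w (indicator ?A)"
    unfolding FV_integral_eq[OF assms(1) borel_measurable_indicator[OF A]]
    by (rule nn_integral_ge_point) simp
  finally show ?thesis
    unfolding emeasure_nu_FV[OF assms(1) A] by (simp add: top_unique)
qed

section \<open>The anchor mass as a count of source pairs\<close>

lemma pair_mass_cong:
  assumes "\<And>r\<^sub>1 r\<^sub>2. r\<^sub>1 > 0 \<Longrightarrow> r\<^sub>2 > 0 \<Longrightarrow>
    F (source_pair l0 r\<^sub>1 s\<^sub>1 r\<^sub>2 s\<^sub>2) = G r\<^sub>1 * (H r\<^sub>2 :: ennreal)"
    and "G \<in> borel_measurable borel" "H \<in> borel_measurable borel"
  shows "pair_mass \<alpha> l0 F s\<^sub>1 s\<^sub>2 = (\<integral>\<^sup>+r. G r \<partial>power_tail \<alpha>) * (\<integral>\<^sup>+r. H r \<partial>power_tail \<alpha>)"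
proof -
  have "pair_mass \<alpha> l0 F s\<^sub>1 s\<^sub>2 = (\<integral>\<^sup>+r\<^sub>1. G r\<^sub>1 * (\<integral>\<^sup>+r. H r \<partial>power_tail \<alpha>) \<partial>power_tail \<alpha>)"
    unfolding pair_mass_def
  proof (rule nn_integral_cong_AE, use AE_power_tail_pos[of \<alpha>] in eventually_elim)
    case (elim r\<^sub>1)
    have "(\<integral>\<^sup>+r\<^sub>2. F (source_pair l0 r\<^sub>1 s\<^sub>1 r\<^sub>2 s\<^sub>2) \<partial>power_tail \<alpha>) = (\<integral>\<^sup>+r\<^sub>2. G r\<^sub>1 * H r\<^sub>2 \<partial>power_tail \<alpha>)"
      using AE_power_tail_pos[of \<alpha>] elim assms(1) by (intro nn_integral_cong_AE) (auto elim: eventually_mono)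
    also have "\<dots> = G r\<^sub>1 * (\<integral>\<^sup>+r. H r \<partial>power_tail \<alpha>)"
      using assms(3) by (intro nn_integral_cmult) simp
    finally show ?case .
  qed
  also have "\<dots> = (\<integral>\<^sup>+r. G r \<partial>power_tail \<alpha>) * (\<integral>\<^sup>+r. H r \<partial>power_tail \<alpha>)"
    using assms(2) by (intro nn_integral_multc) simp
  finally show ?thesis .
qed

text \<open>Grouping the square by the difference d leaves n - |d| pairs on each diagonal, which is
  the triangular weight of the anchor formula.\<close>

lemma sum_square_by_difference:
  fixes f :: "int \<Rightarrow> ennreal" and n :: int
  assumes "n \<ge> 0"
  shows "(\<Sum>a\<in>{0..<n}. \<Sum>b\<in>{0..<n}. f (a - b)) = (\<Sum>d = - (n - 1)..n - 1. of_nat (nat (n - \<bar>d\<bar>)) * f d)"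
proof -
  let ?S = "{0..<n} \<times> {0..<n}" and ?T = "{- (n - 1)..n - 1}"
  have card: "card {p \<in> ?S. fst p - snd p = d} = nat (n - \<bar>d\<bar>)" if "d \<in> ?T" for d
  proof -
    \<comment> \<open>The diagonal is parametrised by its second coordinate b; the bounds say that
      both b and b + d lie in [0, n).\<close>
    have "{p \<in> ?S. fst p - snd p = d} = (\<lambda>b. (b + d, b)) ` {max 0 (- d)..<min n (n - d)}"
      by (auto simp: image_iff)
    then have "card {p \<in> ?S. fst p - snd p = d} = card {max 0 (- d)..<min n (n - d)}"
      by (simp add: card_image inj_on_def)
    then show ?thesis by (simp add: max_def min_def)
  qed
  have "(\<Sum>a\<in>{0..<n}. \<Sum>b\<in>{0..<n}. f (a - b)) = (\<Sum>p\<in>?S. f (fst p - snd p))"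
    by (simp add: sum.cartesian_product split_beta')
  also have "\<dots> = (\<Sum>d\<in>?T. \<Sum>p\<in>{p \<in> ?S. fst p - snd p = d}. f (fst p - snd p))"
    by (rule sum.group[symmetric]) auto
  also have "\<dots> = (\<Sum>d\<in>?T. \<Sum>p\<in>{p \<in> ?S. fst p - snd p = d}. f d)"
    by (intro sum.cong) auto
  also have "\<dots> = (\<Sum>d\<in>?T. of_nat (nat (n - \<bar>d\<bar>)) * f d)"
    by (intro sum.cong refl) (simp only: sum_constant card)
  finally show ?thesis .
qed

text \<open>A pulse started at s covers a time l exactly for the l0 values s = l - l0 + 1, ..., l,
  and the radii above 1 have mass 1. Each admissible source pair thus contributes its bare
  weight.\<close>

lemma anchor_mass:
  assumes "\<alpha> > 0" "l0 > 0" "\<And>\<delta>. w \<delta> \<ge> 0"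
  shows "emeasure (nu_FV \<alpha> l0 w) {f. \<bar>f 0 $ 1\<bar> > 1 \<and> \<bar>f l $ 2\<bar> > 1} =
    ennreal (\<Sum>d = - (int l0 - 1)..int l0 - 1. real_of_int (int l0 - \<bar>d\<bar>) * w (l + d))"
proof -
  let ?A = "{f :: int \<Rightarrow> real^2. \<bar>f 0 $ 1\<bar> > 1 \<and> \<bar>f l $ 2\<bar> > 1}"
  let ?S = "\<lambda>l. {l - int l0 + 1..l}"
  have A: "?A \<in> sets borel"
    using sets.Int[OF sets_exceedance[of 1 0 1] sets_exceedance[of 1 l 2]] by (simp add: Collect_conj_eq)
  have one: "(\<integral>\<^sup>+r. indicator {1<..} r \<partial>power_tail \<alpha>) = 1"
    using assms by (simp add: emeasure_power_tail_greaterThan)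
  have mass: "pair_mass \<alpha> l0 (indicator ?A) s\<^sub>1 s\<^sub>2 = (if s\<^sub>1 \<in> ?S 0 \<and> s\<^sub>2 \<in> ?S l then 1 else 0)" for s\<^sub>1 s\<^sub>2
  proof -
    have "pair_mass \<alpha> l0 (indicator ?A) s\<^sub>1 s\<^sub>2 =
        (\<integral>\<^sup>+r. indicator (?S 0) s\<^sub>1 * indicator {1<..} r \<partial>power_tail \<alpha>) *
        (\<integral>\<^sup>+r. indicator (?S l) s\<^sub>2 * indicator {1<..} r \<partial>power_tail \<alpha>)"
      by (rule pair_mass_cong) (auto simp: indicator_def source_pair_eq phi_eq)
    then show ?thesis using one by (auto simp: indicator_def)
  qed
  have "emeasure (nu_FV \<alpha> l0 w) ?A = FV_integral \<alpha> l0 w (indicator ?A)"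
    by (rule emeasure_nu_FV[OF assms(1) A])
  also have "\<dots> = (\<Sum>s\<^sub>1\<in>?S 0. \<Sum>s\<^sub>2\<in>?S l. ennreal (w (s\<^sub>2 - s\<^sub>1)) * pair_mass \<alpha> l0 (indicator ?A) s\<^sub>1 s\<^sub>2)"
    by (rule FV_integral_eq_sum[OF assms(1) borel_measurable_indicator[OF A]])
      (simp_all only: mass, auto)
  also have "\<dots> = (\<Sum>s\<^sub>1\<in>?S 0. \<Sum>s\<^sub>2\<in>?S l. ennreal (w (s\<^sub>2 - s\<^sub>1)))"
    by (intro sum.cong refl) (simp add: mass)
  \<comment> \<open>Reflection s1 = -a, s2 = l - b makes both ranges [0, l0) and gives s2 - s1 = l +
    (a - b).\<close>
  also have "\<dots> = (\<Sum>a\<in>{0..<int l0}. \<Sum>b\<in>{0..<int l0}. ennreal (w (l + (a - b))))"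
  proof (rule sum.reindex_bij_witness[of _ uminus uminus])
    fix s\<^sub>1 assume "s\<^sub>1 \<in> ?S 0"
    show "(\<Sum>b\<in>{0..<int l0}. ennreal (w (l + (- s\<^sub>1 - b)))) = (\<Sum>s\<^sub>2\<in>?S l. ennreal (w (s\<^sub>2 - s\<^sub>1)))"
      by (rule sum.reindex_bij_witness[of _ "\<lambda>s. l - s" "\<lambda>b. l - b"]) (auto simp: algebra_simps)
  qed auto
  also have "\<dots> = (\<Sum>d = - (int l0 - 1)..int l0 - 1. of_nat (nat (int l0 - \<bar>d\<bar>)) * ennreal (w (l + d)))"
    by (rule sum_square_by_difference) simp
  also have "\<dots> = (\<Sum>d = - (int l0 - 1)..int l0 - 1. ennreal (real_of_int (int l0 - \<bar>d\<bar>) * w (l + d)))"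
  proof (intro sum.cong refl)
    fix d assume "d \<in> {- (int l0 - 1)..int l0 - 1}"
    \<comment> \<open>Since |d| < l0, the truncation at 0 in \<open>nat\<close> has no
      effect.\<close>
    then have eq: "real_of_int (int l0 - \<bar>d\<bar>) = real (nat (int l0 - \<bar>d\<bar>))" by auto
    show "of_nat (nat (int l0 - \<bar>d\<bar>)) * ennreal (w (l + d)) =
        ennreal (real_of_int (int l0 - \<bar>d\<bar>) * w (l + d))"
      by (simp only: eq ennreal_of_nat_eq_real_of_nat ennreal_mult'[OF of_nat_0_le_iff])
  qed
  also have "\<dots> = ennreal (\<Sum>d = - (int l0 - 1)..int l0 - 1. real_of_int (int l0 - \<bar>d\<bar>) * w (l + d))"
    using assms(3) by (intro sum_ennreal) auto
  finally show ?thesis .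
qed

section \<open>The joint law of the volatility and the two noise rows\<close>

lemma prod_emb_pareto:
  "prod_emb UNIV (\<lambda>_. pareto \<alpha>) J (PiE J A) = {x. \<forall>j\<in>J. x j \<in> A j}"
  by (auto simp: prod_emb_def PiE_iff)

lemma emeasure_pareto_cylinder:
  fixes A :: "'i \<Rightarrow> real set"
  assumes "\<alpha> > 0" "finite J" "\<And>j. j \<in> J \<Longrightarrow> A j \<in> sets borel"
  shows "emeasure (PiM UNIV (\<lambda>_. pareto \<alpha>)) {x. \<forall>j\<in>J. x j \<in> A j} = (\<Prod>j\<in>J. emeasure (pareto \<alpha>) (A j))"
  using emeasure_PiM_emb[of UNIV "\<lambda>_. pareto \<alpha>" J A] assms prob_space_pareto[OF assms(1)]
  by (simp add: prod_emb_pareto)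

lemma sets_pareto_seq_cylinder:
  assumes "finite J" "\<And>j. j \<in> J \<Longrightarrow> A j \<in> sets borel"
  shows "{x. \<forall>j\<in>J. x j \<in> A j} \<in> sets (pareto_seq \<alpha>)"
  using sets_PiM_I[of J UNIV A "\<lambda>_. pareto \<alpha>"] assms by (simp add: prod_emb_pareto pareto_seq_def)

text \<open>Independence of the noise is assumed over the joint index set of rows and times, whereas
  the limit integrates two separate sequences. \<open>interleave\<close> and its left inverse
  \<open>rows\<close> pass between the two forms.\<close>

definition interleave :: "(int \<Rightarrow> real) \<times> (int \<Rightarrow> real) \<Rightarrow> 2 \<times> int \<Rightarrow> real" where
  "interleave e = (\<lambda>p. if fst p = 1 then fst e (snd p) else snd e (snd p))"

definition rows :: "(2 \<times> int \<Rightarrow> real) \<Rightarrow> (int \<Rightarrow> real) \<times> (int \<Rightarrow> real)" where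
  "rows x = (\<lambda>s. x (1, s), \<lambda>s. x (2, s))"

lemma rows_interleave: "rows (interleave e) = e"
  by (simp add: rows_def interleave_def)

lemma borel_measurable_seq_nth:
  "sets N = sets borel \<Longrightarrow> (\<lambda>x :: int \<Rightarrow> real. x t) \<in> borel_measurable N"
  using borel_measurable_coordinate[of t] measurable_cong_sets[of N borel borel borel] by blast

lemma measurable_interleave:
  "interleave \<in> measurable (pareto_seq \<alpha> \<Otimes>\<^sub>M pareto_seq \<alpha>) (PiM UNIV (\<lambda>_. pareto \<alpha>))"
proof (rule measurable_PiM_single')
  fix p :: "2 \<times> int"
  have "(\<lambda>e. interleave e p) = (if fst p = 1 then (\<lambda>e. fst e (snd p)) else (\<lambda>e. snd e (snd p)))"
    by (auto simp: interleave_def)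
  moreover have "(\<lambda>e. fst e (snd p)) \<in> measurable (pareto_seq \<alpha> \<Otimes>\<^sub>M pareto_seq \<alpha>) (pareto \<alpha>)"
    "(\<lambda>e. snd e (snd p)) \<in> measurable (pareto_seq \<alpha> \<Otimes>\<^sub>M pareto_seq \<alpha>) (pareto \<alpha>)"
    using borel_measurable_seq_nth[OF sets_pareto_seq, of "snd p" \<alpha>]
    by (auto simp: measurable_cong_sets[OF refl sets_pareto] intro: measurable_compose[OF measurable_fst]
        measurable_compose[OF measurable_snd])
  ultimately show "(\<lambda>e. interleave e p) \<in> measurable (pareto_seq \<alpha> \<Otimes>\<^sub>M pareto_seq \<alpha>) (pareto \<alpha>)"
    by presburger
qed auto

lemma measurable_rows:
  "rows \<in> measurable (PiM UNIV (\<lambda>_. pareto \<alpha>)) (borel \<Otimes>\<^sub>M borel)"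
proof -
  have "(\<lambda>x (s :: int). x (i, s)) \<in> borel_measurable (PiM UNIV (\<lambda>_. pareto \<alpha>))" for i :: 2
  proof (rule measurable_into_path)
    fix t
    have "(\<lambda>x. x (i, t)) \<in> measurable (PiM UNIV (\<lambda>_. pareto \<alpha>)) (pareto \<alpha>)"
      by (rule measurable_component_singleton) simp
    then show "(\<lambda>x. x (i, t)) \<in> borel_measurable (PiM UNIV (\<lambda>_. pareto \<alpha>))"
      by (simp add: measurable_cong_sets[OF refl sets_pareto])
  qed
  then show ?thesis
    unfolding rows_def[abs_def] by (intro measurable_Pair)
qed

text \<open>Cylinders determine the product law. The preimage of a cylinder is a rectangle of row
  cylinders, and the finite product of coordinate masses splits along the row index.\<close>

lemma distr_interleave:
  assumes "\<alpha> > 0"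
  shows "distr (pareto_seq \<alpha> \<Otimes>\<^sub>M pareto_seq \<alpha>) (PiM UNIV (\<lambda>_. pareto \<alpha>)) interleave = PiM UNIV (\<lambda>_. pareto \<alpha>)"
proof (rule measure_eqI_PiM_infinite[symmetric])
  interpret P: prob_space "pareto_seq \<alpha>" using assms by (rule prob_space_pareto_seq)
  interpret prob_space "PiM (UNIV :: (2 \<times> int) set) (\<lambda>_. pareto \<alpha>)"
    by (intro prob_space_PiM prob_space_pareto assms)
  show "finite_measure (PiM (UNIV :: (2 \<times> int) set) (\<lambda>_. pareto \<alpha>))"
    by unfold_locales
  fix A :: "2 \<times> int \<Rightarrow> real set" and J
  assume J: "finite J" "J \<subseteq> UNIV" and A: "\<And>i. i \<in> J \<Longrightarrow> A i \<in> sets (pareto \<alpha>)"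
  let ?J = "\<lambda>i. {s. (i, s) \<in> J}"
  let ?C = "\<lambda>i. {x. \<forall>s\<in>?J i. x s \<in> A (i, s)}"
  let ?E = "{x. \<forall>j\<in>J. x j \<in> A j}"
  have fin: "finite (?J i)" for i
    using finite_vimageI[OF J(1), of "Pair i"] by (simp add: vimage_def inj_on_def)
  have C: "?C i \<in> sets (pareto_seq \<alpha>)" for i
    using fin A by (intro sets_pareto_seq_cylinder) auto
  have split: "interleave -` ?E = ?C 1 \<times> ?C 2"
  proof (rule set_eqI)
    fix e :: "(int \<Rightarrow> real) \<times> (int \<Rightarrow> real)"
    have "(\<forall>j\<in>J. interleave e j \<in> A j) \<longleftrightarrow> (\<forall>i s. (i, s) \<in> J \<longrightarrow> interleave e (i, s) \<in> A (i, s))"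
      by auto
    then show "e \<in> interleave -` ?E \<longleftrightarrow> e \<in> ?C 1 \<times> ?C 2"
      by (cases e) (simp add: forall_2 interleave_def)
  qed
  have rowm: "emeasure (pareto_seq \<alpha>) (?C i) = (\<Prod>s\<in>?J i. emeasure (pareto \<alpha>) (A (i, s)))" for i
    unfolding pareto_seq_def using fin A assms by (intro emeasure_pareto_cylinder) auto
  have prod: "(\<Prod>j\<in>J. emeasure (pareto \<alpha>) (A j)) =
      (\<Prod>s\<in>?J 1. emeasure (pareto \<alpha>) (A (1, s))) * (\<Prod>s\<in>?J 2. emeasure (pareto \<alpha>) (A (2, s)))"
  proof -
    have "J = Pair 1 ` ?J 1 \<union> Pair 2 ` ?J 2"
    proof (rule set_eqI)
      fix p show "p \<in> J \<longleftrightarrow> p \<in> Pair 1 ` ?J 1 \<union> Pair 2 ` ?J 2"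
        using exhaust_2[of "fst p"] by (cases p) auto
    qed
    then have "(\<Prod>j\<in>J. emeasure (pareto \<alpha>) (A j)) =
        (\<Prod>j\<in>Pair 1 ` ?J 1 \<union> Pair 2 ` ?J 2. emeasure (pareto \<alpha>) (A j))" by simp
    also have "\<dots> = (\<Prod>j\<in>Pair 1 ` ?J 1. emeasure (pareto \<alpha>) (A j)) * (\<Prod>j\<in>Pair 2 ` ?J 2. emeasure (pareto \<alpha>) (A j))"
      using fin by (intro prod.union_disjoint) auto
    finally show ?thesis by (simp add: prod.reindex inj_on_def)
  qed
  have cyl: "emeasure (PiM UNIV (\<lambda>_. pareto \<alpha>)) ?E = (\<Prod>j\<in>J. emeasure (pareto \<alpha>) (A j))"
    using J A assms by (intro emeasure_pareto_cylinder) auto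
  have E: "?E \<in> sets (PiM UNIV (\<lambda>_. pareto \<alpha>))"
    using sets_PiM_I[of J UNIV A "\<lambda>_. pareto \<alpha>"] J A by (simp add: prod_emb_pareto)
  have "emeasure (distr (pareto_seq \<alpha> \<Otimes>\<^sub>M pareto_seq \<alpha>) (PiM UNIV (\<lambda>_. pareto \<alpha>)) interleave) ?E =
      emeasure (pareto_seq \<alpha> \<Otimes>\<^sub>M pareto_seq \<alpha>) (?C 1 \<times> ?C 2)"
    unfolding emeasure_distr[OF measurable_interleave E] split by (simp add: space_pair_measure)
  then show "emeasure (PiM UNIV (\<lambda>_. pareto \<alpha>)) (prod_emb UNIV (\<lambda>_. pareto \<alpha>) J (PiE J A)) =
      emeasure (distr (pareto_seq \<alpha> \<Otimes>\<^sub>M pareto_seq \<alpha>) (PiM UNIV (\<lambda>_. pareto \<alpha>)) interleave)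
        (prod_emb UNIV (\<lambda>_. pareto \<alpha>) J (PiE J A))"
    unfolding prod_emb_pareto P.emeasure_pair_measure_Times[OF C C] rowm cyl prod by simp
qed simp_all

text \<open>Push the identity for \<open>interleave\<close> forward along its left inverse.\<close>

lemma distr_rows:
  assumes "\<alpha> > 0"
  shows "distr (PiM UNIV (\<lambda>_. pareto \<alpha>)) (borel \<Otimes>\<^sub>M borel) rows = pareto_seq \<alpha> \<Otimes>\<^sub>M pareto_seq \<alpha>"
proof -
  have "distr (PiM UNIV (\<lambda>_. pareto \<alpha>)) (borel \<Otimes>\<^sub>M borel) rows =
      distr (distr (pareto_seq \<alpha> \<Otimes>\<^sub>M pareto_seq \<alpha>) (PiM UNIV (\<lambda>_. pareto \<alpha>)) interleave) (borel \<Otimes>\<^sub>M borel) rows"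
    unfolding distr_interleave[OF assms] ..
  also have "\<dots> = distr (pareto_seq \<alpha> \<Otimes>\<^sub>M pareto_seq \<alpha>) (borel \<Otimes>\<^sub>M borel) (\<lambda>x. x)"
    by (subst distr_distr[OF measurable_rows measurable_interleave]) (simp add: comp_def rows_interleave)
  also have "\<dots> = pareto_seq \<alpha> \<Otimes>\<^sub>M pareto_seq \<alpha>"
    by (rule distr_id2) (rule sets_pair_measure_cong; simp)
  finally show ?thesis .
qed

lemma borel_measurable_shift: "(\<lambda>x t. x (t + h)) \<in> borel_measurable (borel :: (int \<Rightarrow> real) measure)"
  by (rule measurable_into_path) (rule borel_measurable_coordinate)

lemma distr_pareto_seq_shift:
  assumes "\<alpha> > 0"
  shows "distr (pareto_seq \<alpha>) borel (\<lambda>x t. x (t + h)) = pareto_seq \<alpha>"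
proof -
  have "distr (pareto_seq \<alpha>) borel (\<lambda>x t. x (t + h)) =
      distr (PiM UNIV (\<lambda>_. pareto \<alpha>)) (PiM UNIV (\<lambda>_. pareto \<alpha>)) (\<lambda>x. \<lambda>t\<in>UNIV. x (t + h))"
    unfolding pareto_seq_def using sets_pareto_seq[of \<alpha>]
    by (intro distr_cong) (auto simp: pareto_seq_def)
  also have "\<dots> = pareto_seq \<alpha>"
    unfolding pareto_seq_def
    using distr_PiM_reindex[of UNIV "\<lambda>_. pareto \<alpha>" "\<lambda>t. t + h" UNIV] prob_space_pareto[OF assms] by simp
  finally show ?thesis .
qed

section \<open>The process: joint law of volatility and noise, and strict stationarity\<close>

locale moving_average = prob_space M for M :: "'w measure" +
  fixes \<alpha> :: real and l0 :: nat and V :: "int \<Rightarrow> 'w \<Rightarrow> real" and \<eta> :: "2 \<Rightarrow> int \<Rightarrow> 'w \<Rightarrow> real"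
  assumes \<alpha>: "\<alpha> > 0"
    and l0: "l0 \<ge> 2"
    and V_pos: "\<And>t. AE \<omega> in M. V t \<omega> > 0"
    and V_stationary: "strictly_stationary M V"
    and V_mean: "(\<integral>\<omega>. V 0 \<omega> powr \<alpha> \<partial>M) = 1"
    and V_square: "integrable M (\<lambda>\<omega>. V 0 \<omega> powr (2 * \<alpha>))"
    and \<eta>_indep: "indep_vars (\<lambda>_. borel) (\<lambda>(i, s). \<eta> i s) UNIV"
    and \<eta>_tail: "\<And>i s x. x \<ge> 1 \<Longrightarrow> measure M {\<omega> \<in> space M. \<eta> i s \<omega> > x} = x powr - \<alpha>"
    and V_\<eta>_indep: "independent M (\<lambda>\<omega> t. V t \<omega>) (\<lambda>\<omega> i s. \<eta> i s \<omega>)"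
begin

definition law_V :: "(int \<Rightarrow> real) measure" where
  "law_V = distr M borel (\<lambda>\<omega> t. V t \<omega>)"

lemma measurable_V: "(\<lambda>\<omega> t. V t \<omega>) \<in> borel_measurable M"
  using V_stationary by (simp add: strictly_stationary_def)

lemma measurable_V_nth [measurable]: "V t \<in> borel_measurable M"
  using borel_measurable_path_component[OF measurable_V, of t] by simp

lemma measurable_\<eta> [measurable]: "\<eta> i s \<in> borel_measurable M"
  using \<eta>_indep by (auto simp: indep_vars_def2)

lemma measurable_\<eta>_row: "(\<lambda>\<omega> s. \<eta> i s \<omega>) \<in> borel_measurable M"
  by (rule measurable_into_path) simp

lemma sets_law_V [simp, measurable_cong]: "sets law_V = sets borel"
  by (simp add: law_V_def)

lemma space_law_V [simp]: "space law_V = UNIV"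
  by (simp add: law_V_def)

lemma prob_space_law_V: "prob_space law_V"
  unfolding law_V_def using measurable_V by (rule prob_space_distr)

lemma distr_\<eta>: "distr M borel (\<eta> i s) = pareto \<alpha>"
proof (rule pareto_unique[OF \<alpha>])
  show "prob_space (distr M borel (\<eta> i s))" by (rule prob_space_distr) simp
  show "measure (distr M borel (\<eta> i s)) {x<..} = x powr - \<alpha>" if "x \<ge> 1" for x
    using \<eta>_tail[OF that, of i s] by (subst measure_distr) (auto simp: vimage_def Int_def conj_commute)
qed simp

text \<open>Mutual independence says that the joint law over all rows and times is the product of
  Pareto laws; \<open>rows\<close> then separates it into two independent sequences.\<close>

lemma distr_\<eta>_rows:
  "distr M (borel \<Otimes>\<^sub>M borel) (\<lambda>\<omega>. (\<lambda>s. \<eta> 1 s \<omega>, \<lambda>s. \<eta> 2 s \<omega>)) = pareto_seq \<alpha> \<Otimes>\<^sub>M pareto_seq \<alpha>"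
proof -
  let ?P = "PiM (UNIV :: (2 \<times> int) set) (\<lambda>_. pareto \<alpha>)"
  let ?x = "\<lambda>\<omega> p. \<eta> (fst p) (snd p) \<omega>"
  have sets: "sets ?P = sets (PiM UNIV (\<lambda>_. borel))"
    by (rule sets_PiM_cong) auto
  have law: "distr M (PiM UNIV (\<lambda>_. borel)) ?x = ?P"
    using indep_vars_iff_distr_eq_PiM[of UNIV "\<lambda>(i, s). \<eta> i s" "\<lambda>_. borel"] \<eta>_indep
    by (simp add: split_beta' distr_\<eta> restrict_def)
  have m: "?x \<in> measurable M ?P"
    by (rule measurable_PiM_single') (auto simp: measurable_cong_sets[OF refl sets_pareto])
  have "distr M (borel \<Otimes>\<^sub>M borel) (\<lambda>\<omega>. (\<lambda>s. \<eta> 1 s \<omega>, \<lambda>s. \<eta> 2 s \<omega>)) =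
      distr (distr M ?P ?x) (borel \<Otimes>\<^sub>M borel) rows"
    by (subst distr_distr[OF measurable_rows m]) (simp add: comp_def rows_def)
  also have "distr M ?P ?x = ?P"
    using law distr_cong[OF refl sets[symmetric], of M ?x ?x] by simp
  finally show ?thesis using distr_rows[OF \<alpha>] by simp
qed

text \<open>Independence of V and \<eta> is a statement about events, so the product law is checked
  on rectangles; only then is the noise component mapped to its pair of rows.\<close>

lemma distr_V_\<eta>:
  "distr M (borel \<Otimes>\<^sub>M (borel \<Otimes>\<^sub>M borel)) (\<lambda>\<omega>. (\<lambda>t. V t \<omega>, (\<lambda>s. \<eta> 1 s \<omega>, \<lambda>s. \<eta> 2 s \<omega>))) =
    law_V \<Otimes>\<^sub>M (pareto_seq \<alpha> \<Otimes>\<^sub>M pareto_seq \<alpha>)"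
proof -
  let ?v = "\<lambda>\<omega> t. V t \<omega>" and ?e = "\<lambda>\<omega> i s. \<eta> i s \<omega>"
  let ?r = "\<lambda>g :: 2 \<Rightarrow> int \<Rightarrow> real. (g 1, g 2)"
  have e: "?e \<in> borel_measurable M" and ind: "indep_set {?v -` A \<inter> space M | A. A \<in> sets borel}
      {?e -` A \<inter> space M | A. A \<in> sets borel}"
    using V_\<eta>_indep by (auto simp: independent_def)
  have law_e: "prob_space (distr M borel ?e)" using e by (rule prob_space_distr)
  have joint: "law_V \<Otimes>\<^sub>M distr M borel ?e = distr M (borel \<Otimes>\<^sub>M borel) (\<lambda>\<omega>. (?v \<omega>, ?e \<omega>))"
  proof (rule pair_measure_eqI)
    show "sigma_finite_measure law_V" "sigma_finite_measure (distr M borel ?e)"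
      using prob_space_law_V law_e by (simp_all add: prob_space_imp_sigma_finite)
    show "sets (law_V \<Otimes>\<^sub>M distr M borel ?e) = sets (distr M (borel \<Otimes>\<^sub>M borel) (\<lambda>\<omega>. (?v \<omega>, ?e \<omega>)))"
      unfolding sets_distr by (rule sets_pair_measure_cong) simp_all
    fix A B assume A: "A \<in> sets law_V" and B: "B \<in> sets (distr M borel ?e)"
    have pr: "prob ((?v -` A \<inter> space M) \<inter> (?e -` B \<inter> space M)) =
        prob (?v -` A \<inter> space M) * prob (?e -` B \<inter> space M)"
      using A B by (intro indep_setD[OF ind]) auto
    have "emeasure (distr M (borel \<Otimes>\<^sub>M borel) (\<lambda>\<omega>. (?v \<omega>, ?e \<omega>))) (A \<times> B) =
        emeasure M ((?v -` A \<inter> space M) \<inter> (?e -` B \<inter> space M))"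
      using A B measurable_V e by (subst emeasure_distr) (auto intro!: arg_cong[where f = "emeasure M"])
    also have "\<dots> = emeasure M (?v -` A \<inter> space M) * emeasure M (?e -` B \<inter> space M)"
      unfolding emeasure_eq_measure pr by (simp only: ennreal_mult'[OF measure_nonneg])
    also have "\<dots> = emeasure law_V A * emeasure (distr M borel ?e) B"
      using A B measurable_V e by (simp add: law_V_def emeasure_distr)
    finally show "emeasure law_V A * emeasure (distr M borel ?e) B =
        emeasure (distr M (borel \<Otimes>\<^sub>M borel) (\<lambda>\<omega>. (?v \<omega>, ?e \<omega>))) (A \<times> B)" ..
  qed
  have nth: "(\<lambda>g :: 2 \<Rightarrow> int \<Rightarrow> real. g i) \<in> borel_measurable borel" for i
    by (rule measurable_product_then_coordinatewise) simp
  have r: "?r \<in> measurable borel (borel \<Otimes>\<^sub>M borel)"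
    by (rule measurable_Pair[OF nth nth])
  have ve: "(\<lambda>\<omega>. (?v \<omega>, ?e \<omega>)) \<in> measurable M (borel \<Otimes>\<^sub>M borel)"
    using measurable_V e by (rule measurable_Pair)
  have idr: "(\<lambda>(v, g). (v, ?r g)) \<in> measurable (borel \<Otimes>\<^sub>M borel) (borel \<Otimes>\<^sub>M (borel \<Otimes>\<^sub>M borel))"
    unfolding split_beta'
    by (rule measurable_Pair[OF measurable_fst measurable_compose[OF measurable_snd r]])
  have law_r: "distr (distr M borel ?e) (borel \<Otimes>\<^sub>M borel) ?r = pareto_seq \<alpha> \<Otimes>\<^sub>M pareto_seq \<alpha>"
    using distr_\<eta>_rows by (subst distr_distr[OF r e]) (simp add: comp_def)
  interpret P: prob_space "pareto_seq \<alpha>" using \<alpha> by (rule prob_space_pareto_seq)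
  interpret PP: pair_prob_space "pareto_seq \<alpha>" "pareto_seq \<alpha>" ..
  have "law_V \<Otimes>\<^sub>M (pareto_seq \<alpha> \<Otimes>\<^sub>M pareto_seq \<alpha>) =
      distr law_V borel (\<lambda>v. v) \<Otimes>\<^sub>M distr (distr M borel ?e) (borel \<Otimes>\<^sub>M borel) ?r"
    by (simp add: law_r distr_id2)
  also have "\<dots> = distr (law_V \<Otimes>\<^sub>M distr M borel ?e) (borel \<Otimes>\<^sub>M (borel \<Otimes>\<^sub>M borel)) (\<lambda>(v, g). (v, ?r g))"
  proof (rule pair_measure_distr)
    show "(\<lambda>v. v) \<in> measurable law_V borel" by (simp add: measurable_ident_sets)
    show "?r \<in> measurable (distr M borel ?e) (borel \<Otimes>\<^sub>M borel)"
      using r by simp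
    show "sigma_finite_measure (distr (distr M borel ?e) (borel \<Otimes>\<^sub>M borel) ?r)"
      unfolding law_r ..
  qed
  also have "\<dots> = distr M (borel \<Otimes>\<^sub>M (borel \<Otimes>\<^sub>M borel)) (\<lambda>\<omega>. (?v \<omega>, (?e \<omega> 1, ?e \<omega> 2)))"
    unfolding joint by (subst distr_distr[OF idr ve]) (simp add: comp_def)
  finally show ?thesis by simp
qed

lemma measurable_V_\<eta>:
  "(\<lambda>\<omega>. (\<lambda>t. V t \<omega>, (\<lambda>s. \<eta> 1 s \<omega>, \<lambda>s. \<eta> 2 s \<omega>))) \<in> measurable M (borel \<Otimes>\<^sub>M (borel \<Otimes>\<^sub>M borel))"
  by (intro measurable_Pair measurable_V measurable_\<eta>_row)

text \<open>The volatility is outermost, so for fixed v the two rows are driven by independent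
  Pareto sequences and can be treated one after the other.\<close>

lemma nn_integral_V_\<eta>:
  assumes h: "h \<in> borel_measurable (borel \<Otimes>\<^sub>M (borel \<Otimes>\<^sub>M borel))"
  shows "(\<integral>\<^sup>+\<omega>. h (\<lambda>t. V t \<omega>, (\<lambda>s. \<eta> 1 s \<omega>, \<lambda>s. \<eta> 2 s \<omega>)) \<partial>M) =
    (\<integral>\<^sup>+v. \<integral>\<^sup>+e\<^sub>1. \<integral>\<^sup>+e\<^sub>2. h (v, e\<^sub>1, e\<^sub>2) \<partial>pareto_seq \<alpha> \<partial>pareto_seq \<alpha> \<partial>law_V)"
proof -
  interpret P: prob_space "pareto_seq \<alpha>" using \<alpha> by (rule prob_space_pareto_seq)
  interpret PP: pair_prob_space "pareto_seq \<alpha>" "pareto_seq \<alpha>" ..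
  have sigma: "sigma_finite_measure (pareto_seq \<alpha> \<Otimes>\<^sub>M pareto_seq \<alpha>)" ..
  have sets2: "sets (pareto_seq \<alpha> \<Otimes>\<^sub>M pareto_seq \<alpha>) = sets (borel \<Otimes>\<^sub>M borel)"
    by (rule sets_pair_measure_cong) simp_all
  have sets3: "sets (law_V \<Otimes>\<^sub>M (pareto_seq \<alpha> \<Otimes>\<^sub>M pareto_seq \<alpha>)) = sets (borel \<Otimes>\<^sub>M (borel \<Otimes>\<^sub>M borel))"
    by (rule sets_pair_measure_cong) (simp_all add: sets2)
  have h3: "h \<in> borel_measurable (law_V \<Otimes>\<^sub>M (pareto_seq \<alpha> \<Otimes>\<^sub>M pareto_seq \<alpha>))"
    using h unfolding measurable_cong_sets[OF sets3 refl] .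
  have h2: "(\<lambda>e. h (v, e)) \<in> borel_measurable (pareto_seq \<alpha> \<Otimes>\<^sub>M pareto_seq \<alpha>)" for v
    by (rule measurable_compose[OF _ h3]) simp
  have "(\<integral>\<^sup>+\<omega>. h (\<lambda>t. V t \<omega>, (\<lambda>s. \<eta> 1 s \<omega>, \<lambda>s. \<eta> 2 s \<omega>)) \<partial>M) =
      (\<integral>\<^sup>+x. h x \<partial>(law_V \<Otimes>\<^sub>M (pareto_seq \<alpha> \<Otimes>\<^sub>M pareto_seq \<alpha>)))"
    unfolding distr_V_\<eta>[symmetric] using h by (subst nn_integral_distr[OF measurable_V_\<eta>]) simp_all
  also have "\<dots> = (\<integral>\<^sup>+v. \<integral>\<^sup>+e. h (v, e) \<partial>(pareto_seq \<alpha> \<Otimes>\<^sub>M pareto_seq \<alpha>) \<partial>law_V)"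
    by (rule sigma_finite_measure.nn_integral_fst[OF sigma h3, symmetric])
  also have "\<dots> = (\<integral>\<^sup>+v. \<integral>\<^sup>+e\<^sub>1. \<integral>\<^sup>+e\<^sub>2. h (v, e\<^sub>1, e\<^sub>2) \<partial>pareto_seq \<alpha> \<partial>pareto_seq \<alpha> \<partial>law_V)"
    by (intro nn_integral_cong P.nn_integral_fst[OF h2, symmetric])
  finally show ?thesis .
qed

text \<open>Writing the process as a fixed measurable functional of volatility and noise reduces
  measurability and stationarity to properties of the input law.\<close>

definition sample_path :: "(int \<Rightarrow> real) \<times> (int \<Rightarrow> real) \<times> (int \<Rightarrow> real) \<Rightarrow> int \<Rightarrow> real^2" where
  "sample_path x = pair_path (moving_sum l0 (\<lambda>s. fst x s * fst (snd x) s))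
    (moving_sum l0 (\<lambda>s. fst x s * snd (snd x) s))"

lemma MA_process_eq:
  "(\<lambda>t. MA_process l0 V \<eta> t \<omega>) = sample_path (\<lambda>t. V t \<omega>, (\<lambda>s. \<eta> 1 s \<omega>, \<lambda>s. \<eta> 2 s \<omega>))"
  by (rule ext) (simp add: vec_eq_iff forall_2 sample_path_def MA_process_def moving_sum_def)

lemma measurable_sample_path: "sample_path \<in> borel_measurable (borel \<Otimes>\<^sub>M (borel \<Otimes>\<^sub>M borel))"
proof -
  have "(\<lambda>x s. fst x s * p (snd x) s) \<in> borel_measurable (borel \<Otimes>\<^sub>M (borel \<Otimes>\<^sub>M borel))"
    if "p \<in> borel_measurable (borel \<Otimes>\<^sub>M borel)"
    for p :: "(int \<Rightarrow> real) \<times> (int \<Rightarrow> real) \<Rightarrow> int \<Rightarrow> real"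
  proof (rule measurable_into_path)
    fix t
    show "(\<lambda>x. fst x t * p (snd x) t) \<in> borel_measurable (borel \<Otimes>\<^sub>M (borel \<Otimes>\<^sub>M borel))"
      by (rule borel_measurable_times[OF borel_measurable_path_component[OF measurable_fst]
            borel_measurable_path_component[OF measurable_compose[OF measurable_snd that]]])
  qed
  from this[OF measurable_fst] this[OF measurable_snd] show ?thesis
    unfolding sample_path_def[abs_def]
    by (intro borel_measurable_pair_path measurable_compose[OF _ borel_measurable_moving_sum])
qed

lemma measurable_MA: "(\<lambda>\<omega> t. MA_process l0 V \<eta> t \<omega>) \<in> borel_measurable M"
  unfolding MA_process_eq by (rule measurable_compose[OF measurable_V_\<eta> measurable_sample_path])

lemma distr_law_V_shift: "distr law_V borel (\<lambda>x t. x (t + h)) = law_V"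
proof -
  have "distr law_V borel (\<lambda>x t. x (t + h)) = distr M borel (\<lambda>\<omega> t. V (t + h) \<omega>)"
    unfolding law_V_def by (subst distr_distr[OF borel_measurable_shift measurable_V]) (simp add: comp_def)
  then show ?thesis using V_stationary by (simp add: strictly_stationary_def law_V_def)
qed

text \<open>A common shift of v and both noise rows shifts the output path, and it preserves the
  input law because it preserves each of the three independent factors.\<close>

lemma strictly_stationary_MA: "strictly_stationary M (MA_process l0 V \<eta>)"
  unfolding strictly_stationary_def
proof (intro conjI allI measurable_MA)
  fix h
  let ?B = "borel :: (int \<Rightarrow> real) measure"
  let ?L = "law_V \<Otimes>\<^sub>M (pareto_seq \<alpha> \<Otimes>\<^sub>M pareto_seq \<alpha>)"
  let ?x = "\<lambda>\<omega>. (\<lambda>t. V t \<omega>, (\<lambda>s. \<eta> 1 s \<omega>, \<lambda>s. \<eta> 2 s \<omega>))"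
  define sh :: "(int \<Rightarrow> real) \<Rightarrow> int \<Rightarrow> real" where "sh = (\<lambda>x t. x (t + h))"
  define sh2 where "sh2 = (\<lambda>(x, y). (sh x, sh y))"
  define sh3 where "sh3 = (\<lambda>(x, y). (sh x, sh2 y))"
  interpret P: prob_space "pareto_seq \<alpha>" using \<alpha> by (rule prob_space_pareto_seq)
  interpret PP: pair_prob_space "pareto_seq \<alpha>" "pareto_seq \<alpha>" ..
  have sh: "sh \<in> measurable N ?B" if "sets N = sets borel" for N
    using borel_measurable_shift[of h] measurable_cong_sets[OF that refl] unfolding sh_def by blast
  have sets2: "sets (pareto_seq \<alpha> \<Otimes>\<^sub>M pareto_seq \<alpha>) = sets (?B \<Otimes>\<^sub>M ?B)"
    by (rule sets_pair_measure_cong) simp_all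
  have sh2: "sh2 \<in> measurable N (?B \<Otimes>\<^sub>M ?B)" if "sets N = sets (?B \<Otimes>\<^sub>M ?B)" for N
    unfolding sh2_def split_beta' measurable_cong_sets[OF that refl]
    by (intro measurable_Pair measurable_compose[OF measurable_fst sh] measurable_compose[OF measurable_snd sh] refl)
  have sh3: "sh3 \<in> measurable (?B \<Otimes>\<^sub>M (?B \<Otimes>\<^sub>M ?B)) (?B \<Otimes>\<^sub>M (?B \<Otimes>\<^sub>M ?B))"
    unfolding sh3_def split_beta'
    by (intro measurable_Pair measurable_compose[OF measurable_fst sh] measurable_compose[OF measurable_snd sh2] refl)
  have law2: "distr (pareto_seq \<alpha> \<Otimes>\<^sub>M pareto_seq \<alpha>) (?B \<Otimes>\<^sub>M ?B) sh2 = pareto_seq \<alpha> \<Otimes>\<^sub>M pareto_seq \<alpha>"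
  proof -
    have "distr (pareto_seq \<alpha>) ?B sh = pareto_seq \<alpha>"
      unfolding sh_def by (rule distr_pareto_seq_shift[OF \<alpha>])
    then show ?thesis
      using pair_measure_distr[of sh "pareto_seq \<alpha>" ?B sh "pareto_seq \<alpha>" ?B] sh[OF sets_pareto_seq]
        P.sigma_finite_measure_axioms
      unfolding sh2_def by simp
  qed
  have law3: "distr ?L (?B \<Otimes>\<^sub>M (?B \<Otimes>\<^sub>M ?B)) sh3 = ?L"
  proof -
    have "distr law_V ?B sh = law_V"
      unfolding sh_def by (rule distr_law_V_shift)
    moreover have "sigma_finite_measure (pareto_seq \<alpha> \<Otimes>\<^sub>M pareto_seq \<alpha>)" ..
    ultimately show ?thesis
      using pair_measure_distr[of sh law_V ?B sh2 "pareto_seq \<alpha> \<Otimes>\<^sub>M pareto_seq \<alpha>" "?B \<Otimes>\<^sub>M ?B"]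
        sh[OF sets_law_V] sh2[OF sets2] law2
      unfolding sh3_def by simp
  qed
  have eq: "(\<lambda>t. MA_process l0 V \<eta> (t + h) \<omega>) = sample_path (sh3 (?x \<omega>))" for \<omega>
    by (rule ext)
      (simp add: vec_eq_iff forall_2 sample_path_def MA_process_def moving_sum_def sh3_def sh2_def sh_def algebra_simps)
  have "distr M borel (\<lambda>\<omega> t. MA_process l0 V \<eta> (t + h) \<omega>) = distr (distr ?L (?B \<Otimes>\<^sub>M (?B \<Otimes>\<^sub>M ?B)) sh3) borel sample_path"
    unfolding eq distr_V_\<eta>[symmetric]
    by (subst distr_distr[OF sh3 measurable_V_\<eta>], subst distr_distr[OF measurable_sample_path])
      (auto simp: comp_def intro: measurable_compose[OF measurable_V_\<eta> sh3])
  also have "\<dots> = distr M borel (\<lambda>\<omega> t. MA_process l0 V \<eta> t \<omega>)"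
    unfolding law3 unfolding MA_process_eq distr_V_\<eta>[symmetric]
    by (subst distr_distr[OF measurable_sample_path measurable_V_\<eta>]) (simp add: comp_def)
  finally show "distr M borel (\<lambda>\<omega> t. MA_process l0 V \<eta> (t + h) \<omega>) =
      distr M borel (\<lambda>\<omega> t. MA_process l0 V \<eta> t \<omega>)" .
qed

end

section \<open>The two-row limit\<close>

lemma borel_measurable_noise_path:
  assumes "f \<in> borel_measurable N" "g \<in> borel_measurable N"
  shows "(\<lambda>x. moving_sum l0 (scaled_noise (f x) u (g x))) \<in> borel_measurable N"
proof (rule measurable_compose[OF _ borel_measurable_moving_sum], rule measurable_into_path)
  fix t
  have "(\<lambda>x. f x t * g x t) \<in> borel_measurable N"
    by (rule borel_measurable_times[OF assms[THEN borel_measurable_path_component]])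
  then show "(\<lambda>x. scaled_noise (f x) u (g x) t) \<in> borel_measurable N"
    unfolding scaled_noise_def by simp
qed

text \<open>This is 2ab \<le> a^2 + b^2 with a factor 2 given away. It bounds mixed moments of the
  volatility by single moments of order 2 \<alpha>.\<close>

lemma mult_powr_le_square:
  fixes x y :: real
  shows "x powr a * y powr a \<le> x powr (2 * a) + y powr (2 * a)"
proof -
  have sq: "z powr (2 * a) = (z powr a)\<^sup>2" for z :: real
    by (simp add: power2_eq_square powr_add[symmetric])
  have "2 * (x powr a * y powr a) \<le> (x powr a)\<^sup>2 + (y powr a)\<^sup>2" "0 \<le> x powr a * y powr a"
    using sum_squares_bound[of "x powr a" "y powr a"] by simp_all
  then show ?thesis unfolding sq by linarith
qed

lemma tendsto_pair_path:
  assumes "\<And>t. (\<lambda>n. f n t) \<longlonglongrightarrow> f' t" "\<And>t. (\<lambda>n. h n t) \<longlonglongrightarrow> h' t"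
  shows "(\<lambda>n. pair_path (f n) (h n) t) \<longlonglongrightarrow> pair_path f' h' t"
proof (rule vec_tendstoI)
  fix i :: 2
  show "(\<lambda>n. pair_path (f n) (h n) t $ i) \<longlonglongrightarrow> pair_path f' h' t $ i"
    using exhaust_2[of i] assms[of t] by (elim disjE) simp_all
qed

lemma borel_measurable_pair_path_row:
  assumes "H \<in> borel_measurable borel"
  shows "(\<lambda>h. H (pair_path f h)) \<in> borel_measurable borel"
proof -
  have "(\<lambda>h. pair_path f h) \<in> borel_measurable borel"
    by (rule borel_measurable_pair_path) simp_all
  then show ?thesis using assms by (rule measurable_compose)
qed

section \<open>Moments of the volatility and the limit for two rows\<close>

context moving_average begin

abbreviation w :: "int \<Rightarrow> real" where "w \<equiv> w_coeff M V \<alpha>"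

lemma nn_integral_law_V:
  "g \<in> borel_measurable borel \<Longrightarrow> (\<integral>\<^sup>+v. g v \<partial>law_V) = (\<integral>\<^sup>+\<omega>. g (\<lambda>t. V t \<omega>) \<partial>M)"
  unfolding law_V_def using measurable_V by (subst nn_integral_distr) simp_all

lemma nn_integral_law_V_shift:
  assumes "g \<in> borel_measurable borel"
  shows "(\<integral>\<^sup>+v. g (\<lambda>t. v (t + h)) \<partial>law_V) = (\<integral>\<^sup>+v. g v \<partial>law_V)"
proof -
  have "(\<lambda>x t. x (t + h)) \<in> measurable law_V borel"
    using borel_measurable_shift[of h] by (simp add: measurable_cong_sets[OF sets_law_V refl])
  then have "(\<integral>\<^sup>+v. g v \<partial>distr law_V borel (\<lambda>x t. x (t + h))) = (\<integral>\<^sup>+v. g (\<lambda>t. v (t + h)) \<partial>law_V)"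
    using assms by (subst nn_integral_distr) simp_all
  then show ?thesis by (simp add: distr_law_V_shift)
qed

text \<open>Time is countable, so the exceptional null sets unite to one; the deterministic limit
  theorem needs every v(t) positive at once.\<close>

lemma AE_law_V_pos: "AE v in law_V. \<forall>t. v t > 0"
proof -
  have "AE v in law_V. v t > 0" for t
  proof -
    have "{v \<in> space (borel :: (int \<Rightarrow> real) measure). v t > 0} \<in> sets borel"
      using measurable_sets[OF borel_measurable_coordinate, of "{0<..}" t] by (simp add: vimage_def)
    then show ?thesis
      unfolding law_V_def using V_pos[of t] by (subst AE_distr_iff[OF measurable_V]) auto
  qed
  then show ?thesis by (simp add: AE_all_countable)
qed

lemma borel_measurable_coordinate_powr:
  "(\<lambda>v :: int \<Rightarrow> real. v s powr a) \<in> borel_measurable borel"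
  by (rule measurable_compose[OF borel_measurable_coordinate]) simp

lemma integrable_V_square: "integrable M (\<lambda>\<omega>. V t \<omega> powr (2 * \<alpha>))"
proof -
  have "(\<integral>\<^sup>+\<omega>. ennreal (V t \<omega> powr (2 * \<alpha>)) \<partial>M) = (\<integral>\<^sup>+v. ennreal (v t powr (2 * \<alpha>)) \<partial>law_V)"
    using borel_measurable_coordinate_powr by (subst nn_integral_law_V) simp_all
  also have "\<dots> = (\<integral>\<^sup>+v. ennreal (v 0 powr (2 * \<alpha>)) \<partial>law_V)"
    using nn_integral_law_V_shift[of "\<lambda>v. ennreal (v 0 powr (2 * \<alpha>))" t] borel_measurable_coordinate_powr
    by simp
  also have "\<dots> = (\<integral>\<^sup>+\<omega>. ennreal (V 0 \<omega> powr (2 * \<alpha>)) \<partial>M)"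
    using borel_measurable_coordinate_powr by (subst nn_integral_law_V) simp_all
  also have "\<dots> < \<infinity>"
    using V_square by (simp add: integrable_iff_bounded)
  finally show ?thesis by (simp add: integrable_iff_bounded)
qed

lemma integrable_V_product: "integrable M (\<lambda>\<omega>. V s \<omega> powr \<alpha> * V t \<omega> powr \<alpha>)"
  by (rule Bochner_Integration.integrable_bound[OF Bochner_Integration.integrable_add[OF integrable_V_square[of s] integrable_V_square[of t]]])
    (auto simp: mult_powr_le_square)

lemma w_nonneg: "w \<delta> \<ge> 0"
  by (simp add: w_coeff_def)

text \<open>Stationarity moves the first time to 0, so only the lag remains.\<close>

lemma nn_integral_V_product:
  "(\<integral>\<^sup>+v. ennreal (v s\<^sub>1 powr \<alpha>) * ennreal (v s\<^sub>2 powr \<alpha>) \<partial>law_V) = ennreal (w (s\<^sub>2 - s\<^sub>1))"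
proof -
  have m: "(\<lambda>v. ennreal (v 0 powr \<alpha> * v (s\<^sub>2 - s\<^sub>1) powr \<alpha>)) \<in> borel_measurable borel"
    using borel_measurable_times[OF borel_measurable_coordinate_powr borel_measurable_coordinate_powr]
    by simp
  have "(\<integral>\<^sup>+v. ennreal (v s\<^sub>1 powr \<alpha>) * ennreal (v s\<^sub>2 powr \<alpha>) \<partial>law_V) =
      (\<integral>\<^sup>+v. ennreal (v 0 powr \<alpha> * v (s\<^sub>2 - s\<^sub>1) powr \<alpha>) \<partial>law_V)"
    using nn_integral_law_V_shift[OF m, of s\<^sub>1] by (simp add: ennreal_mult')
  also have "\<dots> = (\<integral>\<^sup>+\<omega>. ennreal (V 0 \<omega> powr \<alpha> * V (s\<^sub>2 - s\<^sub>1) \<omega> powr \<alpha>) \<partial>M)"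
    by (rule nn_integral_law_V[OF m])
  also have "\<dots> = ennreal (w (s\<^sub>2 - s\<^sub>1))"
    unfolding w_coeff_def by (rule nn_integral_eq_integral[OF integrable_V_product]) simp
  finally show ?thesis .
qed

lemma nn_integral_V_powr: "(\<integral>\<^sup>+v. ennreal (v s powr \<alpha>) \<partial>law_V) = 1"
proof -
  \<comment> \<open>A function that is not integrable has Bochner integral 0 by convention, which
    the mean 1 excludes.\<close>
  have int: "integrable M (\<lambda>\<omega>. V 0 \<omega> powr \<alpha>)"
    using V_mean not_integrable_integral_eq by fastforce
  have m: "(\<lambda>v. ennreal (v 0 powr \<alpha>)) \<in> borel_measurable borel"
    using borel_measurable_coordinate_powr by simp
  have "(\<integral>\<^sup>+v. ennreal (v s powr \<alpha>) \<partial>law_V) = (\<integral>\<^sup>+\<omega>. ennreal (V 0 \<omega> powr \<alpha>) \<partial>M)"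
    using nn_integral_law_V_shift[OF m, of s] nn_integral_law_V[OF m] by simp
  also have "\<dots> = ennreal (\<integral>\<omega>. V 0 \<omega> powr \<alpha> \<partial>M)"
    by (rule nn_integral_eq_integral[OF int]) simp
  finally show ?thesis using V_mean by simp
qed

text \<open>A vanishing second moment of V(0)^\<alpha> would force V(0) = 0 almost surely.
  Positivity makes the diagonal source pairs visible to \<open>nu_FV\<close>, hence the infinite row
  masses.\<close>

lemma w_0_pos: "w 0 > 0"
proof (rule ccontr)
  assume "\<not> w 0 > 0"
  then have "w 0 = 0" using w_nonneg[of 0] by linarith
  moreover have "(\<integral>\<^sup>+\<omega>. ennreal (V 0 \<omega> powr \<alpha> * V 0 \<omega> powr \<alpha>) \<partial>M) = ennreal (w 0)"
    unfolding w_coeff_def by (rule nn_integral_eq_integral[OF integrable_V_product]) simp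
  ultimately have "(\<integral>\<^sup>+\<omega>. ennreal (V 0 \<omega> powr \<alpha> * V 0 \<omega> powr \<alpha>) \<partial>M) = 0" by simp
  then have "AE \<omega> in M. ennreal (V 0 \<omega> powr \<alpha> * V 0 \<omega> powr \<alpha>) = 0"
    by (subst (asm) nn_integral_0_iff_AE) simp_all
  with V_pos[of 0] have "AE \<omega> in M. False"
    by eventually_elim simp
  then show False by simp
qed

abbreviation noise_path :: "(int \<Rightarrow> real) \<Rightarrow> real \<Rightarrow> (int \<Rightarrow> real) \<Rightarrow> int \<Rightarrow> real" where
  "noise_path v u e \<equiv> moving_sum l0 (scaled_noise v u e)"

lemma rescale_MA:
  "rescale u (\<lambda>t. MA_process l0 V \<eta> t \<omega>) =
    pair_path (noise_path (\<lambda>t. V t \<omega>) (u $ 1) (\<lambda>s. \<eta> 1 s \<omega>)) (noise_path (\<lambda>t. V t \<omega>) (u $ 2) (\<lambda>s. \<eta> 2 s \<omega>))"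
  by (rule ext)
    (simp add: vec_eq_iff forall_2 rescale_def MA_process_def moving_sum_def scaled_noise_def sum_divide_distrib)

text \<open>Two nested uses of the one-row theorem for fixed v, followed by dominated convergence in
  v. The finiteness claim, applied to |F|, later supplies integrability of a test function under
  \<open>nu_FV\<close>.\<close>

lemma pair_limit:
  assumes K: "finite K\<^sub>1" "finite K\<^sub>2" and \<epsilon>: "\<epsilon>\<^sub>1 > 0" "\<epsilon>\<^sub>2 > 0"
    and H: "H \<in> borel_measurable borel"
    and C: "\<And>f. H f \<le> C" "C < \<infinity>"
    and supp: "\<And>f. (\<forall>t\<in>K\<^sub>1. \<bar>f t $ 1\<bar> \<le> \<epsilon>\<^sub>1) \<or> (\<forall>t\<in>K\<^sub>2. \<bar>f t $ 2\<bar> \<le> \<epsilon>\<^sub>2) \<Longrightarrow> H f = 0"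
    and cont: "\<And>x y. (\<And>t. (\<lambda>n. x n t) \<longlonglongrightarrow> y t) \<Longrightarrow> (\<lambda>n. H (x n)) \<longlonglongrightarrow> H y"
    and u: "\<And>n i. u n $ i > 0" "\<And>i. filterlim (\<lambda>n. u n $ i) at_top sequentially"
  shows "(\<lambda>n. ennreal ((u n $ 1) powr \<alpha>) * ennreal ((u n $ 2) powr \<alpha>) *
      (\<integral>\<^sup>+\<omega>. H (rescale (u n) (\<lambda>t. MA_process l0 V \<eta> t \<omega>)) \<partial>M)) \<longlonglongrightarrow> FV_integral \<alpha> l0 w H"
    and "FV_integral \<alpha> l0 w H < \<infinity>"
proof -
  let ?B = "borel :: (int \<Rightarrow> real) measure" and ?P = "pareto_seq \<alpha>"
  let ?S\<^sub>1 = "sources l0 K\<^sub>1" and ?S\<^sub>2 = "sources l0 K\<^sub>2"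
  interpret P: prob_space ?P using \<alpha> by (rule prob_space_pareto_seq)
  interpret pt: sigma_finite_measure "power_tail \<alpha>" using \<alpha> by (rule sigma_finite_power_tail)
  have fin: "finite ?S\<^sub>1" "finite ?S\<^sub>2" using K by (simp_all add: finite_sources)
  have l0': "l0 > 0" using l0 by simp
  define c\<^sub>1 c\<^sub>2 where "c\<^sub>1 n = ennreal ((u n $ 1) powr \<alpha>)" and "c\<^sub>2 n = ennreal ((u n $ 2) powr \<alpha>)" for n
  \<comment> \<open>Row 2 is integrated out while row 1 is frozen at the path f; \<open>g'\<close>
    is the limit of this functional.\<close>
  define g where "g n v f = c\<^sub>2 n * (\<integral>\<^sup>+e. H (pair_path f (noise_path v (u n $ 2) e)) \<partial>?P)" for n v f
  define g' where "g' v f = (\<Sum>s\<in>?S\<^sub>2. ennreal (v s powr \<alpha>) *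
      (\<integral>\<^sup>+r. H (pair_path f (\<lambda>t. r * phi l0 s t)) \<partial>power_tail \<alpha>))" for v f
  define G where "G n v = c\<^sub>1 n * (\<integral>\<^sup>+e. g n v (noise_path v (u n $ 1) e) \<partial>?P)" for n v
  define T where "T v = (\<Sum>s\<in>?S\<^sub>1. ennreal (v s powr \<alpha>) *
      (\<integral>\<^sup>+r. g' v (\<lambda>t. r * phi l0 s t) \<partial>power_tail \<alpha>))" for v
  define b\<^sub>2 where "b\<^sub>2 v = (\<Sum>s\<in>?S\<^sub>2. ennreal (v s powr \<alpha>)) * (C * ennreal ((\<epsilon>\<^sub>2 / l0) powr - \<alpha>))"
    for v :: "int \<Rightarrow> real"
  define b where "b v = (\<Sum>s\<in>?S\<^sub>1. ennreal (v s powr \<alpha>)) * (b\<^sub>2 v * ennreal ((\<epsilon>\<^sub>1 / l0) powr - \<alpha>))"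
    for v :: "int \<Rightarrow> real"
  note meas_row = borel_measurable_pair_path_row[OF H]
  have g_meas: "g n v \<in> borel_measurable borel" for n v
  proof -
    have "(\<lambda>x. H (pair_path (fst x) (noise_path v (u n $ 2) (snd x)))) \<in> borel_measurable (?B \<Otimes>\<^sub>M ?P)"
    proof (rule measurable_compose[OF borel_measurable_pair_path[OF measurable_fst borel_measurable_noise_path] H])
      show "snd \<in> borel_measurable (?B \<Otimes>\<^sub>M ?P)"
        using measurable_snd[of ?B ?P] measurable_cong_sets[OF refl sets_pareto_seq] by blast
    qed simp
    then show ?thesis
      unfolding g_def[abs_def] by (intro borel_measurable_times_ennreal measurable_const P.borel_measurable_nn_integral)
        (simp_all add: split_beta')
  qed
  have g_supp: "g n v f = 0" if "\<And>t. t \<in> K\<^sub>1 \<Longrightarrow> \<bar>f t\<bar> \<le> \<epsilon>\<^sub>1" for n v f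
    using that by (simp add: g_def supp)
  have g_bound: "g n v f \<le> b\<^sub>2 v" if "\<And>t. v t > 0" for n v f
    unfolding g_def c\<^sub>2_def b\<^sub>2_def
  proof (rule nn_integral_moving_sum_bound[OF \<alpha> u(1) l0' K(2) that \<epsilon>(2) meas_row _ C(1)])
    show "H (pair_path f x) = 0" if "\<And>t. t \<in> K\<^sub>2 \<Longrightarrow> \<bar>x t\<bar> \<le> \<epsilon>\<^sub>2" for x
      using that by (simp add: supp)
  qed
  have g_lim: "(\<lambda>n. g n v (x n)) \<longlonglongrightarrow> g' v y" if v: "\<And>t. v t > 0" and x: "\<And>t. (\<lambda>n. x n t) \<longlonglongrightarrow> y t" for v x y
    unfolding g_def c\<^sub>2_def g'_def
  proof (rule nn_integral_moving_sum_tendsto[where G = "\<lambda>n h. H (pair_path (x n) h)" and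
        H = "\<lambda>h. H (pair_path y h)", OF \<alpha> l0' K(2) v \<epsilon>(2) u meas_row _ C])
    show "H (pair_path (x n) h) = 0" if "\<And>t. t \<in> K\<^sub>2 \<Longrightarrow> \<bar>h t\<bar> \<le> \<epsilon>\<^sub>2" for n h
      using that by (simp add: supp)
    show "(\<lambda>n. H (pair_path (x n) (h n))) \<longlonglongrightarrow> H (pair_path y h')" if "\<And>t. (\<lambda>n. h n t) \<longlonglongrightarrow> h' t" for h h'
      by (rule cont) (rule tendsto_pair_path[OF x that])
  qed
  have b\<^sub>2_fin: "b\<^sub>2 v < \<infinity>" for v
    using C(2) fin by (simp add: b\<^sub>2_def ennreal_mult_less_top)
  have G_bound: "G n v \<le> b v" if v: "\<And>t. v t > 0" for n v
    unfolding G_def c\<^sub>1_def b_def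
    by (rule nn_integral_moving_sum_bound[OF \<alpha> u(1) l0' K(1) v \<epsilon>(1) g_meas g_supp g_bound[OF v]])
  have G_lim: "(\<lambda>n. G n v) \<longlonglongrightarrow> T v" if v: "\<And>t. v t > 0" for v
    unfolding G_def c\<^sub>1_def T_def
    by (rule nn_integral_moving_sum_tendsto[where G = "\<lambda>n. g n v",
          OF \<alpha> l0' K(1) v \<epsilon>(1) u g_meas g_supp g_bound[OF v] b\<^sub>2_fin g_lim[OF v]])
  define h where "h n x = c\<^sub>1 n * (c\<^sub>2 n * H (pair_path (noise_path (fst x) (u n $ 1) (fst (snd x)))
      (noise_path (fst x) (u n $ 2) (snd (snd x)))))" for n x
  have path_meas: "(\<lambda>x. pair_path (noise_path (fst x) (u n $ 1) (fst (snd x)))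
      (noise_path (fst x) (u n $ 2) (snd (snd x)))) \<in> borel_measurable (?B \<Otimes>\<^sub>M (?B \<Otimes>\<^sub>M ?B))" for n
    by (rule borel_measurable_pair_path[OF borel_measurable_noise_path[OF measurable_fst
            measurable_compose[OF measurable_snd measurable_fst]]
          borel_measurable_noise_path[OF measurable_fst measurable_compose[OF measurable_snd measurable_snd]]])
  have h_meas: "h n \<in> borel_measurable (?B \<Otimes>\<^sub>M (?B \<Otimes>\<^sub>M ?B))" for n
    unfolding h_def[abs_def]
    by (intro borel_measurable_times_ennreal borel_measurable_const measurable_compose[OF path_meas H])
  have row_meas: "(\<lambda>e. noise_path v (u n $ i) e) \<in> borel_measurable ?P" for v n i
    by (intro borel_measurable_noise_path borel_measurable_const measurable_ident_sets sets_pareto_seq)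
  have inner: "(\<integral>\<^sup>+e\<^sub>2. h n (v, e\<^sub>1, e\<^sub>2) \<partial>?P) = c\<^sub>1 n * g n v (noise_path v (u n $ 1) e\<^sub>1)" for n v e\<^sub>1
    unfolding h_def g_def fst_conv snd_conv
    using measurable_compose[OF row_meas meas_row]
    by (subst nn_integral_cmult, simp)+ simp
  have middle: "(\<integral>\<^sup>+e\<^sub>1. \<integral>\<^sup>+e\<^sub>2. h n (v, e\<^sub>1, e\<^sub>2) \<partial>?P \<partial>?P) = G n v" for n v
    unfolding inner G_def using measurable_compose[OF row_meas g_meas] by (rule nn_integral_cmult)
  have G_meas: "G n \<in> borel_measurable law_V" for n
  proof -
    have sets: "sets ((law_V \<Otimes>\<^sub>M ?P) \<Otimes>\<^sub>M ?P) = sets ((?B \<Otimes>\<^sub>M ?B) \<Otimes>\<^sub>M ?B)"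
      by (intro sets_pair_measure_cong) simp_all
    have "(\<lambda>y. (fst (fst y), snd (fst y), snd y)) \<in> measurable ((law_V \<Otimes>\<^sub>M ?P) \<Otimes>\<^sub>M ?P) (?B \<Otimes>\<^sub>M (?B \<Otimes>\<^sub>M ?B))"
      unfolding measurable_cong_sets[OF sets refl] by simp
    from measurable_compose[OF this h_meas[of n]]
    have "(\<lambda>y. \<integral>\<^sup>+e\<^sub>2. h n (fst y, snd y, e\<^sub>2) \<partial>?P) \<in> borel_measurable (law_V \<Otimes>\<^sub>M ?P)"
      by (intro P.borel_measurable_nn_integral) (simp add: split_beta')
    then have "(\<lambda>v. \<integral>\<^sup>+e\<^sub>1. \<integral>\<^sup>+e\<^sub>2. h n (v, e\<^sub>1, e\<^sub>2) \<partial>?P \<partial>?P) \<in> borel_measurable law_V"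
      by (intro P.borel_measurable_nn_integral) (simp add: split_beta')
    then show ?thesis by (simp add: middle)
  qed
  have lhs: "c\<^sub>1 n * c\<^sub>2 n * (\<integral>\<^sup>+\<omega>. H (rescale (u n) (\<lambda>t. MA_process l0 V \<eta> t \<omega>)) \<partial>M) = (\<integral>\<^sup>+v. G n v \<partial>law_V)" for n
  proof -
    have "(\<lambda>\<omega>. H (rescale (u n) (\<lambda>t. MA_process l0 V \<eta> t \<omega>))) \<in> borel_measurable M"
      using measurable_compose[OF measurable_V_\<eta> measurable_compose[OF path_meas H]]
      unfolding rescale_MA by simp
    then have "c\<^sub>1 n * c\<^sub>2 n * (\<integral>\<^sup>+\<omega>. H (rescale (u n) (\<lambda>t. MA_process l0 V \<eta> t \<omega>)) \<partial>M) =
        (\<integral>\<^sup>+\<omega>. h n (\<lambda>t. V t \<omega>, (\<lambda>s. \<eta> 1 s \<omega>, \<lambda>s. \<eta> 2 s \<omega>)) \<partial>M)"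
      by (subst nn_integral_cmult[symmetric]) (simp_all add: h_def rescale_MA mult.assoc)
    also have "\<dots> = (\<integral>\<^sup>+v. G n v \<partial>law_V)"
      unfolding nn_integral_V_\<eta>[OF h_meas] middle ..
    finally show ?thesis .
  qed
  \<comment> \<open>Volatility and radii separate here: v enters only through products of two
    powers, whose means are the weights.\<close>
  have T_eq: "T v = (\<Sum>s\<^sub>1\<in>?S\<^sub>1. \<Sum>s\<^sub>2\<in>?S\<^sub>2. ennreal (v s\<^sub>1 powr \<alpha>) * ennreal (v s\<^sub>2 powr \<alpha>) * pair_mass \<alpha> l0 H s\<^sub>1 s\<^sub>2)" for v
  proof -
    have m: "(\<lambda>r\<^sub>1. \<integral>\<^sup>+r\<^sub>2. H (source_pair l0 r\<^sub>1 s\<^sub>1 r\<^sub>2 s\<^sub>2) \<partial>power_tail \<alpha>) \<in> borel_measurable (power_tail \<alpha>)" for s\<^sub>1 s\<^sub>2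
      using measurable_compose[OF borel_measurable_source_pair H]
      by (intro pt.borel_measurable_nn_integral) (simp add: split_beta')
    have "(\<integral>\<^sup>+r. g' v (\<lambda>t. r * phi l0 s\<^sub>1 t) \<partial>power_tail \<alpha>) =
        (\<Sum>s\<^sub>2\<in>?S\<^sub>2. ennreal (v s\<^sub>2 powr \<alpha>) * pair_mass \<alpha> l0 H s\<^sub>1 s\<^sub>2)" for s\<^sub>1
      unfolding g'_def pair_mass_def source_pair_eq[symmetric] using m
      by (subst nn_integral_sum) (auto intro!: sum.cong nn_integral_cmult)
    then show ?thesis by (simp add: T_def sum_distrib_left mult.assoc)
  qed
  have prod_meas: "(\<lambda>v. ennreal (v s powr \<alpha>) * ennreal (v t powr \<alpha>)) \<in> borel_measurable law_V" for s t
    unfolding measurable_cong_sets[OF sets_law_V refl]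
    using borel_measurable_coordinate_powr by (intro borel_measurable_times_ennreal) simp_all
  have rhs: "(\<integral>\<^sup>+v. T v \<partial>law_V) = FV_integral \<alpha> l0 w H"
  proof -
    have "(\<integral>\<^sup>+v. T v \<partial>law_V) = (\<Sum>s\<^sub>1\<in>?S\<^sub>1. \<Sum>s\<^sub>2\<in>?S\<^sub>2. ennreal (w (s\<^sub>2 - s\<^sub>1)) * pair_mass \<alpha> l0 H s\<^sub>1 s\<^sub>2)"
      unfolding T_eq using prod_meas
      by (simp add: nn_integral_sum nn_integral_multc nn_integral_V_product)
    also have "\<dots> = FV_integral \<alpha> l0 w H"
    proof (rule FV_integral_eq_sum[OF \<alpha> H fin, symmetric])
      fix s\<^sub>1 s\<^sub>2 assume "s\<^sub>1 \<notin> ?S\<^sub>1 \<or> s\<^sub>2 \<notin> ?S\<^sub>2"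
      then have "H (source_pair l0 r\<^sub>1 s\<^sub>1 r\<^sub>2 s\<^sub>2) = 0" for r\<^sub>1 r\<^sub>2
        using \<epsilon> by (intro supp) (auto simp: source_pair_eq phi_eq_0)
      then show "pair_mass \<alpha> l0 H s\<^sub>1 s\<^sub>2 = 0" by (simp add: pair_mass_def)
    qed
    finally show ?thesis .
  qed
  define k where "k = C * ennreal ((\<epsilon>\<^sub>2 / l0) powr - \<alpha>) * ennreal ((\<epsilon>\<^sub>1 / l0) powr - \<alpha>)"
  have k: "k < \<infinity>" using C(2) by (simp add: k_def ennreal_mult_less_top)
  have b_eq: "b v = (\<Sum>s\<^sub>1\<in>?S\<^sub>1. \<Sum>s\<^sub>2\<in>?S\<^sub>2. ennreal (v s\<^sub>1 powr \<alpha>) * ennreal (v s\<^sub>2 powr \<alpha>)) * k" for v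
    unfolding b_def b\<^sub>2_def k_def sum_product[symmetric] by (simp only: mult.assoc)
  have sum_meas: "(\<lambda>v. \<Sum>s\<^sub>1\<in>?S\<^sub>1. \<Sum>s\<^sub>2\<in>?S\<^sub>2. ennreal (v s\<^sub>1 powr \<alpha>) * ennreal (v s\<^sub>2 powr \<alpha>)) \<in> borel_measurable law_V"
    by (intro borel_measurable_sum prod_meas)
  \<comment> \<open>Finitely many real weights remain; their finiteness encodes the moment bound of
    order 2 \<alpha>.\<close>
  have w_fin: "(\<Sum>s\<^sub>1\<in>?S\<^sub>1. \<Sum>s\<^sub>2\<in>?S\<^sub>2. ennreal (w (s\<^sub>2 - s\<^sub>1))) < \<top>"
    using fin by (simp add: ennreal_sum_less_top)
  have b_int: "(\<integral>\<^sup>+v. b v \<partial>law_V) < \<infinity>"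
    unfolding b_eq using k w_fin prod_meas
    by (simp del: sum_ennreal add: nn_integral_multc[OF sum_meas] nn_integral_sum nn_integral_V_product ennreal_mult_less_top)
  have b_meas: "b \<in> borel_measurable law_V"
    unfolding b_eq[abs_def] by (intro borel_measurable_times_ennreal sum_meas borel_measurable_const)
  have T_meas: "T \<in> borel_measurable law_V"
    unfolding T_eq[abs_def] by (intro borel_measurable_sum borel_measurable_times_ennreal[OF prod_meas] borel_measurable_const)
  have "(\<lambda>n. \<integral>\<^sup>+v. G n v \<partial>law_V) \<longlonglongrightarrow> (\<integral>\<^sup>+v. T v \<partial>law_V)"
  proof (rule nn_integral_dominated_convergence[OF G_meas T_meas b_meas _ b_int])
    show "AE v in law_V. G n v \<le> b v" for n
      using AE_law_V_pos by eventually_elim (rule G_bound, simp)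
    show "AE v in law_V. (\<lambda>n. G n v) \<longlonglongrightarrow> T v"
      using AE_law_V_pos by eventually_elim (rule G_lim, simp)
  qed
  then show "(\<lambda>n. ennreal ((u n $ 1) powr \<alpha>) * ennreal ((u n $ 2) powr \<alpha>) *
      (\<integral>\<^sup>+\<omega>. H (rescale (u n) (\<lambda>t. MA_process l0 V \<eta> t \<omega>)) \<partial>M)) \<longlonglongrightarrow> FV_integral \<alpha> l0 w H"
    unfolding rhs lhs[symmetric] c\<^sub>1_def c\<^sub>2_def .
  have "(\<integral>\<^sup>+v. T v \<partial>law_V) \<le> (\<integral>\<^sup>+v. b v \<partial>law_V)"
  proof (rule nn_integral_mono_AE, use AE_law_V_pos in eventually_elim)
    case (elim v)
    \<comment> \<open>The uniform bound on \<open>G n v\<close> passes to its limit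
      \<open>T v\<close>, so the integrable bound also controls the limit integral.\<close>
    then show ?case by (intro LIMSEQ_le_const2[OF G_lim] exI[of _ 0]) (auto intro: G_bound)
  qed
  with b_int show "FV_integral \<alpha> l0 w H < \<infinity>" unfolding rhs by simp
qed

end

section \<open>Uniqueness of the limit in regular variation\<close>

lemma tendsto_fun_pointwise:
  assumes "\<And>t. (\<lambda>n. x n t) \<longlonglongrightarrow> y t"
  shows "x \<longlonglongrightarrow> y"
proof -
  have "limitin (product_topology (\<lambda>_. euclidean) UNIV) x y sequentially"
    unfolding limitin_componentwise using assms by auto
  then show ?thesis
    unfolding euclidean_product_topology limitin_canonical_iff .
qed

lemma continuous_path_functional_tendsto:
  assumes "continuous_on UNIV F" "\<And>t. (\<lambda>n. x n t) \<longlonglongrightarrow> y t"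
  shows "(\<lambda>n. F (x n)) \<longlonglongrightarrow> F y"
  by (rule continuous_on_tendsto_compose[OF assms(1) tendsto_fun_pointwise[OF assms(2)]]) simp_all

text \<open>A real integral is the difference of its two nonnegative parts. Integrability under the
  limit measure makes both limits finite, so \<open>enn2real\<close> is continuous there.\<close>

lemma integral_tendsto_of_nn_integral_tendsto:
  fixes F :: "'a \<Rightarrow> real" and c :: "nat \<Rightarrow> real"
  assumes int: "\<And>n. integrable M (\<lambda>\<omega>. F (Y n \<omega>))" "integrable \<nu> F" and c: "\<And>n. c n \<ge> 0"
    and pos: "(\<lambda>n. ennreal (c n) * (\<integral>\<^sup>+\<omega>. ennreal (F (Y n \<omega>)) \<partial>M)) \<longlonglongrightarrow> (\<integral>\<^sup>+f. ennreal (F f) \<partial>\<nu>)"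
    and neg: "(\<lambda>n. ennreal (c n) * (\<integral>\<^sup>+\<omega>. ennreal (- F (Y n \<omega>)) \<partial>M)) \<longlonglongrightarrow> (\<integral>\<^sup>+f. ennreal (- F f) \<partial>\<nu>)"
  shows "(\<lambda>n. c n * (\<integral>\<omega>. F (Y n \<omega>) \<partial>M)) \<longlonglongrightarrow> (\<integral>f. F f \<partial>\<nu>)"
proof -
  have fin: "(\<integral>\<^sup>+f. ennreal (F f) \<partial>\<nu>) < \<top>" "(\<integral>\<^sup>+f. ennreal (- F f) \<partial>\<nu>) < \<top>"
    using int(2) by (auto simp: real_integrable_def less_top)
  have "(\<lambda>n. enn2real (ennreal (c n) * (\<integral>\<^sup>+\<omega>. ennreal (F (Y n \<omega>)) \<partial>M))) \<longlonglongrightarrow> enn2real (\<integral>\<^sup>+f. ennreal (F f) \<partial>\<nu>)"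
    "(\<lambda>n. enn2real (ennreal (c n) * (\<integral>\<^sup>+\<omega>. ennreal (- F (Y n \<omega>)) \<partial>M))) \<longlonglongrightarrow> enn2real (\<integral>\<^sup>+f. ennreal (- F f) \<partial>\<nu>)"
    using pos neg fin by (auto intro!: tendsto_enn2real)
  from tendsto_diff[OF this] show ?thesis
    using c by (simp add: real_lebesgue_integral_def[OF int(1)] real_lebesgue_integral_def[OF int(2)]
        enn2real_mult right_diff_distrib)
qed

lemma product_window_iff:
  assumes "exhaustion K"
  shows "f \<in> product_window K n \<epsilon> \<longleftrightarrow> (\<forall>i. \<exists>t\<in>K (n i). \<bar>f t $ i\<bar> > \<epsilon> i)"
proof -
  have "finite (K m)" "K m \<noteq> {}" for m using assms by (auto simp: exhaustion_def)
  then show ?thesis by (simp add: product_window_def sup_on_greater_iff)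
qed

lemma open_product_window:
  fixes K :: "nat \<Rightarrow> int set" and n :: "'q::finite \<Rightarrow> nat"
  assumes "exhaustion K"
  shows "open (product_window K n \<epsilon>)"
proof -
  have "product_window K n \<epsilon> = (\<Inter>i\<in>UNIV. \<Union>t\<in>K (n i). {f. \<epsilon> i < \<bar>f t $ i\<bar>})"
    by (auto simp: product_window_iff[OF assms])
  moreover have "continuous_on UNIV (\<lambda>f :: int \<Rightarrow> real^'q. \<bar>f t $ i\<bar>)" for t i
    by (intro continuous_intros continuous_on_product_coordinates)
  then have "open {f :: int \<Rightarrow> real^'q. \<epsilon> i < \<bar>f t $ i\<bar>}" for t i
    by (intro open_Collect_less continuous_on_const)
  ultimately show ?thesis by (auto intro!: open_INT open_UN)
qed

lemma sets_product_window:
  "exhaustion K \<Longrightarrow> product_window K (n :: 'q::finite \<Rightarrow> nat) \<epsilon> \<in> sets borel"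
  by (rule borel_open) (rule open_product_window)

lemma filterlim_of_Min:
  fixes u :: "nat \<Rightarrow> real^'q::finite"
  assumes "filterlim (\<lambda>n. Min (range (\<lambda>i. u n $ i))) at_top sequentially"
  shows "filterlim (\<lambda>n. u n $ i) at_top sequentially"
  by (rule filterlim_at_top_mono[OF assms]) (auto intro!: always_eventually)

lemma regularly_varying_powr: "regularly_varying (\<lambda>u. u powr a) a"
  unfolding regularly_varying_def
proof (intro conjI allI impI)
  show "\<forall>\<^sub>F x in at_top. x powr a > 0"
    using eventually_gt_at_top[of 0] by eventually_elim simp
  fix c :: real assume c: "c > 0"
  have "\<forall>\<^sub>F x in at_top. c powr a = (c * x) powr a / x powr a"
    using eventually_gt_at_top[of 0] by eventually_elim (use c in \<open>simp add: powr_mult\<close>)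
  then show "((\<lambda>x. (c * x) powr a / x powr a) \<longlongrightarrow> c powr a) at_top"
    by (rule Lim_transform_eventually[OF tendsto_const])
qed simp

text \<open>Test functions approximate indicators of open subsets of a window. Open sets are stable
  under intersection, so they determine the finite restriction of the limit to that window, and
  growing windows recover the whole measure.\<close>

lemma RV_Pi_unique:
  fixes X :: "int \<Rightarrow> 'w \<Rightarrow> real^'q::finite"
  assumes K: "exhaustion K" and rv: "RV_Pi K M X \<alpha> \<mu> b" "RV_Pi K M X \<alpha> \<nu> b"
  shows "\<mu> = \<nu>"
proof -
  \<comment> \<open>A one-parameter family of windows, with larger time sets and lower levels as m
    grows, that exhausts all paths without a zero row.\<close>
  define W :: "nat \<Rightarrow> (int \<Rightarrow> real^'q) set" where
    "W m = product_window K (\<lambda>_. m) (\<lambda>_. 1 / real (Suc m))" for m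
  have window: "is_product_window K (W m)" for m
    unfolding is_product_window_def W_def by (intro exI[of _ "\<lambda>_. m"] exI[of _ "\<lambda>_. 1 / real (Suc m)"]) simp
  have W_open: "open (W m)" for m unfolding W_def by (rule open_product_window[OF K])
  have W_sets: "W m \<in> sets borel" for m by (rule borel_open[OF W_open])
  have zero: "(\<lambda>_. 0) \<notin> W m" for m by (simp add: W_def product_window_iff[OF K])
  have sets: "sets \<mu> = sets borel" "sets \<nu> = sets borel" using rv by (simp_all add: RV_Pi_def)
  have space: "space \<mu> = UNIV" "space \<nu> = UNIV"
    using sets[THEN sets_eq_imp_space_eq] by simp_all
  have fin: "emeasure \<mu> (W m) < \<infinity>" "emeasure \<nu> (W m) < \<infinity>" for m
    using rv window[of m] by (auto simp: RV_Pi_def)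
  have int_eq: "(\<integral>f. F f \<partial>\<mu>) = (\<integral>f. F f \<partial>\<nu>)"
    if "continuous_on UNIV F" "bounded (range F)" "\<And>f. f \<notin> W m \<Longrightarrow> F f = 0" for F :: "(int \<Rightarrow> real^'q) \<Rightarrow> real" and m
  proof -
    \<comment> \<open>Any admissible threshold sequence identifies the limits; equal thresholds n +
      1 are the simplest.\<close>
    define u :: "nat \<Rightarrow> real^'q" where "u n = vec (real (Suc n))" for n
    have "(\<lambda>n. Min (range (\<lambda>i. u n $ i))) = (\<lambda>n. real (Suc n))"
      by (simp add: u_def del: of_nat_Suc)
    moreover have "filterlim (\<lambda>n. real (Suc n)) at_top sequentially"
      by (rule filterlim_compose[OF filterlim_real_sequentially filterlim_Suc])
    ultimately have u: "(\<forall>n i. u n $ i > 0) \<and> filterlim (\<lambda>n. Min (range (\<lambda>i. u n $ i))) at_top sequentially"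
      by (simp add: u_def)
    have adm: "continuous_on UNIV F \<and> bounded (range F) \<and>
        (\<exists>W. is_product_window K W \<and> (\<forall>f. f \<notin> W \<longrightarrow> F f = 0))"
      using that window by blast
    have "(\<lambda>n. (\<Prod>i\<in>UNIV. b i (u n $ i)) * (\<integral>\<omega>. F (rescale (u n) (\<lambda>t. X t \<omega>)) \<partial>M)) \<longlonglongrightarrow> (\<integral>f. F f \<partial>\<mu>)"
      "(\<lambda>n. (\<Prod>i\<in>UNIV. b i (u n $ i)) * (\<integral>\<omega>. F (rescale (u n) (\<lambda>t. X t \<omega>)) \<partial>M)) \<longlonglongrightarrow> (\<integral>f. F f \<partial>\<nu>)"
      using rv adm u unfolding RV_Pi_def by blast+
    then show ?thesis by (rule LIMSEQ_unique)
  qed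
  have open_eq: "emeasure \<mu> (U \<inter> W m) = emeasure \<nu> (U \<inter> W m)" if U: "open U" for U m
  proof -
    \<comment> \<open>The zero path lies outside every window, so A is nonempty. This matters
      because \<open>infdist\<close> to the empty set is 0 by convention.\<close>
    define A where "A = - (U \<inter> W m)"
    have A: "closed A" "A \<noteq> {}"
      unfolding A_def using U W_open[of m] zero[of m] by (auto simp: closed_def)
    \<comment> \<open>Truncated multiples of the distance to A: they are continuous, bounded by 1,
      vanish outside the window, and tend to the indicator of its open part U.\<close>
    define F where "F k f = min 1 (real k * infdist f A)" for k f
    have cont: "continuous_on UNIV (F k)" for k
      unfolding F_def by (intro continuous_intros)
    have F_meas: "F k \<in> borel_measurable borel" for k
      by (rule borel_measurable_continuous_onI[OF cont])
    have F01: "0 \<le> F k f" "F k f \<le> 1" for k f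
      by (simp_all add: F_def infdist_nonneg)
    have F0: "F k f = 0" if "f \<notin> W m" for k f
      using that by (simp add: F_def A_def)
    have bnd: "bounded (range (F k))" for k
      unfolding bounded_iff using F01 by (intro exI[of _ 1]) auto
    have F_lim: "(\<lambda>k. ennreal (F k f)) \<longlonglongrightarrow> indicator (U \<inter> W m) f" for f
    proof (cases "f \<in> A")
      case True
      then show ?thesis by (simp add: F_def A_def)
    next
      case False
      then have pos: "infdist f A > 0" using A infdist_pos_not_in_closed by blast
      obtain k0 where k0: "real k0 * infdist f A > 1"
        using reals_Archimedean3[OF pos] by blast
      have "F k f = 1" if "k \<ge> k0" for k
      proof -
        have "real k0 * infdist f A \<le> real k * infdist f A"
          using that pos by (intro mult_right_mono) auto
        then show ?thesis using k0 by (simp add: F_def)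
      qed
      then have "\<forall>\<^sub>F k in sequentially. 1 = ennreal (F k f)"
        unfolding eventually_sequentially by (intro exI[of _ k0]) simp
      then have "(\<lambda>k. ennreal (F k f)) \<longlonglongrightarrow> 1"
        by (rule Lim_transform_eventually[OF tendsto_const])
      then show ?thesis using False by (simp add: A_def indicator_def)
    qed
    have lim: "(\<lambda>k. ennreal (\<integral>f. F k f \<partial>N)) \<longlonglongrightarrow> emeasure N (U \<inter> W m)"
      if N: "sets N = sets borel" "emeasure N (W m) < \<infinity>" for N
    proof -
      have meas: "F k \<in> borel_measurable N" for k
        using F_meas measurable_cong_sets[OF N(1) refl] by blast
      have nn: "(\<integral>\<^sup>+f. ennreal (F k f) \<partial>N) = ennreal (\<integral>f. F k f \<partial>N)" for k
      proof (rule nn_integral_eq_integral)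
        have "(\<integral>\<^sup>+f. ennreal (norm (F k f)) \<partial>N) \<le> (\<integral>\<^sup>+f. indicator (W m) f \<partial>N)"
          using F01 F0 by (intro nn_integral_mono) (auto simp: indicator_def)
        also have "\<dots> < \<infinity>" using N W_sets by simp
        finally show "integrable N (F k)" using meas by (simp add: integrable_iff_bounded)
      qed (simp add: F01)
      have Um: "U \<inter> W m \<in> sets N" using U W_open[of m] N(1) by auto
      have "(\<lambda>k. \<integral>\<^sup>+f. ennreal (F k f) \<partial>N) \<longlonglongrightarrow> (\<integral>\<^sup>+f. indicator (U \<inter> W m) f \<partial>N)"
      proof (rule nn_integral_dominated_convergence[where w = "indicator (W m)"])
        show "(\<integral>\<^sup>+f. indicator (W m) f \<partial>N) < \<infinity>" using N W_sets by simp
        show "AE f in N. ennreal (F k f) \<le> indicator (W m) f" for k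
          using F01 F0 by (intro AE_I2) (auto simp: indicator_def)
        show "AE f in N. (\<lambda>k. ennreal (F k f)) \<longlonglongrightarrow> indicator (U \<inter> W m) f"
          using F_lim by (intro AE_I2)
      qed (use meas Um W_sets N(1) in \<open>auto intro: borel_measurable_indicator\<close>)
      then show ?thesis using Um by (simp add: nn)
    qed
    have "(\<integral>f. F k f \<partial>\<mu>) = (\<integral>f. F k f \<partial>\<nu>)" for k
      by (rule int_eq[OF cont bnd F0])
    then show ?thesis
      using lim[OF sets(1) fin(1)] lim[OF sets(2) fin(2)] LIMSEQ_unique by simp
  qed
  have dens: "emeasure (density N (indicator (W m))) A = emeasure N (A \<inter> W m)"
    if "sets N = sets borel" "A \<in> sets borel" for N A m
    using that W_sets[of m] by (subst emeasure_density) (auto simp: indicator_inter_arith[symmetric] mult.commute)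
  have eq: "emeasure \<mu> (A \<inter> W m) = emeasure \<nu> (A \<inter> W m)" if A: "A \<in> sets borel" for A m
  proof -
    \<comment> \<open>Restriction to a window makes both measures finite, as the uniqueness theorem
      for a generating family needs.\<close>
    have "density \<mu> (indicator (W m)) = density \<nu> (indicator (W m))"
    proof (rule measure_eqI_generator_eq[where E = "{U. open U}" and \<Omega> = UNIV and A = "\<lambda>_. UNIV"])
      show "Int_stable {U :: (int \<Rightarrow> real^'q) set. open U}" by (auto intro!: Int_stableI)
      show "sets (density \<mu> (indicator (W m))) = sigma_sets UNIV {U. open U}"
        "sets (density \<nu> (indicator (W m))) = sigma_sets UNIV {U. open U}"
        by (simp_all add: sets sets_borel)
      show "emeasure (density \<mu> (indicator (W m))) U = emeasure (density \<nu> (indicator (W m))) U"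
        if "U \<in> {U. open U}" for U
        using that open_eq[of U m] by (simp add: dens sets)
      show "emeasure (density \<mu> (indicator (W m))) UNIV \<noteq> \<infinity>" for i :: nat
        using fin(1)[of m] by (simp add: dens sets)
    qed auto
    then show ?thesis using A dens[OF sets(1) A] dens[OF sets(2) A] by metis
  qed
  have W_inc: "incseq W"
  proof (rule incseq_SucI, rule subsetI)
    fix m f assume f: "f \<in> W m"
    have "K m \<subseteq> K (Suc m)" using K by (simp add: exhaustion_def incseq_SucD)
    moreover have "1 / real (Suc (Suc m)) < 1 / real (Suc m)" by (simp add: field_simps)
    ultimately show "f \<in> W (Suc m)"
      using f unfolding W_def product_window_iff[OF K] by (meson less_trans subsetD)
  qed
  have W_Un: "(\<Union>m. W m) = {f. \<forall>i. \<exists>t. f t $ i \<noteq> 0}"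
  proof (intro subset_antisym subsetI)
    fix f :: "int \<Rightarrow> real^'q" assume "f \<in> {f. \<forall>i. \<exists>t. f t $ i \<noteq> 0}"
    then obtain t where t: "f (t i) $ i \<noteq> 0" for i by (auto simp: choice_iff)
    obtain m1 where m1: "range t \<subseteq> K m1"
      using K unfolding exhaustion_def by (meson finite_UNIV finite_imageI finite)
    \<comment> \<open>There are finitely many rows, so one positive level lies below a nonzero value
      in each of them.\<close>
    define e where "e = Min (range (\<lambda>i. \<bar>f (t i) $ i\<bar>))"
    have "e > 0" using t by (simp add: e_def)
    then obtain m2 where m2: "1 / real (Suc m2) < e"
      using reals_Archimedean[of e] by (auto simp: inverse_eq_divide)
    have "f \<in> W (max m1 m2)"
      unfolding W_def product_window_iff[OF K]
    proof
      fix i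
      have "K m1 \<subseteq> K (max m1 m2)" using K by (simp add: exhaustion_def incseqD)
      moreover have "1 / real (Suc (max m1 m2)) \<le> 1 / real (Suc m2)" by (simp add: frac_le)
      moreover have "e \<le> \<bar>f (t i) $ i\<bar>" by (simp add: e_def)
      ultimately show "\<exists>s\<in>K (max m1 m2). 1 / real (Suc (max m1 m2)) < \<bar>f s $ i\<bar>"
        using m1 m2 by (intro bexI[of _ "t i"]) auto
    qed
    then show "f \<in> (\<Union>m. W m)" by blast
  next
    fix f :: "int \<Rightarrow> real^'q" assume "f \<in> (\<Union>m. W m)"
    then obtain m where m: "f \<in> W m" by blast
    have "\<exists>t. f t $ i \<noteq> 0" for i
    proof -
      obtain t where "\<bar>f t $ i\<bar> > 1 / real (Suc m)"
        using m unfolding W_def product_window_iff[OF K] by blast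
      then show ?thesis by (intro exI[of _ t]) (auto simp: divide_less_0_iff)
    qed
    then show "f \<in> {f. \<forall>i. \<exists>t. f t $ i \<noteq> 0}" by blast
  qed
  \<comment> \<open>Paths with a zero row form a null set, so continuity from below along the
    windows gives the mass of every Borel set.\<close>
  have carried: "emeasure N A = (SUP m. emeasure N (A \<inter> W m))"
    if N: "sets N = sets borel" "emeasure N {f. \<not> (\<forall>i. \<exists>t. f t $ i \<noteq> 0)} = 0" and A: "A \<in> sets borel" for N A
  proof -
    have Un: "(\<Union>m. A \<inter> W m) = A - {f. \<not> (\<forall>i. \<exists>t. f t $ i \<noteq> 0)}"
      using W_Un by auto
    have sets_null: "{f :: int \<Rightarrow> real^'q. \<not> (\<forall>i. \<exists>t. f t $ i \<noteq> 0)} \<in> sets N"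
    proof -
      have "{f :: int \<Rightarrow> real^'q. \<not> (\<forall>i. \<exists>t. f t $ i \<noteq> 0)} = UNIV - (\<Union>m. W m)"
        unfolding W_Un by auto
      also have "\<dots> \<in> sets N"
        using N(1) W_sets sets.compl_sets[of "\<Union>m. W m" borel] by auto
      finally show ?thesis .
    qed
    have "(SUP m. emeasure N (A \<inter> W m)) = emeasure N (\<Union>m. A \<inter> W m)"
    proof (rule SUP_emeasure_incseq)
      show "range (\<lambda>m. A \<inter> W m) \<subseteq> sets N" using N(1) A W_sets by auto
      show "incseq (\<lambda>m. A \<inter> W m)" using W_inc by (auto simp: incseq_def)
    qed
    also have "\<dots> = emeasure N A"
      unfolding Un using N A sets_null by (intro emeasure_Diff_null_set) (auto simp: null_sets_def)
    finally show ?thesis ..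
  qed
  show ?thesis
  proof (rule measure_eqI)
    fix A assume "A \<in> sets \<mu>"
    then have A: "A \<in> sets borel" by (simp add: sets)
    show "emeasure \<mu> A = emeasure \<nu> A"
      using carried[OF sets(1) _ A] carried[OF sets(2) _ A] rv eq[OF A] by (simp add: RV_Pi_def)
  qed (simp add: sets)
qed

section \<open>Regular variation of the process and of its rows\<close>

text \<open>Pulses only take the values 0 and 1, so exceeding a positive level forces the radius
  above it, and the two radii decouple.\<close>

lemma pair_mass_window_le:
  assumes "\<alpha> > 0" "\<epsilon>\<^sub>1 > 0" "\<epsilon>\<^sub>2 > 0"
    and W: "\<And>f. f \<in> W \<Longrightarrow> (\<exists>t. \<bar>f t $ 1\<bar> > \<epsilon>\<^sub>1) \<and> (\<exists>t. \<bar>f t $ 2\<bar> > \<epsilon>\<^sub>2)"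
  shows "pair_mass \<alpha> l0 (indicator W) s\<^sub>1 s\<^sub>2 \<le> ennreal (\<epsilon>\<^sub>1 powr - \<alpha>) * ennreal (\<epsilon>\<^sub>2 powr - \<alpha>)"
proof -
  have large: "r > \<epsilon>" if "r > 0" "\<bar>r * phi l0 s t\<bar> > \<epsilon>" "\<epsilon> > 0" for r \<epsilon> s t
    using that by (auto simp: phi_eq split: if_splits)
  have "pair_mass \<alpha> l0 (indicator W) s\<^sub>1 s\<^sub>2 \<le>
      (\<integral>\<^sup>+r\<^sub>1. \<integral>\<^sup>+r\<^sub>2. indicator {\<epsilon>\<^sub>1<..} r\<^sub>1 * indicator {\<epsilon>\<^sub>2<..} r\<^sub>2 \<partial>power_tail \<alpha> \<partial>power_tail \<alpha>)"
    unfolding pair_mass_def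
  proof (rule nn_integral_mono_AE, use AE_power_tail_pos[of \<alpha>] in eventually_elim)
    case (elim r\<^sub>1)
    show ?case
    proof (rule nn_integral_mono_AE, use AE_power_tail_pos[of \<alpha>] in eventually_elim)
      case (elim r\<^sub>2)
      show ?case
      proof (cases "source_pair l0 r\<^sub>1 s\<^sub>1 r\<^sub>2 s\<^sub>2 \<in> W")
        case True
        from W[OF this] have "r\<^sub>1 > \<epsilon>\<^sub>1" "r\<^sub>2 > \<epsilon>\<^sub>2"
          using large \<open>0 < r\<^sub>1\<close> \<open>0 < r\<^sub>2\<close> assms by (auto simp: source_pair_eq)
        then show ?thesis by (simp add: indicator_def)
      qed simp
    qed
  qed
  also have "\<dots> = ennreal (\<epsilon>\<^sub>1 powr - \<alpha>) * ennreal (\<epsilon>\<^sub>2 powr - \<alpha>)"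
    using assms by (simp add: nn_integral_cmult nn_integral_multc emeasure_power_tail_greaterThan)
  finally show ?thesis .
qed

text \<open>A pulse that vanishes on the time set of its row cannot exceed a positive level there.
  Both the finite number of contributing pairs and the finite window mass rest on this.\<close>

lemma source_pair_in_window:
  assumes "exhaustion K" "\<forall>i. \<epsilon> i > 0" "source_pair l0 r\<^sub>1 s\<^sub>1 r\<^sub>2 s\<^sub>2 \<in> product_window K n \<epsilon>"
  shows "s\<^sub>1 \<in> sources l0 (K (n 1))" "s\<^sub>2 \<in> sources l0 (K (n 2))"
proof -
  obtain t\<^sub>1 t\<^sub>2 where "t\<^sub>1 \<in> K (n 1)" "\<bar>r\<^sub>1 * phi l0 s\<^sub>1 t\<^sub>1\<bar> > \<epsilon> 1" "t\<^sub>2 \<in> K (n 2)" "\<bar>r\<^sub>2 * phi l0 s\<^sub>2 t\<^sub>2\<bar> > \<epsilon> 2"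
    using assms(3) unfolding product_window_iff[OF assms(1)] by (auto simp: forall_2 source_pair_eq)
  then show "s\<^sub>1 \<in> sources l0 (K (n 1))" "s\<^sub>2 \<in> sources l0 (K (n 2))"
    using assms(2) phi_eq_0 by (metis abs_zero less_asym mult_zero_right)+
qed

lemma finite_contributes:
  assumes "exhaustion K" "is_product_window K W"
  shows "finite {p. contributes l0 W p}"
proof -
  obtain n \<epsilon> where \<epsilon>: "\<forall>i. \<epsilon> i > 0" and W: "W = product_window K n \<epsilon>"
    using assms(2) by (auto simp: is_product_window_def)
  have "{p. contributes l0 W p} \<subseteq> sources l0 (K (n 1)) \<times> sources l0 (K (n 2))"
    unfolding contributes_def W using source_pair_in_window[OF assms(1) \<epsilon>] by auto
  moreover have "finite (sources l0 (K (n 1)) \<times> sources l0 (K (n 2)))"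
    using assms(1) by (simp add: exhaustion_def finite_sources)
  ultimately show ?thesis by (rule finite_subset)
qed

lemma emeasure_nu_FV_window:
  assumes "\<alpha> > 0" "exhaustion K" "is_product_window K W"
  shows "emeasure (nu_FV \<alpha> l0 w) W < \<infinity>"
proof -
  obtain n \<epsilon> where \<epsilon>: "\<forall>i. \<epsilon> i > 0" and W: "W = product_window K n \<epsilon>"
    using assms(3) by (auto simp: is_product_window_def)
  let ?S = "\<lambda>i. sources l0 (K (n i))"
  have fin: "finite (?S i)" for i
    using assms(2) by (simp add: exhaustion_def finite_sources)
  have sets: "W \<in> sets borel" unfolding W by (rule sets_product_window[OF assms(2)])
  have le: "pair_mass \<alpha> l0 (indicator W) s\<^sub>1 s\<^sub>2 < \<top>" for s\<^sub>1 s\<^sub>2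
  proof (rule le_less_trans[OF pair_mass_window_le])
    show "(\<exists>t. \<bar>f t $ 1\<bar> > \<epsilon> 1) \<and> (\<exists>t. \<bar>f t $ 2\<bar> > \<epsilon> 2)" if "f \<in> W" for f
      using that unfolding W product_window_iff[OF assms(2)] by blast
  qed (use assms \<epsilon> in \<open>auto simp: ennreal_mult_less_top\<close>)
  have "FV_integral \<alpha> l0 w (indicator W) =
      (\<Sum>s\<^sub>1\<in>?S 1. \<Sum>s\<^sub>2\<in>?S 2. ennreal (w (s\<^sub>2 - s\<^sub>1)) * pair_mass \<alpha> l0 (indicator W) s\<^sub>1 s\<^sub>2)"
  proof (rule FV_integral_eq_sum[OF assms(1) borel_measurable_indicator[OF sets] fin fin])
    fix s\<^sub>1 s\<^sub>2 assume "s\<^sub>1 \<notin> ?S 1 \<or> s\<^sub>2 \<notin> ?S 2"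
    then have "source_pair l0 r\<^sub>1 s\<^sub>1 r\<^sub>2 s\<^sub>2 \<notin> W" for r\<^sub>1 r\<^sub>2
      using source_pair_in_window[OF assms(2) \<epsilon>] unfolding W by blast
    then show "pair_mass \<alpha> l0 (indicator W) s\<^sub>1 s\<^sub>2 = 0" by (simp add: pair_mass_def)
  qed
  also have "\<dots> < \<infinity>"
    using fin le by (simp add: ennreal_sum_less_top ennreal_mult_less_top)
  finally show ?thesis by (simp add: emeasure_nu_FV[OF assms(1) sets])
qed

text \<open>A zero row is a countable intersection of coordinate conditions. Measurability gives the
  null-set claim its content, since \<open>emeasure\<close> is 0 by convention off the
  sigma-field.\<close>

lemma sets_zero_row:
  "{f :: int \<Rightarrow> real^'q::finite. \<not> (\<forall>i. \<exists>t. f t $ i \<noteq> 0)} \<in> sets borel"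
proof -
  have "{f :: int \<Rightarrow> real^'q. f t $ i = 0} \<in> sets borel" for i t
    using measurable_sets[OF borel_measurable_path_coordinate, of "{0}" t i] by (simp add: vimage_def)
  then have "(\<Union>i\<in>UNIV. \<Inter>t\<in>UNIV. {f :: int \<Rightarrow> real^'q. f t $ i = 0}) \<in> sets borel"
    by (intro sets.finite_UN sets.countable_INT') auto
  moreover have "{f :: int \<Rightarrow> real^'q. \<not> (\<forall>i. \<exists>t. f t $ i \<noteq> 0)} = (\<Union>i\<in>UNIV. \<Inter>t\<in>UNIV. {f. f t $ i = 0})"
    by auto
  ultimately show ?thesis by simp
qed

text \<open>Every pulse equals 1 at its own source time, so positive radii leave neither row
  zero.\<close>

lemma emeasure_nu_FV_zero_row:
  assumes "\<alpha> > 0" "l0 > 0"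
  shows "emeasure (nu_FV \<alpha> l0 w) {f. \<not> (\<forall>i. \<exists>t. f t $ i \<noteq> 0)} = 0"
proof -
  let ?A = "{f :: int \<Rightarrow> real^2. \<not> (\<forall>i. \<exists>t. f t $ i \<noteq> 0)}"
  have "pair_mass \<alpha> l0 (indicator ?A) s\<^sub>1 s\<^sub>2 = (\<integral>\<^sup>+r. 0 \<partial>power_tail \<alpha>) * (\<integral>\<^sup>+r. 0 \<partial>power_tail \<alpha>)" for s\<^sub>1 s\<^sub>2
  proof (rule pair_mass_cong)
    fix r\<^sub>1 r\<^sub>2 :: real assume r: "r\<^sub>1 > 0" "r\<^sub>2 > 0"
    have "phi l0 s s = 1" for s using assms(2) by (simp add: phi_eq)
    then have "source_pair l0 r\<^sub>1 s\<^sub>1 r\<^sub>2 s\<^sub>2 s\<^sub>1 $ 1 \<noteq> 0" "source_pair l0 r\<^sub>1 s\<^sub>1 r\<^sub>2 s\<^sub>2 s\<^sub>2 $ 2 \<noteq> 0"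
      using r by (simp_all add: source_pair_eq)
    then have "source_pair l0 r\<^sub>1 s\<^sub>1 r\<^sub>2 s\<^sub>2 \<notin> ?A" by (auto simp: forall_2)
    then show "indicator ?A (source_pair l0 r\<^sub>1 s\<^sub>1 r\<^sub>2 s\<^sub>2) = 0 * (0 :: ennreal)" by simp
  qed simp_all
  then have mass: "pair_mass \<alpha> l0 (indicator ?A) s\<^sub>1 s\<^sub>2 = 0" for s\<^sub>1 s\<^sub>2 by simp
  have "FV_integral \<alpha> l0 w (indicator ?A) = 0"
    unfolding FV_integral_eq[OF assms(1) borel_measurable_indicator[OF sets_zero_row]] mass by simp
  then show ?thesis unfolding emeasure_nu_FV[OF assms(1) sets_zero_row] .
qed

section \<open>Single rows and the scalar path-tail measure\<close>

definition line_path :: "(int \<Rightarrow> real) \<Rightarrow> int \<Rightarrow> real^1" where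
  "line_path f = (\<lambda>t. vec (f t))"

lemma line_path_nth [simp]: "line_path f t $ i = f t"
  by (simp add: line_path_def)

lemma single_source_eq: "single_source l0 r s = line_path (\<lambda>t. r * phi l0 s t)"
  by (simp add: single_source_def line_path_def)

lemma borel_measurable_line_path: "line_path \<in> borel_measurable borel"
  by (rule measurable_into_path, rule borel_measurable_vec)
    (simp add: borel_measurable_coordinate)

lemma tendsto_line_path:
  assumes "(\<lambda>n. f n t) \<longlonglongrightarrow> f' t"
  shows "(\<lambda>n. line_path (f n) t) \<longlonglongrightarrow> line_path f' t"
  by (rule vec_tendstoI) (simp add: assms)

lemma sc_integral_eq_sum:
  assumes "finite S" "\<And>s r. s \<notin> S \<Longrightarrow> F (single_source l0 r s) = 0"
  shows "sc_integral \<alpha> l0 F = (\<Sum>s\<in>S. \<integral>\<^sup>+r. F (single_source l0 r s) \<partial>power_tail \<alpha>)"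
  unfolding sc_integral_def infsum_int_eq_nn_integral
  using assms by (intro nn_integral_count_space') auto

lemma single_source_in_window:
  assumes "exhaustion K" "\<forall>i. \<epsilon> i > 0" "single_source l0 r s \<in> product_window K n \<epsilon>"
  shows "s \<in> sources l0 (K (n 1))"
proof -
  obtain t where "t \<in> K (n 1)" "\<bar>r * phi l0 s t\<bar> > \<epsilon> 1"
    using assms(3) unfolding product_window_iff[OF assms(1)] by (auto simp: single_source_eq)
  then show ?thesis
    using assms(2) phi_eq_0 by (metis abs_zero less_asym mult_zero_right)
qed

lemma emeasure_nu_sc_window:
  assumes "\<alpha> > 0" "exhaustion K" "is_product_window K W"
  shows "emeasure (nu_sc \<alpha> l0) W < \<infinity>"
proof -
  obtain n \<epsilon> where \<epsilon>: "\<forall>i. \<epsilon> i > 0" and W: "W = product_window K n \<epsilon>"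
    using assms(3) by (auto simp: is_product_window_def)
  let ?S = "sources l0 (K (n 1))"
  have fin: "finite ?S"
    using assms(2) by (simp add: exhaustion_def finite_sources)
  have sets: "W \<in> sets borel" unfolding W by (rule sets_product_window[OF assms(2)])
  have le: "(\<integral>\<^sup>+r. indicator W (single_source l0 r s) \<partial>power_tail \<alpha>) < \<top>" for s
  proof -
    have "(\<integral>\<^sup>+r. indicator W (single_source l0 r s) \<partial>power_tail \<alpha>) \<le> (\<integral>\<^sup>+r. indicator {\<epsilon> 1<..} r \<partial>power_tail \<alpha>)"
    proof (rule nn_integral_mono_AE, use AE_power_tail_pos[of \<alpha>] in eventually_elim)
      case (elim r)
      show ?case
      proof (cases "single_source l0 r s \<in> W")
        case True
        then obtain t where "\<bar>r * phi l0 s t\<bar> > \<epsilon> 1"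
          unfolding W product_window_iff[OF assms(2)] by (auto simp: single_source_eq)
        then have "r > \<epsilon> 1" using elim \<epsilon>[rule_format, of 1] by (auto simp: phi_eq split: if_splits)
        then show ?thesis by (simp add: indicator_def)
      qed simp
    qed
    also have "\<dots> < \<top>" using assms \<epsilon> by (simp add: emeasure_power_tail_greaterThan)
    finally show ?thesis .
  qed
  have "sc_integral \<alpha> l0 (indicator W) = (\<Sum>s\<in>?S. \<integral>\<^sup>+r. indicator W (single_source l0 r s) \<partial>power_tail \<alpha>)"
  proof (rule sc_integral_eq_sum[OF fin])
    fix s r assume "s \<notin> ?S"
    then have "single_source l0 r s \<notin> W"
      using single_source_in_window[OF assms(2) \<epsilon>] unfolding W by blast
    then show "indicator W (single_source l0 r s) = (0 :: ennreal)" by simp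
  qed
  also have "\<dots> < \<infinity>" using fin le by (simp add: ennreal_sum_less_top)
  finally show ?thesis by (simp add: emeasure_nu_sc[OF assms(1) sets])
qed

lemma sc_integral_indicator_eq_0:
  assumes "\<And>r s. r > 0 \<Longrightarrow> single_source l0 r s \<notin> A"
  shows "sc_integral \<alpha> l0 (indicator A) = 0"
proof -
  have "(\<integral>\<^sup>+r. indicator A (single_source l0 r s) \<partial>power_tail \<alpha>) = (\<integral>\<^sup>+r. 0 \<partial>power_tail \<alpha>)" for s
    using AE_power_tail_pos[of \<alpha>] assms by (intro nn_integral_cong_AE) (auto elim: eventually_mono)
  then show ?thesis by (simp add: sc_integral_def)
qed

lemma emeasure_nu_sc_zero_row:
  assumes "\<alpha> > 0" "l0 > 0"
  shows "emeasure (nu_sc \<alpha> l0) {f. \<not> (\<forall>i. \<exists>t. f t $ i \<noteq> 0)} = 0"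
  unfolding emeasure_nu_sc[OF assms(1) sets_zero_row]
proof (rule sc_integral_indicator_eq_0)
  fix r :: real and s assume "r > 0"
  then have "single_source l0 r s s $ i \<noteq> 0" for i
    using assms(2) by (simp add: single_source_eq phi_eq)
  then show "single_source l0 r s \<notin> {f. \<not> (\<forall>i. \<exists>t. f t $ i \<noteq> 0)}" by blast
qed

lemma emeasure_nu_sc_space:
  assumes "\<alpha> > 0"
  shows "emeasure (nu_sc \<alpha> l0) (space (nu_sc \<alpha> l0)) \<noteq> 0"
proof -
  have "\<infinity> = (\<integral>\<^sup>+r. indicator UNIV (single_source l0 r 0) \<partial>power_tail \<alpha>)"
    using assms by (simp add: emeasure_power_tail_UNIV)
  also have "\<dots> \<le> sc_integral \<alpha> l0 (indicator UNIV)"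
    unfolding sc_integral_def infsum_int_eq_nn_integral by (rule nn_integral_ge_point) simp
  also have "\<dots> = emeasure (nu_sc \<alpha> l0) UNIV"
    using emeasure_nu_sc[OF assms, of UNIV l0] by simp
  finally show ?thesis by (auto simp: top_unique)
qed

section \<open>Regular variation of the pair and of its rows\<close>

context moving_average begin

lemma rescale_row:
  "rescale u (\<lambda>t. path_row i (\<lambda>t. MA_process l0 V \<eta> t \<omega>) t) =
    line_path (noise_path (\<lambda>t. V t \<omega>) (u $ 1) (\<lambda>s. \<eta> i s \<omega>))"
  by (rule ext)
    (simp add: vec_eq_iff rescale_def path_row_def MA_process_def moving_sum_def scaled_noise_def sum_divide_distrib)

text \<open>The noise of the other row integrates to total mass 1.\<close>

lemma nn_integral_V_\<eta>_row:
  assumes f: "(\<lambda>x. f (fst x) (snd x)) \<in> borel_measurable (borel \<Otimes>\<^sub>M borel)"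
  shows "(\<integral>\<^sup>+\<omega>. f (\<lambda>t. V t \<omega>) (\<lambda>s. \<eta> i s \<omega>) \<partial>M) = (\<integral>\<^sup>+v. \<integral>\<^sup>+e. f v e \<partial>pareto_seq \<alpha> \<partial>law_V)"
proof -
  define p :: "(int \<Rightarrow> real) \<times> (int \<Rightarrow> real) \<Rightarrow> int \<Rightarrow> real" where "p = (if i = 1 then fst else snd)"
  have p: "p \<in> measurable (borel \<Otimes>\<^sub>M borel) borel" by (simp add: p_def)
  have eq: "(\<lambda>s. \<eta> i s \<omega>) = p (\<lambda>s. \<eta> 1 s \<omega>, \<lambda>s. \<eta> 2 s \<omega>)" for \<omega>
    using exhaust_2[of i] by (auto simp: p_def)
  have "(\<lambda>x. (fst x, p (snd x))) \<in> measurable (borel \<Otimes>\<^sub>M (borel \<Otimes>\<^sub>M borel)) (borel \<Otimes>\<^sub>M borel)"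
    by (rule measurable_Pair[OF measurable_fst measurable_compose[OF measurable_snd p]])
  from measurable_compose[OF this f] have h: "(\<lambda>x. f (fst x) (p (snd x))) \<in> borel_measurable (borel \<Otimes>\<^sub>M (borel \<Otimes>\<^sub>M borel))"
    by simp
  show ?thesis
    unfolding eq using nn_integral_V_\<eta>[OF h] emeasure_pareto_seq_UNIV[OF \<alpha>]
    by (cases "i = 1") (simp_all add: p_def)
qed

text \<open>For one row both the limit and the bound are linear in the v(s)^\<alpha>, which all have
  mean 1. Integrating out the volatility therefore leaves no trace of its temporal law, unlike the
  products in \<open>pair_limit\<close>.\<close>

lemma single_limit:
  assumes K: "finite K" and \<epsilon>: "\<epsilon> > 0"
    and H: "H \<in> borel_measurable borel"
    and C: "\<And>f. H f \<le> C" "C < \<infinity>"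
    and supp: "\<And>f. (\<forall>t\<in>K. \<bar>f t $ 1\<bar> \<le> \<epsilon>) \<Longrightarrow> H f = 0"
    and cont: "\<And>x y. (\<And>t. (\<lambda>n. x n t) \<longlonglongrightarrow> y t) \<Longrightarrow> (\<lambda>n. H (x n)) \<longlonglongrightarrow> H y"
    and u: "\<And>n. u n > 0" "filterlim u at_top sequentially"
  shows "(\<lambda>n. ennreal (u n powr \<alpha>) *
      (\<integral>\<^sup>+\<omega>. H (line_path (noise_path (\<lambda>t. V t \<omega>) (u n) (\<lambda>s. \<eta> i s \<omega>))) \<partial>M)) \<longlonglongrightarrow> sc_integral \<alpha> l0 H"
    and "sc_integral \<alpha> l0 H < \<infinity>"
proof -
  let ?B = "borel :: (int \<Rightarrow> real) measure" and ?P = "pareto_seq \<alpha>" and ?S = "sources l0 K"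
  interpret P: prob_space ?P using \<alpha> by (rule prob_space_pareto_seq)
  have fin: "finite ?S" using K by (simp add: finite_sources)
  have l0': "l0 > 0" using l0 by simp
  have H_line: "(\<lambda>h. H (line_path h)) \<in> borel_measurable borel"
    by (rule measurable_compose[OF borel_measurable_line_path H])
  define G where "G n v = ennreal (u n powr \<alpha>) * (\<integral>\<^sup>+e. H (line_path (noise_path v (u n) e)) \<partial>?P)" for n v
  define T where "T v = (\<Sum>s\<in>?S. ennreal (v s powr \<alpha>) * (\<integral>\<^sup>+r. H (single_source l0 r s) \<partial>power_tail \<alpha>))" for v
  define k where "k = C * ennreal ((\<epsilon> / l0) powr - \<alpha>)"
  define b where "b v = (\<Sum>s\<in>?S. ennreal (v s powr \<alpha>)) * k" for v :: "int \<Rightarrow> real"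
  have supp': "H (line_path x) = 0" if "\<And>t. t \<in> K \<Longrightarrow> \<bar>x t\<bar> \<le> \<epsilon>" for x
    using that by (simp add: supp)
  have G_bound: "G n v \<le> b v" if v: "\<And>t. v t > 0" for n v
    unfolding G_def b_def k_def
    by (rule nn_integral_moving_sum_bound[OF \<alpha> u(1) l0' K v \<epsilon> H_line supp' C(1)])
  have G_lim: "(\<lambda>n. G n v) \<longlonglongrightarrow> T v" if v: "\<And>t. v t > 0" for v
    unfolding G_def T_def single_source_eq
  proof (rule nn_integral_moving_sum_tendsto[where G = "\<lambda>_ h. H (line_path h)" and H = "\<lambda>h. H (line_path h)",
        OF \<alpha> l0' K v \<epsilon> u H_line _ C])
    show "H (line_path x) = 0" if "\<And>t. t \<in> K \<Longrightarrow> \<bar>x t\<bar> \<le> \<epsilon>" for x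
      using that by (rule supp')
    show "(\<lambda>n. H (line_path (x n))) \<longlonglongrightarrow> H (line_path y)" if "\<And>t. (\<lambda>n. x n t) \<longlonglongrightarrow> y t" for x y
      by (rule cont) (rule tendsto_line_path[OF that])
  qed
  have joint: "(\<lambda>x. H (line_path (noise_path (fst x) (u n) (snd x)))) \<in> borel_measurable (?B \<Otimes>\<^sub>M ?B)" for n
    by (rule measurable_compose[OF borel_measurable_noise_path[OF measurable_fst measurable_snd] H_line])
  have G_meas: "G n \<in> borel_measurable law_V" for n
  proof -
    have "(\<lambda>x. H (line_path (noise_path (fst x) (u n) (snd x)))) \<in> borel_measurable (law_V \<Otimes>\<^sub>M ?P)"
      using joint[of n] measurable_cong_sets[OF sets_pair_measure_cong[OF sets_law_V sets_pareto_seq] refl]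
      by blast
    then show ?thesis
      unfolding G_def[abs_def]
      by (intro borel_measurable_times_ennreal borel_measurable_const P.borel_measurable_nn_integral)
        (simp add: split_beta')
  qed
  have lhs: "ennreal (u n powr \<alpha>) *
      (\<integral>\<^sup>+\<omega>. H (line_path (noise_path (\<lambda>t. V t \<omega>) (u n) (\<lambda>s. \<eta> i s \<omega>))) \<partial>M) = (\<integral>\<^sup>+v. G n v \<partial>law_V)" for n
  proof -
    have f: "(\<lambda>x. ennreal (u n powr \<alpha>) * H (line_path (noise_path (fst x) (u n) (snd x)))) \<in> borel_measurable (?B \<Otimes>\<^sub>M ?B)"
      by (intro borel_measurable_times_ennreal borel_measurable_const joint)
    have "(\<lambda>\<omega>. H (line_path (noise_path (\<lambda>t. V t \<omega>) (u n) (\<lambda>s. \<eta> i s \<omega>)))) \<in> borel_measurable M"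
      by (rule measurable_compose[OF borel_measurable_noise_path[OF measurable_V measurable_\<eta>_row] H_line])
    then have "ennreal (u n powr \<alpha>) *
        (\<integral>\<^sup>+\<omega>. H (line_path (noise_path (\<lambda>t. V t \<omega>) (u n) (\<lambda>s. \<eta> i s \<omega>))) \<partial>M) =
        (\<integral>\<^sup>+v. \<integral>\<^sup>+e. ennreal (u n powr \<alpha>) * H (line_path (noise_path v (u n) e)) \<partial>?P \<partial>law_V)"
      by (subst nn_integral_cmult[symmetric]) (auto intro: nn_integral_V_\<eta>_row[OF f])
    also have "\<dots> = (\<integral>\<^sup>+v. G n v \<partial>law_V)"
      unfolding G_def
    proof (rule nn_integral_cong, rule nn_integral_cmult)
      fix v
      show "(\<lambda>e. H (line_path (noise_path v (u n) e))) \<in> borel_measurable ?P"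
        by (rule measurable_compose[OF borel_measurable_noise_path[OF borel_measurable_const
              measurable_ident_sets[OF sets_pareto_seq]] H_line])
    qed
    finally show ?thesis .
  qed
  have powr_meas: "(\<lambda>v. ennreal (v s powr \<alpha>)) \<in> borel_measurable law_V" for s
    unfolding measurable_cong_sets[OF sets_law_V refl] using borel_measurable_coordinate_powr by simp
  have rhs: "(\<integral>\<^sup>+v. T v \<partial>law_V) = sc_integral \<alpha> l0 H"
  proof -
    have "(\<integral>\<^sup>+v. T v \<partial>law_V) = (\<Sum>s\<in>?S. \<integral>\<^sup>+r. H (single_source l0 r s) \<partial>power_tail \<alpha>)"
      unfolding T_def using powr_meas
      by (simp add: nn_integral_sum nn_integral_multc nn_integral_V_powr)
    also have "\<dots> = sc_integral \<alpha> l0 H"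
      using \<epsilon> by (intro sc_integral_eq_sum[OF fin, symmetric] supp) (simp add: single_source_eq phi_eq_0)
    finally show ?thesis .
  qed
  have sum_meas: "(\<lambda>v. \<Sum>s\<in>?S. ennreal (v s powr \<alpha>)) \<in> borel_measurable law_V"
    by (intro borel_measurable_sum powr_meas)
  have b_meas: "b \<in> borel_measurable law_V"
    unfolding b_def[abs_def] by (intro borel_measurable_times_ennreal sum_meas borel_measurable_const)
  have T_meas: "T \<in> borel_measurable law_V"
    unfolding T_def[abs_def]
    by (intro borel_measurable_sum borel_measurable_times_ennreal powr_meas borel_measurable_const)
  have k: "k < \<infinity>" using C(2) by (simp add: k_def ennreal_mult_less_top)
  have b_int: "(\<integral>\<^sup>+v. b v \<partial>law_V) < \<infinity>"
    unfolding b_def nn_integral_multc[OF sum_meas] nn_integral_sum[OF powr_meas] nn_integral_V_powr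
    using k by (simp add: ennreal_mult_less_top of_nat_less_top)
  have "(\<lambda>n. \<integral>\<^sup>+v. G n v \<partial>law_V) \<longlonglongrightarrow> (\<integral>\<^sup>+v. T v \<partial>law_V)"
  proof (rule nn_integral_dominated_convergence[OF G_meas T_meas b_meas _ b_int])
    show "AE v in law_V. G n v \<le> b v" for n
      using AE_law_V_pos by eventually_elim (rule G_bound, simp)
    show "AE v in law_V. (\<lambda>n. G n v) \<longlonglongrightarrow> T v"
      using AE_law_V_pos by eventually_elim (rule G_lim, simp)
  qed
  then show "(\<lambda>n. ennreal (u n powr \<alpha>) *
      (\<integral>\<^sup>+\<omega>. H (line_path (noise_path (\<lambda>t. V t \<omega>) (u n) (\<lambda>s. \<eta> i s \<omega>))) \<partial>M)) \<longlonglongrightarrow> sc_integral \<alpha> l0 H"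
    unfolding rhs lhs .
  have "(\<integral>\<^sup>+v. T v \<partial>law_V) \<le> (\<integral>\<^sup>+v. b v \<partial>law_V)"
  proof (rule nn_integral_mono_AE, use AE_law_V_pos in eventually_elim)
    case (elim v)
    then show ?case by (intro LIMSEQ_le_const2[OF G_lim] exI[of _ 0]) (auto intro: G_bound)
  qed
  with b_int show "sc_integral \<alpha> l0 H < \<infinity>" unfolding rhs by simp
qed

lemma RV_Pi_MA:
  assumes K: "exhaustion K"
  shows "RV_Pi K M (MA_process l0 V \<eta>) (\<lambda>_. \<alpha>) (nu_FV \<alpha> l0 w) (\<lambda>_ u. u powr \<alpha>)"
  unfolding RV_Pi_def
proof (intro conjI allI impI)
  have l0': "l0 > 0" using l0 by simp
  show "(\<lambda>\<omega> t. MA_process l0 V \<eta> t \<omega>) \<in> borel_measurable M" by (rule measurable_MA)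
  show "regularly_varying (\<lambda>u. u powr \<alpha>) \<alpha>" by (rule regularly_varying_powr)
  \<comment> \<open>Nontriviality comes for free from the infinite mass of a row exceedance.\<close>
  have "\<infinity> = emeasure (nu_FV \<alpha> l0 w) {f. sup_on {0} 1 f > 1}"
    using emeasure_nu_FV_row_exceedance[of \<alpha> l0 w "{0}" 1 1] \<alpha> l0' w_0_pos by simp
  also have "\<dots> \<le> emeasure (nu_FV \<alpha> l0 w) (space (nu_FV \<alpha> l0 w))"
    by (rule emeasure_space)
  finally show "emeasure (nu_FV \<alpha> l0 w) (space (nu_FV \<alpha> l0 w)) \<noteq> 0" by (auto simp: top_unique)
  show "emeasure (nu_FV \<alpha> l0 w) {f. \<not> (\<forall>i. \<exists>t. f t $ i \<noteq> 0)} = 0"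
    by (rule emeasure_nu_FV_zero_row[OF \<alpha> l0'])
  show "emeasure (nu_FV \<alpha> l0 w) W < \<infinity>" if "is_product_window K W" for W
    by (rule emeasure_nu_FV_window[OF \<alpha> K that])
next
  fix F :: "(int \<Rightarrow> real^2) \<Rightarrow> real" and u :: "nat \<Rightarrow> real^2"
  assume F: "continuous_on UNIV F \<and> bounded (range F) \<and> (\<exists>W. is_product_window K W \<and> (\<forall>f. f \<notin> W \<longrightarrow> F f = 0))"
    and "(\<forall>n i. u n $ i > 0) \<and> filterlim (\<lambda>n. Min (range (\<lambda>i. u n $ i))) at_top sequentially"
  then have u: "\<And>n i. u n $ i > 0" "\<And>i. filterlim (\<lambda>n. u n $ i) at_top sequentially"
    using filterlim_of_Min[of u] by auto
  obtain n \<epsilon> where \<epsilon>: "\<forall>i. \<epsilon> i > 0" and F0: "\<And>f. f \<notin> product_window K n \<epsilon> \<Longrightarrow> F f = 0"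
    using F by (auto simp: is_product_window_def)
  obtain B where B: "\<And>f. \<bar>F f\<bar> \<le> B" using F by (auto simp: bounded_iff)
  have cont: "continuous_on UNIV F" using F by simp
  have F_meas: "F \<in> borel_measurable borel" by (rule borel_measurable_continuous_onI[OF cont])
  have finK: "finite (K m)" for m using K by (simp add: exhaustion_def)
  \<comment> \<open>Used with \<phi> the identity, negation and absolute value:
    \<open>ennreal\<close> truncates the first two to the positive and negative part, the third
    gives integrability. The value 0 at 0 keeps F supported in the window, and \<phi> x \<le> |x|
    keeps the bound B.\<close>
  have lim: "(\<lambda>n. ennreal ((u n $ 1) powr \<alpha>) * ennreal ((u n $ 2) powr \<alpha>) *
      (\<integral>\<^sup>+\<omega>. ennreal (\<phi> (F (rescale (u n) (\<lambda>t. MA_process l0 V \<eta> t \<omega>)))) \<partial>M)) \<longlonglongrightarrow>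
      (\<integral>\<^sup>+f. ennreal (\<phi> (F f)) \<partial>nu_FV \<alpha> l0 w)"
    "(\<integral>\<^sup>+f. ennreal (\<phi> (F f)) \<partial>nu_FV \<alpha> l0 w) < \<infinity>"
    if \<phi>: "continuous_on UNIV \<phi>" "\<phi> 0 = 0" "\<And>x. \<phi> x \<le> \<bar>x\<bar>" for \<phi> :: "real \<Rightarrow> real"
  proof -
    have contH: "continuous_on UNIV (\<lambda>f. \<phi> (F f))"
      using continuous_on_compose2[OF \<phi>(1) cont] by simp
    have H: "(\<lambda>f. ennreal (\<phi> (F f))) \<in> borel_measurable borel"
      using borel_measurable_continuous_onI[OF contH] by simp
    have le: "ennreal (\<phi> (F f)) \<le> ennreal B" for f
      using order_trans[OF \<phi>(3) B] by (rule ennreal_leI)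
    have supp: "ennreal (\<phi> (F f)) = 0"
      if "(\<forall>t\<in>K (n 1). \<bar>f t $ 1\<bar> \<le> \<epsilon> 1) \<or> (\<forall>t\<in>K (n 2). \<bar>f t $ 2\<bar> \<le> \<epsilon> 2)" for f
    proof -
      have "f \<notin> product_window K n \<epsilon>"
        using that unfolding product_window_iff[OF K] by (meson not_le)
      then show ?thesis using F0 \<phi>(2) by simp
    qed
    note * = pair_limit[OF finK finK, of "\<epsilon> 1" "\<epsilon> 2", OF _ _ H le _ supp
        tendsto_ennrealI[OF continuous_path_functional_tendsto[OF contH]] u]
    show "(\<lambda>n. ennreal ((u n $ 1) powr \<alpha>) * ennreal ((u n $ 2) powr \<alpha>) *
      (\<integral>\<^sup>+\<omega>. ennreal (\<phi> (F (rescale (u n) (\<lambda>t. MA_process l0 V \<eta> t \<omega>)))) \<partial>M)) \<longlonglongrightarrow>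
      (\<integral>\<^sup>+f. ennreal (\<phi> (F f)) \<partial>nu_FV \<alpha> l0 w)"
      "(\<integral>\<^sup>+f. ennreal (\<phi> (F f)) \<partial>nu_FV \<alpha> l0 w) < \<infinity>"
      unfolding nn_integral_nu_FV[OF \<alpha> H] using * \<epsilon> by simp_all
  qed
  have "F \<in> borel_measurable (nu_FV \<alpha> l0 w)"
    using F_meas unfolding measurable_cong_sets[OF sets_nu_FV refl] .
  then have int\<nu>: "integrable (nu_FV \<alpha> l0 w) F"
    using lim(2)[of abs] by (auto simp: integrable_iff_bounded continuous_on_rabs)
  have meas: "(\<lambda>\<omega>. F (rescale (u n) (\<lambda>t. MA_process l0 V \<eta> t \<omega>))) \<in> borel_measurable M" for n
    unfolding rescale_MA
    by (rule measurable_compose[OF borel_measurable_pair_path[OF borel_measurable_noise_path[OF measurable_V measurable_\<eta>_row]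
          borel_measurable_noise_path[OF measurable_V measurable_\<eta>_row]] F_meas])
  have "(\<lambda>n. ((u n $ 1) powr \<alpha> * (u n $ 2) powr \<alpha>) *
      (\<integral>\<omega>. F (rescale (u n) (\<lambda>t. MA_process l0 V \<eta> t \<omega>)) \<partial>M)) \<longlonglongrightarrow> (\<integral>f. F f \<partial>nu_FV \<alpha> l0 w)"
  proof (rule integral_tendsto_of_nn_integral_tendsto[OF _ int\<nu>])
    show "integrable M (\<lambda>\<omega>. F (rescale (u n) (\<lambda>t. MA_process l0 V \<eta> t \<omega>)))" for n
      by (rule integrable_const_bound[where B = B]) (use B meas in auto)
    show "(\<lambda>n. ennreal ((u n $ 1) powr \<alpha> * (u n $ 2) powr \<alpha>) *
      (\<integral>\<^sup>+\<omega>. ennreal (F (rescale (u n) (\<lambda>t. MA_process l0 V \<eta> t \<omega>))) \<partial>M)) \<longlonglongrightarrow>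
      (\<integral>\<^sup>+f. ennreal (F f) \<partial>nu_FV \<alpha> l0 w)"
      using lim(1)[of "\<lambda>x. x"] by (simp add: ennreal_mult')
    show "(\<lambda>n. ennreal ((u n $ 1) powr \<alpha> * (u n $ 2) powr \<alpha>) *
      (\<integral>\<^sup>+\<omega>. ennreal (- F (rescale (u n) (\<lambda>t. MA_process l0 V \<eta> t \<omega>))) \<partial>M)) \<longlonglongrightarrow>
      (\<integral>\<^sup>+f. ennreal (- F f) \<partial>nu_FV \<alpha> l0 w)"
      using lim(1)[of uminus] by (simp add: ennreal_mult' continuous_on_minus abs_ge_minus_self)
  qed simp
  then show "(\<lambda>n. (\<Prod>i\<in>UNIV. (u n $ i) powr \<alpha>) * (\<integral>\<omega>. F (rescale (u n) (\<lambda>t. MA_process l0 V \<eta> t \<omega>)) \<partial>M))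
      \<longlonglongrightarrow> (\<integral>f. F f \<partial>nu_FV \<alpha> l0 w)"
    by (simp add: UNIV_2)
qed simp

lemma RV_Pi_MA_row:
  assumes K: "exhaustion K"
  shows "RV_Pi K M (\<lambda>t \<omega>. path_row i (\<lambda>t. MA_process l0 V \<eta> t \<omega>) t) (\<lambda>_. \<alpha>) (nu_sc \<alpha> l0) (\<lambda>_ u. u powr \<alpha>)"
  unfolding RV_Pi_def
proof (intro conjI allI impI)
  have l0': "l0 > 0" using l0 by simp
  \<comment> \<open>At scale 1 the rescaled noise path is the row itself, so its measurability
    follows from that of noise paths.\<close>
  have "(\<lambda>t. path_row i (\<lambda>t. MA_process l0 V \<eta> t \<omega>) t) =
      line_path (noise_path (\<lambda>t. V t \<omega>) 1 (\<lambda>s. \<eta> i s \<omega>))" for \<omega>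
    by (rule ext) (simp add: vec_eq_iff path_row_def MA_process_def moving_sum_def scaled_noise_def)
  then show "(\<lambda>\<omega> t. path_row i (\<lambda>t. MA_process l0 V \<eta> t \<omega>) t) \<in> borel_measurable M"
    using measurable_compose[OF borel_measurable_noise_path[OF measurable_V measurable_\<eta>_row] borel_measurable_line_path]
    by simp
  show "regularly_varying (\<lambda>u. u powr \<alpha>) \<alpha>" by (rule regularly_varying_powr)
  show "emeasure (nu_sc \<alpha> l0) (space (nu_sc \<alpha> l0)) \<noteq> 0" by (rule emeasure_nu_sc_space[OF \<alpha>])
  show "emeasure (nu_sc \<alpha> l0) {f. \<not> (\<forall>i. \<exists>t. f t $ i \<noteq> 0)} = 0"
    by (rule emeasure_nu_sc_zero_row[OF \<alpha> l0'])
  show "emeasure (nu_sc \<alpha> l0) W < \<infinity>" if "is_product_window K W" for W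
    by (rule emeasure_nu_sc_window[OF \<alpha> K that])
next
  fix F :: "(int \<Rightarrow> real^1) \<Rightarrow> real" and u :: "nat \<Rightarrow> real^1"
  assume F: "continuous_on UNIV F \<and> bounded (range F) \<and> (\<exists>W. is_product_window K W \<and> (\<forall>f. f \<notin> W \<longrightarrow> F f = 0))"
    and "(\<forall>n i. u n $ i > 0) \<and> filterlim (\<lambda>n. Min (range (\<lambda>i. u n $ i))) at_top sequentially"
  then have u: "\<And>n. u n $ 1 > 0" "filterlim (\<lambda>n. u n $ 1) at_top sequentially"
    using filterlim_of_Min[of u] by auto
  obtain n \<epsilon> where \<epsilon>: "\<forall>i. \<epsilon> i > 0" and F0: "\<And>f. f \<notin> product_window K n \<epsilon> \<Longrightarrow> F f = 0"
    using F by (auto simp: is_product_window_def)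
  obtain B where B: "\<And>f. \<bar>F f\<bar> \<le> B" using F by (auto simp: bounded_iff)
  have cont: "continuous_on UNIV F" using F by simp
  have F_meas: "F \<in> borel_measurable borel" by (rule borel_measurable_continuous_onI[OF cont])
  have finK: "finite (K m)" for m using K by (simp add: exhaustion_def)
  let ?Y = "\<lambda>n \<omega>. line_path (noise_path (\<lambda>t. V t \<omega>) (u n $ 1) (\<lambda>s. \<eta> i s \<omega>))"
  \<comment> \<open>The same three choices of \<phi> as for the pair give positive part, negative
    part and integrability.\<close>
  have lim: "(\<lambda>n. ennreal ((u n $ 1) powr \<alpha>) * (\<integral>\<^sup>+\<omega>. ennreal (\<phi> (F (?Y n \<omega>))) \<partial>M)) \<longlonglongrightarrow>
      (\<integral>\<^sup>+f. ennreal (\<phi> (F f)) \<partial>nu_sc \<alpha> l0)"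
    "(\<integral>\<^sup>+f. ennreal (\<phi> (F f)) \<partial>nu_sc \<alpha> l0) < \<infinity>"
    if \<phi>: "continuous_on UNIV \<phi>" "\<phi> 0 = 0" "\<And>x. \<phi> x \<le> \<bar>x\<bar>" for \<phi> :: "real \<Rightarrow> real"
  proof -
    have contH: "continuous_on UNIV (\<lambda>f. \<phi> (F f))"
      using continuous_on_compose2[OF \<phi>(1) cont] by simp
    have H: "(\<lambda>f. ennreal (\<phi> (F f))) \<in> borel_measurable borel"
      using borel_measurable_continuous_onI[OF contH] by simp
    have le: "ennreal (\<phi> (F f)) \<le> ennreal B" for f
      using order_trans[OF \<phi>(3) B] by (rule ennreal_leI)
    have supp: "ennreal (\<phi> (F f)) = 0" if "\<forall>t\<in>K (n 1). \<bar>f t $ 1\<bar> \<le> \<epsilon> 1" for f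
    proof -
      have "f \<notin> product_window K n \<epsilon>"
        using that unfolding product_window_iff[OF K] by (meson not_le)
      then show ?thesis using F0 \<phi>(2) by simp
    qed
    note * = single_limit[OF finK, of "\<epsilon> 1", OF _ H le _ supp
        tendsto_ennrealI[OF continuous_path_functional_tendsto[OF contH]] u]
    show "(\<lambda>n. ennreal ((u n $ 1) powr \<alpha>) * (\<integral>\<^sup>+\<omega>. ennreal (\<phi> (F (?Y n \<omega>))) \<partial>M)) \<longlonglongrightarrow>
      (\<integral>\<^sup>+f. ennreal (\<phi> (F f)) \<partial>nu_sc \<alpha> l0)"
      "(\<integral>\<^sup>+f. ennreal (\<phi> (F f)) \<partial>nu_sc \<alpha> l0) < \<infinity>"
      unfolding nn_integral_nu_sc[OF \<alpha> H] using * \<epsilon> by simp_all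
  qed
  have "F \<in> borel_measurable (nu_sc \<alpha> l0)"
    using F_meas unfolding measurable_cong_sets[OF sets_nu_sc refl] .
  then have int\<nu>: "integrable (nu_sc \<alpha> l0) F"
    using lim(2)[of abs] by (auto simp: integrable_iff_bounded continuous_on_rabs)
  have meas: "(\<lambda>\<omega>. F (?Y n \<omega>)) \<in> borel_measurable M" for n
    by (rule measurable_compose[OF measurable_compose[OF borel_measurable_noise_path[OF measurable_V measurable_\<eta>_row]
          borel_measurable_line_path] F_meas])
  have "(\<lambda>n. (u n $ 1) powr \<alpha> * (\<integral>\<omega>. F (?Y n \<omega>) \<partial>M)) \<longlonglongrightarrow> (\<integral>f. F f \<partial>nu_sc \<alpha> l0)"
  proof (rule integral_tendsto_of_nn_integral_tendsto[OF _ int\<nu>])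
    show "integrable M (\<lambda>\<omega>. F (?Y n \<omega>))" for n
      by (rule integrable_const_bound[where B = B]) (use B meas in auto)
    show "(\<lambda>n. ennreal ((u n $ 1) powr \<alpha>) * (\<integral>\<^sup>+\<omega>. ennreal (F (?Y n \<omega>)) \<partial>M)) \<longlonglongrightarrow>
      (\<integral>\<^sup>+f. ennreal (F f) \<partial>nu_sc \<alpha> l0)"
      using lim(1)[of "\<lambda>x. x"] by simp
    show "(\<lambda>n. ennreal ((u n $ 1) powr \<alpha>) * (\<integral>\<^sup>+\<omega>. ennreal (- F (?Y n \<omega>)) \<partial>M)) \<longlonglongrightarrow>
      (\<integral>\<^sup>+f. ennreal (- F f) \<partial>nu_sc \<alpha> l0)"
      using lim(1)[of uminus] by (simp add: continuous_on_minus abs_ge_minus_self)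
  qed simp
  then show "(\<lambda>n. (\<Prod>i\<in>UNIV. (u n $ i) powr \<alpha>) *
      (\<integral>\<omega>. F (rescale (u n) (\<lambda>t. path_row i (\<lambda>t. MA_process l0 V \<eta> t \<omega>) t)) \<partial>M)) \<longlonglongrightarrow> (\<integral>f. F f \<partial>nu_sc \<alpha> l0)"
    by (simp add: rescale_row)
qed simp

text \<open>The scalar measure is finite on one-row windows, whereas the preimage of such a window
  under the row projection has infinite \<open>nu_FV\<close> mass.\<close>

lemma row_marginal_ne_nu_sc:
  assumes K: "exhaustion K"
  shows "distr (nu_FV \<alpha> l0 w) borel (path_row i) \<noteq> nu_sc \<alpha> l0"
proof
  assume eq: "distr (nu_FV \<alpha> l0 w) borel (path_row i) = nu_sc \<alpha> l0"
  define W where "W = product_window K (\<lambda>_ :: 1. 0) (\<lambda>_. 1)"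
  have fin: "finite (K 0)" "K 0 \<noteq> {}" using K by (auto simp: exhaustion_def)
  have "path_row i \<in> borel_measurable borel"
  proof (rule measurable_into_path, rule borel_measurable_vec)
    fix t and j :: 1
    show "(\<lambda>f :: int \<Rightarrow> real^2. path_row i f t $ j) \<in> borel_measurable borel"
      unfolding path_row_def using borel_measurable_path_coordinate[of t i] by simp
  qed
  then have row: "path_row i \<in> borel_measurable (nu_FV \<alpha> l0 w)"
    using measurable_cong_sets[OF sets_nu_FV refl] by blast
  have "path_row i -` W \<inter> space (nu_FV \<alpha> l0 w) = {f. sup_on (K 0) i f > 1}"
    using fin by (auto simp: W_def product_window_iff[OF K] path_row_def sup_on_greater_iff)
  then have "emeasure (nu_sc \<alpha> l0) W = emeasure (nu_FV \<alpha> l0 w) {f. sup_on (K 0) i f > 1}"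
    unfolding eq[symmetric] using row sets_product_window[OF K]
    by (subst emeasure_distr) (simp_all add: W_def)
  also have "\<dots> = \<infinity>"
    using \<alpha> l0 w_0_pos fin by (intro emeasure_nu_FV_row_exceedance) auto
  finally have "emeasure (nu_sc \<alpha> l0) W = \<infinity>" .
  moreover have "is_product_window K W"
    unfolding is_product_window_def W_def by (intro exI[of _ "\<lambda>_. 0"] exI[of _ "\<lambda>_. 1"]) simp
  ultimately show False using emeasure_nu_sc_window[OF \<alpha> K, of W l0] by simp
qed

end

theorem mainTheorem6:
  fixes M :: "'w measure"
    and K :: "nat \<Rightarrow> int set"
    and \<alpha> :: real
    and l0 :: nat
    and V :: "int \<Rightarrow> 'w \<Rightarrow> real"
    and \<eta> :: "2 \<Rightarrow> int \<Rightarrow> 'w \<Rightarrow> real"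
  defines "X \<equiv> MA_process l0 V \<eta>"
    and "w \<equiv> w_coeff M V \<alpha>"
  assumes "prob_space M"
    and "exhaustion K"
    and "\<alpha> > 0"
    and "l0 \<ge> 2"
    and "\<And>t. AE \<omega> in M. V t \<omega> > 0"
    and "strictly_stationary M V"
    and "(\<integral>\<omega>. V 0 \<omega> powr \<alpha> \<partial>M) = 1"
    and "integrable M (\<lambda>\<omega>. V 0 \<omega> powr (2 * \<alpha>))"
    and "prob_space.indep_vars M (\<lambda>_. borel) (\<lambda>(i, s). \<eta> i s) UNIV"
    and "\<And>i s x. x \<ge> 1 \<Longrightarrow> measure M {\<omega> \<in> space M. \<eta> i s \<omega> > x} = x powr (- \<alpha>)"
    and "independent M (\<lambda>\<omega> t. V t \<omega>) (\<lambda>\<omega> i s. \<eta> i s \<omega>)"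
  shows
    "(strictly_stationary M X \<and>
      (\<forall>F \<in> borel_measurable borel. (\<integral>\<^sup>+f. F f \<partial>nu_FV \<alpha> l0 w) = FV_integral \<alpha> l0 w F) \<and>
      RV_Pi K M X (\<lambda>_. \<alpha>) (nu_FV \<alpha> l0 w) (\<lambda>_ u. u powr \<alpha>) \<and>
      (\<forall>W. is_product_window K W \<longrightarrow> finite {p. contributes l0 W p}))
     \<and>
     ((\<forall>F \<in> borel_measurable borel. (\<integral>\<^sup>+f. F f \<partial>nu_sc \<alpha> l0) = sc_integral \<alpha> l0 F) \<and>
      (\<forall>i. (\<forall>\<nu>. RV_Pi K M (\<lambda>t \<omega>. path_row i (\<lambda>t. X t \<omega>) t) (\<lambda>_. \<alpha>) \<nu> (\<lambda>_ u. u powr \<alpha>)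
                 \<longleftrightarrow> \<nu> = nu_sc \<alpha> l0) \<and>
           distr (nu_FV \<alpha> l0 w) borel (path_row i) \<noteq> nu_sc \<alpha> l0 \<and>
           (\<forall>S \<epsilon>. finite S \<and> S \<noteq> {} \<and> \<epsilon> > 0 \<longrightarrow>
              emeasure (nu_FV \<alpha> l0 w) {f. sup_on S i f > \<epsilon>} = \<infinity>)))
     \<and>
     (\<forall>l. emeasure (nu_FV \<alpha> l0 w) {f. \<bar>f 0 $ 1\<bar> > 1 \<and> \<bar>f l $ 2\<bar> > 1} =
        ennreal (\<Sum>d = - (int l0 - 1)..int l0 - 1. real_of_int (int l0 - \<bar>d\<bar>) * w (l + d)))"
proof -
  interpret moving_average M \<alpha> l0 V \<eta>
    by (rule moving_average.intro[OF assms(3)], unfold_locales) (use assms in auto)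
  have l0': "l0 > 0" using l0 by simp
  \<comment> \<open>Existence and uniqueness together turn "the scalar path-tail measure is
    \<open>nu_sc\<close>" into an equivalence.\<close>
  have row: "RV_Pi K M (\<lambda>t \<omega>. path_row i (\<lambda>t. MA_process l0 V \<eta> t \<omega>) t) (\<lambda>_. \<alpha>) \<nu> (\<lambda>_ u. u powr \<alpha>)
      \<longleftrightarrow> \<nu> = nu_sc \<alpha> l0" for i \<nu>
    using RV_Pi_MA_row[OF assms(4)] RV_Pi_unique[OF assms(4)] by blast
  show ?thesis
    unfolding X_def w_def
    by (intro conjI ballI allI impI strictly_stationary_MA nn_integral_nu_FV nn_integral_nu_sc
        RV_Pi_MA[OF assms(4)] finite_contributes[OF assms(4)] row row_marginal_ne_nu_sc[OF assms(4)]
        emeasure_nu_FV_row_exceedance anchor_mass \<alpha> l0' w_0_pos w_nonneg) auto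
qed

end
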